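(* Let $\xi$ be a positive random variable with $\mathbb{E}(\xi^\eta)<\infty$ for some $\eta>1$. Then there exists $p_c\in(0,1)$, depending only on the law of $\xi$, such that for every $p<p_c$, $$\mathbb{P}^\Lambda_p(o\leftrightarrow\infty)=0\quad\text{for }\upsilon_\xi\text{-almost every }\Lambda,$$ whereas for every $p>p_c$, $$\mathbb{P}^\Lambda_p(o\leftrightarrow\infty)>0\quad\text{for }\upsilon_\xi\text{-almost every }\Lambda.$$
   Context: Let $\xi$ be a positive random variable and let $\xi_1,\xi_2,\dots$ be i.i.d. copies of $\xi$. Set $x_0=0$ and $x_k=x_{k-1}+\xi_k$ for $k\ge1$, and let $\Lambda=\{x_0,x_1,x_2,\dots\}\subseteq\mathbb{R}$ (the environment); $\upsilon_\xi$ denotes the law of $\Lambda$. Given $\Lambda$, let $\mathcal{L}_\Lambda$ be the graph with vertex set $\{(x_i,n): i\in\mathbb{Z}_+,\ n\in\mathbb{Z}_+\}\subseteq\mathbb{R}^2$ (with $\mathbb{Z}_+=\{0,1,2,\dots\}$) and edge set $\{\{(x_i,n),(x_j,m)\}: |i-j|+|n-m|=1\}$. For $p\in[0,1]$, $\mathbb{P}^\Lambda_p$ is the probability measure on $\{0,1\}^{E(\mathcal{L}_\Lambda)}$ under which the edges are independently open with probability $p_e=p^{|e|}$, where $|e|$ is the Euclidean length of $e$ (so vertical edges have length $1$, and horizontal edges between the $i$-th and $(i+1)$-th column have length $\xi_{i+1}$). Let $o=(0,0)$ and let $\{o\leftrightarrow\infty\}$ be the event that the open cluster of $o$ (the set of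 vertices joined to $o$ by a path of open edges) is infinite. *)

theory Defs
  imports "HOL-Probability.Probability"
begin

text \<open>The environment is encoded by its gap sequence g, where g i = x_(i+1) - x_i = xi_(i+1).
  Vertex (i,n) stands for the point (x_i, n) of the lattice L_Lambda.\<close>

datatype edge = Hor nat nat
              | Ver nat nat

definition edge_length :: "(nat \<Rightarrow> real) \<Rightarrow> edge \<Rightarrow> real" where
  "edge_length g e = (case e of Hor i n \<Rightarrow> g i | Ver i n \<Rightarrow> 1)"

definition edge_ends :: "edge \<Rightarrow> (nat \<times> nat) \<times> (nat \<times> nat)" where
  "edge_ends e = (case e of Hor i n \<Rightarrow> ((i, n), (Suc i, n)) | Ver i n \<Rightarrow> ((i, n), (i, Suc n)))"

definition perc_measure :: "real \<Rightarrow> (nat \<Rightarrow> real) \<Rightarrow> (edge \<Rightarrow> bool) measure" where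
  "perc_measure p g = PiM UNIV (\<lambda>e. measure_pmf (bernoulli_pmf (p powr edge_length g e)))"

definition open_adj :: "(edge \<Rightarrow> bool) \<Rightarrow> ((nat \<times> nat) \<times> (nat \<times> nat)) set" where
  "open_adj \<omega> = {(u, v). \<exists>e. \<omega> e \<and> (edge_ends e = (u, v) \<or> edge_ends e = (v, u))}"

definition open_cluster :: "(edge \<Rightarrow> bool) \<Rightarrow> nat \<times> nat \<Rightarrow> (nat \<times> nat) set" where
  "open_cluster \<omega> v = {w. (v, w) \<in> (open_adj \<omega>)\<^sup>*}"

definition origin_percolates :: "(edge \<Rightarrow> bool) set" where
  "origin_percolates = {\<omega>. infinite (open_cluster \<omega> (0, 0))}"

definition env_law :: "'a measure \<Rightarrow> ('a \<Rightarrow> real) \<Rightarrow> (nat \<Rightarrow> real) measure" where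
  "env_law M \<xi> = PiM UNIV (\<lambda>_. distr M borel \<xi>)"

end

(*
  Both phases follow from one estimate for a subcritical percolation model on N x N in which the
  vertical edges of column i are open with probability at most 1 - exp(-s_i) and the horizontal edges
  leaving it with probability at most hb_i. For small p it is applied to the model itself (s_i is
  constant, hb_i = p^(xi_i)); for p near 1 to the planar dual (s_i = xi_i ln(1/p), hb_i = 1-p), where
  a large gap is a dual column that is easy to follow but hard to enter.

  The estimate is a renormalisation in the column index only. Let G_J(u,v) bound the expected number
  of vertices of column v reached from a vertex of column u inside the set of columns J. A level at
  which all vertical edges of J are closed cannot be crossed, so G_J <= 2 exp(sum of s over J); and
  exploring the cluster of u in an interval gives a first-exit inequality for G. At scale K blocks
  have 2^(K^2) columns; a block is good if at most one of its sub-blocks is bad and none has a large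
  sum of s. Seen from the block boundaries the first-exit inequality is that of a nearest-neighbour
  walk with tiny weights, which only loses a constant number of steps at a bad sub-block, so crossing
  a good block costs exp(-c width) with the same c at every scale. As the gaps are i.i.d. with a
  moment of order eta > 1, the failure probabilities square from one scale to the next up to large
  deviations of sums, and almost surely all blocks near the origin are eventually good. Crossing N
  columns then costs exp(-N/16) while the vertical reach within N columns is only exp(small * N).

  A single threshold exists because percolation is monotone in p (coupling by uniform variables) and
  because percolation for the shifted environment implies percolation for the environment, which by
  shift invariance and Kolmogorov's law gives a zero-one law.
*)

theory Submission
  imports Defs "HOL-Real_Asymp.Real_Asymp"
begin

section \<open>Bond percolation and the exploration inequality\<close>

text \<open>All edges between two neighbouring columns share one gap, so a bad column is bad at
  every height and independence of the environment is available only horizontally. This is why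
  heights are summed out in expectation instead of being divided into blocks. The widths
  \<open>2 ^ (K ^ 2)\<close> serve two demands. The relative loss per scale, 12 steps out of
  \<open>ratio K\<close>, has to be summable, which a fixed ratio would not give; and the pairs of
  sub-blocks must be absorbed by the squared failure probability, which asks for
  \<open>ratio K ^ 3\<close> below a small power \<alpha> of the width. With \<alpha> = (\<eta> - 1)
  / 2 the probability of a large sum, of order \<open>width K powr (1 - \<eta>)\<close>, has exactly
  the size of the square of \<open>width K powr (- \<alpha>)\<close>. The rates 1/16 and 1/256 meet
  in the dual estimate: from height n one inspects about 64 ln n columns. Leaving them costs at most
  n^(-2), while a level across them is closed with probability at least n^(-1/2), so n levels are
  hardly ever all crossed. The dual lattice crosses no vertical edge of column 0, so these edges can
  be opened independently of all dual paths.\<close>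

definition dep_on :: "'i set \<Rightarrow> (('i \<Rightarrow> bool) \<Rightarrow> bool) \<Rightarrow> bool" where
  "dep_on E P \<longleftrightarrow> (\<forall>\<omega> \<omega>'. (\<forall>e\<in>E. \<omega> e = \<omega>' e) \<longrightarrow> P \<omega> = P \<omega>')"

lemma dep_onI: "(\<And>\<omega> \<omega>'. (\<And>e. e \<in> E \<Longrightarrow> \<omega> e = \<omega>' e) \<Longrightarrow> P \<omega> \<Longrightarrow> P \<omega>') \<Longrightarrow> dep_on E P"
  unfolding dep_on_def by (metis (no_types, lifting))

lemma dep_onD: "dep_on E P \<Longrightarrow> (\<And>e. e \<in> E \<Longrightarrow> \<omega> e = \<omega>' e) \<Longrightarrow> P \<omega> = P \<omega>'"
  unfolding dep_on_def by blast

lemma dep_on_restrict: "dep_on E P \<Longrightarrow> P (restrict \<omega> E) = P \<omega>"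
  unfolding dep_on_def by (metis restrict_apply')

lemma dep_on_mono: "dep_on E P \<Longrightarrow> E \<subseteq> F \<Longrightarrow> dep_on F P"
  unfolding dep_on_def by blast

lemma dep_on_conj: "dep_on E P \<Longrightarrow> dep_on E Q \<Longrightarrow> dep_on E (\<lambda>\<omega>. P \<omega> \<and> Q \<omega>)"
proof (rule dep_onI)
  fix \<omega> \<omega>' assume *: "dep_on E P" "dep_on E Q" "P \<omega> \<and> Q \<omega>" and "\<And>e. e \<in> E \<Longrightarrow> \<omega> e = \<omega>' e"
  from dep_onD[OF *(1) this(4)] dep_onD[OF *(2) this(4)] have "P \<omega> = P \<omega>'" "Q \<omega> = Q \<omega>'" by auto
  with * show "P \<omega>' \<and> Q \<omega>'" by simp
qed

text \<open>Evaluating the predicates on restrictions allows infinite \<open>E\<close> and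
  \<open>F\<close>; percolation events read infinitely many edges, so finite locality does not
  suffice for them.\<close>

lemma (in prob_space) prob_indep_measurable:
  assumes X: "indep_vars M' X I"
    and E: "E \<subseteq> I" "F \<subseteq> I" "E \<inter> F = {}"
    and P: "{\<omega> \<in> space (PiM E M'). P \<omega>} \<in> sets (PiM E M')"
    and Q: "{\<omega> \<in> space (PiM F M'). Q \<omega>} \<in> sets (PiM F M')"
  shows "prob {x \<in> space M. P (\<lambda>e\<in>E. X e x) \<and> Q (\<lambda>e\<in>F. X e x)} =
    prob {x \<in> space M. P (\<lambda>e\<in>E. X e x)} * prob {x \<in> space M. Q (\<lambda>e\<in>F. X e x)}"
proof -
  have rv: "\<And>i. i \<in> I \<Longrightarrow> random_variable (M' i) (X i)"
    using X by (auto simp: indep_vars_def)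
  have sp: "x \<in> space M \<Longrightarrow> J \<subseteq> I \<Longrightarrow> (\<lambda>e\<in>J. X e x) \<in> space (PiM J M')" for x J
    using measurable_space[OF rv] by (auto simp: space_PiM)
  have "prob ((\<lambda>x. (\<lambda>e\<in>E. X e x, \<lambda>e\<in>F. X e x)) -`
      ({\<omega> \<in> space (PiM E M'). P \<omega>} \<times> {\<omega> \<in> space (PiM F M'). Q \<omega>}) \<inter> space M) =
    prob ((\<lambda>x. \<lambda>e\<in>E. X e x) -` {\<omega> \<in> space (PiM E M'). P \<omega>} \<inter> space M) *
    prob ((\<lambda>x. \<lambda>e\<in>F. X e x) -` {\<omega> \<in> space (PiM F M'). Q \<omega>} \<inter> space M)"
    by (rule indep_varD[OF indep_var_restrict[OF X E(3,1,2)] P Q])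
  moreover have "(\<lambda>x. (\<lambda>e\<in>E. X e x, \<lambda>e\<in>F. X e x)) -`
      ({\<omega> \<in> space (PiM E M'). P \<omega>} \<times> {\<omega> \<in> space (PiM F M'). Q \<omega>}) \<inter> space M =
      {x \<in> space M. P (\<lambda>e\<in>E. X e x) \<and> Q (\<lambda>e\<in>F. X e x)}"
    using sp[OF _ E(1)] sp[OF _ E(2)] by auto
  moreover have "(\<lambda>x. \<lambda>e\<in>E. X e x) -` {\<omega> \<in> space (PiM E M'). P \<omega>} \<inter> space M =
      {x \<in> space M. P (\<lambda>e\<in>E. X e x)}"
    using sp[OF _ E(1)] by auto
  moreover have "(\<lambda>x. \<lambda>e\<in>F. X e x) -` {\<omega> \<in> space (PiM F M'). Q \<omega>} \<inter> space M =
      {x \<in> space M. Q (\<lambda>e\<in>F. X e x)}"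
    using sp[OF _ E(2)] by auto
  ultimately show ?thesis by simp
qed

lemma sets_PiM_bool_finite:
  assumes "finite E"
  shows "A \<subseteq> extensional E \<Longrightarrow> A \<in> sets (PiM E (\<lambda>_. count_space (UNIV :: bool set)))"
  using count_space_PiM_finite[OF assms, of "\<lambda>_. UNIV :: bool set"]
  by (simp add: PiE_def)

lemma pred_dep_on:
  assumes "finite E" "dep_on E P" and X: "\<And>e. X e \<in> measurable M (count_space UNIV)"
  shows "Measurable.pred M (\<lambda>x. P (\<lambda>e. X e x))"
proof -
  have "(\<lambda>x. \<lambda>e\<in>E. X e x) \<in> measurable M (PiM E (\<lambda>_. count_space (UNIV :: bool set)))"
    using X by (intro measurable_restrict) auto
  from measurable_sets[OF this sets_PiM_bool_finite[OF assms(1), of "{\<omega>\<in>extensional E. P \<omega>}"]]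
  have "(\<lambda>x. \<lambda>e\<in>E. X e x) -` {\<omega>\<in>extensional E. P \<omega>} \<inter> space M \<in> sets M" by auto
  also have "(\<lambda>x. \<lambda>e\<in>E. X e x) -` {\<omega>\<in>extensional E. P \<omega>} \<inter> space M = {x \<in> space M. P (\<lambda>e. X e x)}"
    using dep_on_restrict[OF assms(2)] by auto
  finally show ?thesis by (simp add: pred_def)
qed

text \<open>Edge states are random variables on an arbitrary space, so that a configuration and its
  planar dual can be functions of the same uniform variables.\<close>

locale indep_bools = prob_space M for M :: "'a measure" +
  fixes X :: "'i \<Rightarrow> 'a \<Rightarrow> bool"
  assumes indep_X: "indep_vars (\<lambda>_. count_space UNIV) X UNIV"
begin

abbreviation Prob :: "(('i \<Rightarrow> bool) \<Rightarrow> bool) \<Rightarrow> real" where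
  "Prob P \<equiv> prob {x \<in> space M. P (\<lambda>e. X e x)}"

lemma rv_X [measurable]: "X e \<in> measurable M (count_space UNIV)"
  using indep_X by (auto simp: indep_vars_def)

text \<open>Over a finite index set every set of Boolean families is measurable, so locality
  replaces all measurability hypotheses.\<close>

lemma Prob_conj_dep_on:
  assumes "finite E" "finite F" "E \<inter> F = {}" "dep_on E P" "dep_on F Q"
  shows "Prob (\<lambda>\<omega>. P \<omega> \<and> Q \<omega>) = Prob P * Prob Q"
  using prob_indep_measurable[OF indep_X subset_UNIV subset_UNIV assms(3), of P Q]
    sets_PiM_bool_finite[OF assms(1)] sets_PiM_bool_finite[OF assms(2)]
    dep_on_restrict[OF assms(4)] dep_on_restrict[OF assms(5)]
  by (auto simp: space_PiM PiE_def)

lemma events_dep_on: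
  assumes "finite E" "dep_on E P"
  shows "{x \<in> space M. P (\<lambda>e. X e x)} \<in> events"
  using pred_dep_on[OF assms rv_X] by (rule predE)

end

section \<open>Connections inside a vertex set\<close>

definition edges_in :: "(nat \<times> nat) set \<Rightarrow> edge set" where
  "edges_in A = {e. fst (edge_ends e) \<in> A \<and> snd (edge_ends e) \<in> A}"

definition conn :: "(edge \<Rightarrow> bool) \<Rightarrow> (nat \<times> nat) set \<Rightarrow> nat \<times> nat \<Rightarrow> nat \<times> nat \<Rightarrow> bool" where
  "conn \<omega> A x y \<longleftrightarrow> x \<in> A \<and> (x, y) \<in> (open_adj \<omega> \<inter> A \<times> A)\<^sup>*"

definition incident :: "edge \<Rightarrow> nat \<times> nat \<Rightarrow> nat \<times> nat \<Rightarrow> bool" where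
  "incident e u v \<longleftrightarrow> edge_ends e = (u, v) \<or> edge_ends e = (v, u)"

lemma open_adj_iff: "(u, v) \<in> open_adj \<omega> \<longleftrightarrow> (\<exists>e. \<omega> e \<and> incident e u v)"
  by (auto simp: open_adj_def incident_def)

lemma open_adj_sym: "(u, v) \<in> open_adj \<omega> \<Longrightarrow> (v, u) \<in> open_adj \<omega>"
  by (auto simp: open_adj_def)

lemma edge_ends_inject: "edge_ends e = edge_ends f \<Longrightarrow> e = f"
  by (cases e; cases f; auto simp: edge_ends_def)

lemma finite_edges_in: "finite A \<Longrightarrow> finite (edges_in A)"
proof -
  assume "finite A"
  have "edge_ends ` edges_in A \<subseteq> A \<times> A"
    by (auto simp: edges_in_def) (metis fst_conv snd_conv)+
  then have "finite (edge_ends ` edges_in A)"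
    using \<open>finite A\<close> by (meson finite_SigmaI finite_subset)
  then show ?thesis
    by (rule finite_imageD) (auto intro: inj_onI edge_ends_inject)
qed

lemma connD: "conn \<omega> A x y \<Longrightarrow> x \<in> A \<and> y \<in> A"
  unfolding conn_def by (auto elim: rtranclE)

lemma conn_refl: "x \<in> A \<Longrightarrow> conn \<omega> A x x"
  by (simp add: conn_def)

lemma conn_step: "conn \<omega> A x y \<Longrightarrow> (y, z) \<in> open_adj \<omega> \<Longrightarrow> z \<in> A \<Longrightarrow> conn \<omega> A x z"
  using connD[of \<omega> A x y] by (auto simp: conn_def intro: rtrancl_into_rtrancl)

lemma conn_trans: "conn \<omega> A x y \<Longrightarrow> conn \<omega> A y z \<Longrightarrow> conn \<omega> A x z"
  by (auto simp: conn_def)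

lemma conn_induct [consumes 1, case_names refl step]:
  assumes "conn \<omega> A x y"
    and "x \<in> A \<Longrightarrow> P x"
    and "\<And>y z. conn \<omega> A x y \<Longrightarrow> P y \<Longrightarrow> (y, z) \<in> open_adj \<omega> \<Longrightarrow> y \<in> A \<Longrightarrow> z \<in> A \<Longrightarrow> P z"
  shows "P y"
proof -
  have x: "x \<in> A" and r: "(x, y) \<in> (open_adj \<omega> \<inter> A \<times> A)\<^sup>*"
    using assms(1) by (auto simp: conn_def)
  from r show ?thesis
  proof (induction rule: rtrancl_induct)
    case base
    show ?case by (rule assms(2)[OF x])
  next
    case (step y z)
    show ?case
      by (rule assms(3)[of y]) (use step x in \<open>auto simp: conn_def\<close>)
  qed
qed

lemma conn_mono: "conn \<omega> A x y \<Longrightarrow> A \<subseteq> B \<Longrightarrow> conn \<omega> B x y"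
  unfolding conn_def using rtrancl_mono[of "open_adj \<omega> \<inter> A \<times> A" "open_adj \<omega> \<inter> B \<times> B"] by blast

lemma conn_sym: "conn \<omega> A x y \<Longrightarrow> conn \<omega> A y x"
proof (induction rule: conn_induct)
  case (step y z)
  have "conn \<omega> A z y"
    using step conn_step[of \<omega> A z z y] by (auto intro: conn_refl open_adj_sym)
  with step show ?case by (blast intro: conn_trans)
qed (rule conn_refl)

lemma dep_on_conn: "dep_on (edges_in A) (\<lambda>\<omega>. conn \<omega> A x y)"
proof (rule dep_onI)
  fix \<omega> \<omega>' assume eq: "\<And>e. e \<in> edges_in A \<Longrightarrow> \<omega> e = \<omega>' e" and "conn \<omega> A x y"
  from this(2) show "conn \<omega>' A x y"
  proof (induction rule: conn_induct)
    case (step y z)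
    then obtain e where "\<omega> e" "incident e y z" by (auto simp: open_adj_iff)
    moreover from this have "e \<in> edges_in A"
      using step by (auto simp: edges_in_def incident_def)
    ultimately have "(y, z) \<in> open_adj \<omega>'" using eq by (auto simp: open_adj_iff)
    with step show ?case by (blast intro: conn_step)
  qed (rule conn_refl)
qed

definition cluster :: "(edge \<Rightarrow> bool) \<Rightarrow> (nat \<times> nat) set \<Rightarrow> nat \<times> nat \<Rightarrow> (nat \<times> nat) set" where
  "cluster \<omega> A x = {y. conn \<omega> A x y}"

text \<open>The open edges inside \<open>c\<close> show that \<open>c\<close> is reached, the closed
  edges from \<open>c\<close> to the rest of \<open>D\<close> show that nothing else is. Edges that
  avoid \<open>c\<close> stay unexplored, hence independent of this event.\<close>

lemma dep_on_cluster_eq: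
  "dep_on {e \<in> edges_in D. fst (edge_ends e) \<in> c \<or> snd (edge_ends e) \<in> c} (\<lambda>\<omega>. cluster \<omega> D x = c)"
    (is "dep_on ?E _")
proof (rule dep_onI)
  fix \<omega> \<omega>' assume eq: "\<And>e. e \<in> ?E \<Longrightarrow> \<omega> e = \<omega>' e" and c: "cluster \<omega> D x = c"
  have adj: "(y, z) \<in> open_adj \<omega> \<longleftrightarrow> (y, z) \<in> open_adj \<omega>'" if "y \<in> c" "y \<in> D" "z \<in> D" for y z
  proof -
    have "e \<in> ?E" if "incident e y z" for e
      using that \<open>y \<in> c\<close> \<open>y \<in> D\<close> \<open>z \<in> D\<close> by (auto simp: edges_in_def incident_def)
    then show ?thesis using eq by (auto simp: open_adj_iff)
  qed
  have "conn \<omega>' D x y" if "conn \<omega> D x y" for y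
    using that
  proof (induction rule: conn_induct)
    case (step y z)
    have "y \<in> c" using step c by (auto simp: cluster_def)
    then have "(y, z) \<in> open_adj \<omega>'" using adj step by blast
    with step show ?case by (blast intro: conn_step)
  qed (rule conn_refl)
  moreover have "conn \<omega> D x y" if "conn \<omega>' D x y" for y
    using that
  proof (induction rule: conn_induct)
    case (step y z)
    have "y \<in> c" using step c by (auto simp: cluster_def)
    then have "(y, z) \<in> open_adj \<omega>" using adj step by blast
    with step show ?case by (blast intro: conn_step)
  qed (rule conn_refl)
  ultimately show "cluster \<omega>' D x = c" using c by (auto simp: cluster_def)
qed

text \<open>The path is cut at its last exit from the cluster of x in D.\<close>

lemma conn_last_exit:
  assumes "conn \<omega> A x y" "D \<subseteq> A" "x \<in> D"
  shows "conn \<omega> D x y \<or> (\<exists>e u v. conn \<omega> D x u \<and> v \<in> A - D \<and> incident e u v \<and> \<omega> e \<and>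
    conn \<omega> (A - cluster \<omega> D x) v y)"
  using assms(1)
proof (induction rule: conn_induct)
  case refl
  then show ?case using assms(3) by (simp add: conn_refl)
next
  case (step y z)
  show ?case
  proof (cases "conn \<omega> D x z")
    case nz: False
    show ?thesis
    proof (cases "conn \<omega> D x y")
      case True
      then have "z \<notin> D" using nz step by (blast intro: conn_step)
      moreover obtain e where "\<omega> e" "incident e y z" using step by (auto simp: open_adj_iff)
      moreover have "conn \<omega> (A - cluster \<omega> D x) z z"
        using nz step by (auto simp: cluster_def intro: conn_refl)
      ultimately show ?thesis using True step by blast
    next
      case False
      then obtain e u v where *: "conn \<omega> D x u" "v \<in> A - D" "incident e u v" "\<omega> e"
        "conn \<omega> (A - cluster \<omega> D x) v y"
        using step by blast
      then have "conn \<omega> (A - cluster \<omega> D x) v z"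
        using nz step by (auto simp: cluster_def intro: conn_step)
      with * show ?thesis by blast
    qed
  qed simp
qed

section \<open>Restricted two-point functions\<close>

locale bond_percolation = indep_bools M X for M :: "'a measure" and X :: "edge \<Rightarrow> 'a \<Rightarrow> bool"
begin

definition tau :: "(nat \<times> nat) set \<Rightarrow> nat \<times> nat \<Rightarrow> nat \<times> nat \<Rightarrow> real" where
  "tau A x y = Prob (\<lambda>\<omega>. conn \<omega> A x y)"

lemma tau_nonneg: "0 \<le> tau A x y" by (simp add: tau_def)

lemma tau_outside: "x \<notin> A \<or> y \<notin> A \<Longrightarrow> tau A x y = 0"
proof -
  assume "x \<notin> A \<or> y \<notin> A"
  then have "\<not> conn \<omega> A x y" for \<omega> using connD by blast
  then show ?thesis by (simp add: tau_def)
qed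

lemma events_conn: "finite A \<Longrightarrow> {w \<in> space M. conn (\<lambda>e. X e w) A x y} \<in> events"
  by (rule events_dep_on[OF finite_edges_in dep_on_conn])

lemma events_cluster_eq: "finite D \<Longrightarrow> {w \<in> space M. cluster (\<lambda>e. X e w) D x = c} \<in> events"
  by (rule events_dep_on[OF _ dep_on_cluster_eq]) (simp add: finite_edges_in)

lemma tau_mono: "A \<subseteq> B \<Longrightarrow> finite B \<Longrightarrow> tau A x y \<le> tau B x y"
  unfolding tau_def by (rule finite_measure_mono) (auto intro: conn_mono events_conn)

text \<open>Three disjoint edge sets decide the three conditions: edges of \<open>D\<close> touching
  \<open>c\<close>, the edge \<open>e\<close> leaving \<open>D\<close>, and edges of
  \<open>A - c\<close>. This is the reason for avoiding the whole cluster after its last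
  exit.\<close>

lemma Prob_exit:
  assumes A: "finite A" and D: "D \<subseteq> A" and u: "u \<in> c" "c \<subseteq> D" and v: "v \<in> A - D" and e: "incident e u v"
  shows "Prob (\<lambda>\<omega>. cluster \<omega> D x = c \<and> \<omega> e \<and> conn \<omega> (A - c) v y)
    \<le> Prob (\<lambda>\<omega>. cluster \<omega> D x = c) * (Prob (\<lambda>\<omega>. \<omega> e) * tau A v y)"
proof -
  let ?E = "{e \<in> edges_in D. fst (edge_ends e) \<in> c \<or> snd (edge_ends e) \<in> c}"
  have fin: "finite (edges_in D)" "finite (edges_in (A - c))"
    using A D by (auto intro: finite_edges_in finite_subset)
  have d: "dep_on {e} (\<lambda>\<omega>. \<omega> e)" by (simp add: dep_on_def)
  have e1: "e \<notin> edges_in (A - c)" using e u by (auto simp: edges_in_def incident_def)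
  have e2: "e \<notin> edges_in D" using e v by (auto simp: edges_in_def incident_def)
  have "Prob (\<lambda>\<omega>. cluster \<omega> D x = c \<and> (\<omega> e \<and> conn \<omega> (A - c) v y))
    = Prob (\<lambda>\<omega>. cluster \<omega> D x = c) * Prob (\<lambda>\<omega>. \<omega> e \<and> conn \<omega> (A - c) v y)"
  proof (rule Prob_conj_dep_on)
    show "dep_on (insert e (edges_in (A - c))) (\<lambda>\<omega>. \<omega> e \<and> conn \<omega> (A - c) v y)"
      by (intro dep_on_conj dep_on_mono[OF d] dep_on_mono[OF dep_on_conn]) auto
    show "?E \<inter> insert e (edges_in (A - c)) = {}"
      using e1 e2 by (auto simp: edges_in_def)
  qed (use fin in \<open>auto intro: dep_on_cluster_eq\<close>)
  also have "Prob (\<lambda>\<omega>. \<omega> e \<and> conn \<omega> (A - c) v y) = Prob (\<lambda>\<omega>. \<omega> e) * tau (A - c) v y"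
    unfolding tau_def by (rule Prob_conj_dep_on[OF _ _ _ d dep_on_conn]) (use fin e1 in auto)
  finally show ?thesis
    using A by (auto intro!: mult_left_mono tau_mono)
qed

text \<open>A Simon-Lieb inequality. Obtained without any correlation inequality, by conditioning on
  the cluster of \<open>x\<close> in \<open>D\<close>.\<close>

lemma tau_first_exit:
  assumes A: "finite A" and D: "D \<subseteq> A" and x: "x \<in> D"
    and B: "finite B" "\<And>e u v. u \<in> D \<Longrightarrow> v \<in> A - D \<Longrightarrow> incident e u v \<Longrightarrow> (e, u, v) \<in> B"
    and B': "\<And>e u v. (e, u, v) \<in> B \<Longrightarrow> u \<in> D \<and> v \<notin> D \<and> incident e u v"
  shows "tau A x y \<le> tau D x y + (\<Sum>(e, u, v)\<in>B. tau D x u * (Prob (\<lambda>\<omega>. \<omega> e) * tau A v y))"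
proof -
  have fD: "finite D" using A D by (rule finite_subset[rotated])
  define T where "T = (\<lambda>(e, u :: nat \<times> nat, v). {w \<in> space M. conn (\<lambda>e. X e w) D x u \<and> X e w \<and>
    conn (\<lambda>e. X e w) (A - cluster (\<lambda>e. X e w) D x) v y})"
  define S where "S = (\<lambda>c (e, u :: nat \<times> nat, v). {w \<in> space M. cluster (\<lambda>e. X e w) D x = c \<and> X e w \<and>
    conn (\<lambda>e. X e w) (A - c) v y})"
  have S_ev: "S c t \<in> events" for c t
  proof -
    obtain e u v where t: "t = (e, u, v)" by (cases t)
    have "S c t = {w \<in> space M. cluster (\<lambda>e. X e w) D x = c} \<inter> {w \<in> space M. X e w} \<inter>
        {w \<in> space M. conn (\<lambda>e. X e w) (A - c) v y}"
      by (auto simp: S_def t)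
    also have "\<dots> \<in> events"
      using A by (intro sets.Int events_cluster_eq events_conn fD) auto
    finally show ?thesis .
  qed
  have T_eq: "T (e, u, v) = (\<Union>c\<in>{c \<in> Pow D. u \<in> c}. S c (e, u, v))" for e u v
    by (auto simp: T_def S_def cluster_def dest: connD)
  have T_ev: "T t \<in> events" for t
    using fD by (cases t) (auto simp: T_eq intro!: sets.finite_UN S_ev)
  have T_le: "prob (T (e, u, v)) \<le> tau D x u * (Prob (\<lambda>\<omega>. \<omega> e) * tau A v y)" if t: "(e, u, v) \<in> B" for e u v
  proof (cases "v \<in> A")
    case v: True
    have fin: "finite {c \<in> Pow D. u \<in> c}" using fD by simp
    have "prob (T (e, u, v)) \<le> (\<Sum>c\<in>{c \<in> Pow D. u \<in> c}. prob (S c (e, u, v)))"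
      unfolding T_eq by (intro finite_measure_subadditive_finite fin) (auto intro: S_ev)
    also have "\<dots> \<le> (\<Sum>c\<in>{c \<in> Pow D. u \<in> c}.
        Prob (\<lambda>\<omega>. cluster \<omega> D x = c) * (Prob (\<lambda>\<omega>. \<omega> e) * tau A v y))"
      using B'[OF t] v by (intro sum_mono) (auto simp: S_def intro!: Prob_exit A D)
    also have "\<dots> = (\<Sum>c\<in>{c \<in> Pow D. u \<in> c}. Prob (\<lambda>\<omega>. cluster \<omega> D x = c)) * (Prob (\<lambda>\<omega>. \<omega> e) * tau A v y)"
      by (simp add: sum_distrib_right)
    \<comment> \<open>The events that the cluster equals \<open>c\<close> are disjoint, and those
      with \<open>u \<in> c\<close> together form the connection from \<open>x\<close> to
      \<open>u\<close>.\<close>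
    also have "(\<Sum>c\<in>{c \<in> Pow D. u \<in> c}. Prob (\<lambda>\<omega>. cluster \<omega> D x = c)) =
       prob (\<Union>c\<in>{c \<in> Pow D. u \<in> c}. {w \<in> space M. cluster (\<lambda>e. X e w) D x = c})"
      by (rule finite_measure_finite_Union[symmetric])
        (use fin in \<open>auto simp: disjoint_family_on_def intro: events_cluster_eq[OF fD]\<close>)
    also have "(\<Union>c\<in>{c \<in> Pow D. u \<in> c}. {w \<in> space M. cluster (\<lambda>e. X e w) D x = c}) =
       {w \<in> space M. conn (\<lambda>e. X e w) D x u}"
      by (auto simp: cluster_def dest: connD)
    finally show ?thesis by (simp add: tau_def)
  next
    \<comment> \<open>\<open>B\<close> may be larger than the boundary within \<open>A\<close>: ends
      outside \<open>A\<close> contribute nothing.\<close>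
    case False
    then have "T (e, u, v) = {}" by (auto simp: T_def dest: connD)
    then show ?thesis by (simp add: tau_nonneg)
  qed
  have "tau A x y \<le> prob ({w \<in> space M. conn (\<lambda>e. X e w) D x y} \<union> (\<Union>t\<in>B. T t))"
    unfolding tau_def
  proof (rule finite_measure_mono)
    show "{w \<in> space M. conn (\<lambda>e. X e w) A x y} \<subseteq>
        {w \<in> space M. conn (\<lambda>e. X e w) D x y} \<union> (\<Union>t\<in>B. T t)"
    proof safe
      fix w assume w: "w \<in> space M" and c: "conn (\<lambda>e. X e w) A x y" and n: "w \<notin> (\<Union>t\<in>B. T t)"
      show "conn (\<lambda>e. X e w) D x y"
        using conn_last_exit[OF c D x]
      proof
        assume "\<exists>e u v. conn (\<lambda>e. X e w) D x u \<and> v \<in> A - D \<and> incident e u v \<and> X e w \<and>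
          conn (\<lambda>e. X e w) (A - cluster (\<lambda>e. X e w) D x) v y"
        then obtain e u v where *: "conn (\<lambda>e. X e w) D x u" "v \<in> A - D" "incident e u v" "X e w"
          "conn (\<lambda>e. X e w) (A - cluster (\<lambda>e. X e w) D x) v y" by blast
        then have "(e, u, v) \<in> B" by (intro B(2)) (auto dest: connD)
        moreover have "w \<in> T (e, u, v)" using * w by (simp add: T_def)
        ultimately show ?thesis using n by blast
      qed
    qed
  qed (auto intro!: sets.Un sets.finite_UN T_ev events_conn fD B(1))
  also have "\<dots> \<le> prob {w \<in> space M. conn (\<lambda>e. X e w) D x y} + prob (\<Union>t\<in>B. T t)"
    by (intro measure_Un_le sets.finite_UN T_ev events_conn fD B(1))
  also have "prob (\<Union>t\<in>B. T t) \<le> (\<Sum>t\<in>B. prob (T t))"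
    by (intro finite_measure_subadditive_finite B(1)) (auto intro: T_ev)
  also have "\<dots> \<le> (\<Sum>(e, u, v)\<in>B. tau D x u * (Prob (\<lambda>\<omega>. \<omega> e) * tau A v y))"
    using T_le by (intro sum_mono) auto
  finally show ?thesis by (simp add: tau_def)
qed

end

section \<open>Column sums of connection probabilities\<close>

text \<open>Applied to the largest ratio \<open>m\<close> of \<open>f\<close> to
  \<open>\<phi>\<close>, the self-improvement gives \<open>m \<le> max 1 m / 2\<close>, which
  excludes \<open>m > 1\<close>. The factor \<rho> is at least 1 because fixed boundary values do
  not shrink with it.\<close>

lemma max_principle:
  fixes f \<phi> :: "'i \<Rightarrow> real"
  assumes "finite A" and pos: "\<And>i. i \<in> A \<Longrightarrow> 0 < \<phi> i"
    and step: "\<And>\<rho> i. 1 \<le> \<rho> \<Longrightarrow> (\<And>j. j \<in> A \<Longrightarrow> f j \<le> \<rho> * \<phi> j) \<Longrightarrow> i \<in> A \<Longrightarrow> f i \<le> \<rho> / 2 * \<phi> i"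
    and i: "i \<in> A"
  shows "f i \<le> \<phi> i"
proof -
  define m where "m = Max ((\<lambda>i. f i / \<phi> i) ` A)"
  define \<rho> where "\<rho> = max 1 m"
  have fm: "f j / \<phi> j \<le> m" if "j \<in> A" for j
    unfolding m_def using \<open>finite A\<close> that by simp
  have f\<rho>: "f j \<le> \<rho> * \<phi> j" if "j \<in> A" for j
  proof -
    have "f j / \<phi> j \<le> \<rho>" using fm[OF that] by (simp add: \<rho>_def)
    then show ?thesis using pos[OF that] by (simp add: pos_divide_le_eq)
  qed
  have "f j / \<phi> j \<le> \<rho> / 2" if "j \<in> A" for j
    using step[of \<rho> j, OF _ f\<rho> that] pos[OF that] by (simp add: \<rho>_def field_simps)
  then have "m \<le> \<rho> / 2"
    unfolding m_def using \<open>finite A\<close> i by (subst Max_le_iff) auto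
  then have "\<rho> = 1" by (auto simp: \<rho>_def)
  with f\<rho>[OF i] show ?thesis by simp
qed

text \<open>A function dominated by a weakly coupled nearest-neighbour walk on an interval, absorbed at
  the right end. Sites of R (the neighbourhoods of bad blocks) may be crossed at a bounded cost,
  all others outside W gain a factor 4 x.\<close>

lemma walk_bound:
  fixes f :: "nat \<Rightarrow> real" and p q :: nat
  assumes x: "0 < x" and \<Omega>: "1 \<le> \<Omega>" and x\<Omega>: "16 * x * \<Omega> \<le> 1"
    and f: "f p = 0" "f q = 1" and R: "R \<subseteq> {p<..<q}"
    and W: "\<And>i. p < i \<Longrightarrow> i < q \<Longrightarrow> i \<in> R \<or> i - 1 \<in> R \<or> i + 1 \<in> R \<Longrightarrow> i \<in> W"
    and normal: "\<And>i. p < i \<Longrightarrow> i < q \<Longrightarrow> i \<notin> R \<Longrightarrow> f i \<le> x * (f (i - 1) + f (i + 1))"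
    and abnormal: "\<And>i. i \<in> R \<Longrightarrow> \<exists>lo hi. p \<le> lo \<and> lo < i \<and> i < hi \<and> hi \<le> q \<and> lo \<notin> R \<and> hi \<notin> R \<and>
      {lo<..<hi} \<subseteq> R \<and> f i \<le> \<Omega> * (f lo + f hi)"
    and i: "p < i" "i < q"
  shows "f i \<le> (4 * x) ^ card ({i..<q} - W) * (if i \<in> R then 4 * \<Omega> else 1)"
proof -
  \<comment> \<open>\<open>n i\<close> counts the sites from \<open>i\<close> on that still earn a
    factor \<open>y\<close>. At such a site the neighbours contribute at most x * (y ^ n + y ^ (n -
    1)), which is at most y ^ n / 2 for \<open>y = 4 * x\<close>; the weight
    \<open>4 * \<Omega>\<close> on \<open>R\<close> yields the same factor 1/2 for a jump.\<close>
  define y where "y = 4 * x"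
  define n where "n i = card ({i..<q} - W)" for i
  define \<phi> where "\<phi> i = y ^ n i * (if i \<in> R then 4 * \<Omega> else 1)" for i
  have xs: "x \<le> 1 / 16"
  proof -
    have "x * 1 \<le> x * \<Omega>" using x \<Omega> by (intro mult_left_mono) auto
    then show ?thesis using x\<Omega> by simp
  qed
  have y: "0 < y" "y \<le> 1 / 4" using x xs by (auto simp: y_def)
  have y_anti: "y ^ b \<le> y ^ a" if "a \<le> b" for a b
    using that y by (intro power_decreasing) auto
  have n_mono: "n j \<le> n i" if "i \<le> j" for i j
    unfolding n_def using that by (intro card_mono) auto
  have pos: "0 < \<phi> i" for i using y \<Omega> by (simp add: \<phi>_def)
  have \<phi>_le: "\<phi> j \<le> 4 * \<Omega> * y ^ a" if "a \<le> n j" for j a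
  proof -
    have "\<phi> j \<le> y ^ n j * (4 * \<Omega>)" unfolding \<phi>_def using y \<Omega> by (intro mult_left_mono) auto
    also have "\<dots> \<le> y ^ a * (4 * \<Omega>)" using y_anti[OF that] \<Omega> by (intro mult_right_mono) auto
    finally show ?thesis by (simp add: mult.commute)
  qed
  have "f i \<le> \<phi> i"
  proof (rule max_principle[of "{p<..<q}"])
    fix \<rho> :: real and i
    assume \<rho>: "1 \<le> \<rho>" and fj: "\<And>j. j \<in> {p<..<q} \<Longrightarrow> f j \<le> \<rho> * \<phi> j" and i: "i \<in> {p<..<q}"
    have fb: "f j \<le> \<rho> * \<phi> j" if "p \<le> j" "j \<le> q" for j
    proof -
      have "j = p \<or> j = q \<or> j \<in> {p<..<q}" using that by auto
      moreover have "f p \<le> \<rho> * \<phi> p" using f \<rho> pos[of p] by simp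
      moreover have "q \<notin> R" using R by auto
      then have "\<phi> q = 1" by (simp add: \<phi>_def n_def)
      then have "f q \<le> \<rho> * \<phi> q" using f \<rho> by simp
      ultimately show ?thesis using fj by auto
    qed
    show "f i \<le> \<rho> / 2 * \<phi> i"
    proof (cases "i \<in> R")
      case True
      then obtain lo hi where *: "p \<le> lo" "lo < i" "i < hi" "hi \<le> q" "lo \<notin> R" "hi \<notin> R"
        "{lo<..<hi} \<subseteq> R" "f i \<le> \<Omega> * (f lo + f hi)" using abnormal by blast
      \<comment> \<open>The jump to \<open>hi\<close> passes only sites of \<open>W\<close>, so the
        power of \<open>y\<close> at \<open>hi\<close> is the one at \<open>i\<close>.\<close>
      have "{i..<hi} \<subseteq> R" using * by auto
      then have "j \<in> W" if "i \<le> j" "j < hi" for j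
        using that W[of j] R by force
      then have "{i..<q} - W = {hi..<q} - W" using * by force
      then have nh: "n hi = n i" by (simp add: n_def)
      have "\<phi> lo \<le> y ^ n i" "\<phi> hi \<le> y ^ n i"
        using * y_anti[OF n_mono[of lo i]] nh by (auto simp: \<phi>_def)
      then have "\<rho> * (\<phi> lo + \<phi> hi) \<le> \<rho> * (2 * y ^ n i)" using \<rho> by (intro mult_left_mono) auto
      moreover have "f lo + f hi \<le> \<rho> * (\<phi> lo + \<phi> hi)"
        using fb[of lo] fb[of hi] * by (simp add: algebra_simps)
      ultimately have "f lo + f hi \<le> \<rho> * (2 * y ^ n i)" by linarith
      then have "\<Omega> * (f lo + f hi) \<le> \<Omega> * (\<rho> * (2 * y ^ n i))" using \<Omega> by (intro mult_left_mono) auto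
      also have "\<dots> = \<rho> / 2 * \<phi> i" using True by (simp add: \<phi>_def)
      finally show ?thesis using * by linarith
    next
      case nR: False
      have le: "f i \<le> x * (f (i - 1) + f (i + 1))" using normal i nR by auto
      have sum: "f (i - 1) + f (i + 1) \<le> \<rho> * (\<phi> (i - 1) + \<phi> (i + 1))"
      proof -
        have "p \<le> i - 1" "i - 1 \<le> q" "p \<le> i + 1" "i + 1 \<le> q" using i by auto
        then show ?thesis using fb[of "i - 1"] fb[of "i + 1"] by (simp add: algebra_simps)
      qed
      have "x * (\<phi> (i - 1) + \<phi> (i + 1)) \<le> 1 / 2 * \<phi> i"
      proof (cases "i \<in> W")
        case True
        \<comment> \<open>A site next to \<open>R\<close> earns no factor: here the smallness of
          \<open>x\<close> is spent on the weights \<open>4 * \<Omega>\<close> of the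
          neighbours.\<close>
        have "{i..<q} - W = {i + 1..<q} - W" using True i
          by (auto simp: not_less_eq_eq le_Suc_eq) (metis le_antisym not_less_eq_eq)
        then have "n (i + 1) = n i" by (simp add: n_def)
        then have "\<phi> (i - 1) + \<phi> (i + 1) \<le> 8 * \<Omega> * y ^ n i"
          using \<phi>_le[of "n i" "i - 1"] \<phi>_le[of "n i" "i + 1"] n_mono[of "i - 1" i] by simp
        then have "x * (\<phi> (i - 1) + \<phi> (i + 1)) \<le> x * (8 * \<Omega> * y ^ n i)"
          using x by (intro mult_left_mono) auto
        also have "\<dots> = (16 * x * \<Omega>) * (1 / 2 * y ^ n i)" by simp
        also have "\<dots> \<le> 1 * (1 / 2 * y ^ n i)" using x\<Omega> y by (intro mult_right_mono) auto
        also have "\<dots> = 1 / 2 * \<phi> i" using nR by (simp add: \<phi>_def)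
        finally show ?thesis .
      next
        case False
        then have nR': "i - 1 \<notin> R" "i + 1 \<notin> R" using W[of i] i by auto
        have "{i..<q} - W = insert i ({i + 1..<q} - W)" using False i by auto
        then have n1: "n i = Suc (n (i + 1))" by (simp add: n_def)
        have "\<phi> (i - 1) \<le> y ^ n i" using nR' y_anti[OF n_mono[of "i - 1" i]] by (simp add: \<phi>_def)
        then have "x * (\<phi> (i - 1) + \<phi> (i + 1)) \<le> x * (y ^ n i + y ^ n (i + 1))"
          using nR' x by (intro mult_left_mono) (auto simp: \<phi>_def)
        also have "\<dots> = (4 * x * x + x) * y ^ n (i + 1)" by (simp add: n1 y_def algebra_simps)
        also have "\<dots> \<le> (2 * x) * y ^ n (i + 1)"
        proof (rule mult_right_mono)
          have "4 * x * x \<le> 1 * x" using xs x by (intro mult_right_mono) auto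
          then show "4 * x * x + x \<le> 2 * x" by simp
        qed (use y in simp)
        also have "\<dots> = 1 / 2 * \<phi> i" using nR by (simp add: \<phi>_def n1 y_def)
        finally show ?thesis .
      qed
      then have "\<rho> * (x * (\<phi> (i - 1) + \<phi> (i + 1))) \<le> \<rho> * (1 / 2 * \<phi> i)"
        using \<rho> by (intro mult_left_mono) auto
      moreover have "x * (f (i - 1) + f (i + 1)) \<le> x * (\<rho> * (\<phi> (i - 1) + \<phi> (i + 1)))"
        using sum x by (intro mult_left_mono) auto
      moreover have "x * (\<rho> * (\<phi> (i - 1) + \<phi> (i + 1))) = \<rho> * (x * (\<phi> (i - 1) + \<phi> (i + 1)))"
        "\<rho> * (1 / 2 * \<phi> i) = \<rho> / 2 * \<phi> i" by simp_all
      ultimately show ?thesis using le by linarith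
    qed
  qed (use pos i in auto)
  then show ?thesis by (simp add: \<phi>_def n_def y_def)
qed

text \<open>Every site of \<open>R\<close> and its two neighbours forfeit their factors, hence
  \<open>3 * c\<close>. The jumps end at the nearest sites outside \<open>R\<close>, which exist
  because \<open>p\<close> and \<open>q\<close> are outside.\<close>

lemma walk_bound_few:
  fixes f :: "nat \<Rightarrow> real" and p q :: nat
  assumes x: "0 < x" and \<Omega>: "1 \<le> \<Omega>" and x\<Omega>: "16 * x * \<Omega> \<le> 1"
    and f: "f p = 0" "f q = 1" and R: "R \<subseteq> {p<..<q}" "card R \<le> c"
    and normal: "\<And>i. p < i \<Longrightarrow> i < q \<Longrightarrow> i \<notin> R \<Longrightarrow> f i \<le> x * (f (i - 1) + f (i + 1))"
    and abnormal: "\<And>lo i hi. p \<le> lo \<Longrightarrow> lo < i \<Longrightarrow> i < hi \<Longrightarrow> hi \<le> q \<Longrightarrow> {lo<..<hi} \<subseteq> R \<Longrightarrow>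
      f i \<le> \<Omega> * (f lo + f hi)"
    and i: "p < i" "i < q"
  shows "f i \<le> (4 * x) ^ (q - i - 3 * c) * (4 * \<Omega>)"
proof -
  define W where "W = R \<union> (\<lambda>i. i + 1) ` R \<union> (\<lambda>i. i - 1) ` R"
  have fin: "finite R" using R finite_subset by blast
  have xs: "4 * x \<le> 1"
  proof -
    have "x * 1 \<le> x * \<Omega>" using x \<Omega> by (intro mult_left_mono) auto
    then show ?thesis using x\<Omega> by simp
  qed
  have "f i \<le> (4 * x) ^ card ({i..<q} - W) * (if i \<in> R then 4 * \<Omega> else 1)"
  proof (rule walk_bound[OF x \<Omega> x\<Omega> f R(1) _ normal _ i])
    fix i assume "p < i" and *: "i \<in> R \<or> i - 1 \<in> R \<or> i + 1 \<in> R"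
    then have "i = (i - 1) + 1" "i = (i + 1) - 1" by auto
    then show "i \<in> W" unfolding W_def using * by blast
  next
    fix i assume i: "i \<in> R"
    define lo where "lo = Max {j. p \<le> j \<and> j < i \<and> j \<notin> R}"
    define hi where "hi = Min {j. i < j \<and> j \<le> q \<and> j \<notin> R}"
    have pq: "p \<notin> R" "q \<notin> R" "p < i" "i < q" using R(1) i by auto
    have 1: "lo \<in> {j. p \<le> j \<and> j < i \<and> j \<notin> R}"
      unfolding lo_def by (rule Max_in) (use pq in auto)
    have 2: "hi \<in> {j. i < j \<and> j \<le> q \<and> j \<notin> R}"
      unfolding hi_def by (rule Min_in) (use pq in auto)
    have 3: "j \<in> R" if "lo < j" "j < hi" for j
    proof (rule ccontr)
      assume n: "j \<notin> R"
      then have "j \<noteq> i" using i by auto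
      then consider "j < i" | "i < j" by linarith
      then show False
      proof cases
        case 1
        then have "j \<le> lo" unfolding lo_def using n that \<open>lo \<in> _\<close> by (intro Max_ge) auto
        then show False using that by simp
      next
        case 2
        then have "hi \<le> j" unfolding hi_def using n that \<open>hi \<in> _\<close> by (intro Min_le) auto
        then show False using that by simp
      qed
    qed
    show "\<exists>lo hi. p \<le> lo \<and> lo < i \<and> i < hi \<and> hi \<le> q \<and> lo \<notin> R \<and> hi \<notin> R \<and>
      {lo<..<hi} \<subseteq> R \<and> f i \<le> \<Omega> * (f lo + f hi)"
      using 1 2 3 by (intro exI[of _ lo] exI[of _ hi] conjI abnormal) auto
  qed
  also have "\<dots> \<le> (4 * x) ^ (q - i - 3 * c) * (4 * \<Omega>)"
  proof (intro mult_mono power_decreasing)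
    have "card W \<le> 3 * card R"
      unfolding W_def using fin card_image_le[OF fin, of "\<lambda>i. i + 1"] card_image_le[OF fin, of "\<lambda>i. i - 1"]
        card_Un_le[of "R \<union> (\<lambda>i. i + 1) ` R" "(\<lambda>i. i - 1) ` R"] card_Un_le[of R "(\<lambda>i. i + 1) ` R"]
      by linarith
    moreover have "card {i..<q} - card W \<le> card ({i..<q} - W)"
      using fin by (intro diff_card_le_card_Diff) (auto simp: W_def)
    ultimately show "q - i - 3 * c \<le> card ({i..<q} - W)" using R by simp
  qed (use x xs \<Omega> in auto)
  finally show ?thesis .
qed

lemma sum_geometric_two_sided:
  fixes r :: real
  assumes "0 \<le> r" "r < 1"
  shows "(\<Sum>k\<le>H. r ^ (max h k - min h k)) \<le> 2 / (1 - r)"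
proof -
  have g: "(\<Sum>k<m. r ^ k) \<le> 1 / (1 - r)" for m
    using assms by (simp add: sum_gp_strict divide_right_mono)
  have "(\<Sum>k\<le>H. r ^ (max h k - min h k)) \<le> (\<Sum>k\<in>{..h} \<union> {h..h + H}. r ^ (max h k - min h k))"
    using assms by (intro sum_mono2) auto
  also have "\<dots> \<le> (\<Sum>k\<in>{..h}. r ^ (max h k - min h k)) + (\<Sum>k\<in>{h..h + H}. r ^ (max h k - min h k))"
    using assms by (subst sum.union_inter[symmetric]) (auto intro!: sum_nonneg)
  also have "(\<Sum>k\<in>{..h}. r ^ (max h k - min h k)) = (\<Sum>k<Suc h. r ^ k)"
    by (rule sum.reindex_bij_witness[of _ "\<lambda>k. h - k" "\<lambda>k. h - k"]) auto
  also have "(\<Sum>k\<in>{h..h + H}. r ^ (max h k - min h k)) = (\<Sum>k<Suc H. r ^ k)"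
    by (rule sum.reindex_bij_witness[of _ "\<lambda>k. h + k" "\<lambda>k. k - h"]) auto
  finally show ?thesis using g[of "Suc h"] g[of "Suc H"] by (simp add: field_simps)
qed

section \<open>Levels of vertical edges and kernels between columns\<close>

lemma conn_crosses_levels:
  assumes "conn \<omega> A x y" "A \<subseteq> J \<times> UNIV" "snd x \<le> n" "n < snd y"
  shows "\<exists>i\<in>J. \<omega> (Ver i n)"
  using assms
proof (induction arbitrary: rule: conn_induct)
  case (step y z)
  show ?case
  proof (cases "n < snd y")
    case False
    obtain e where e: "\<omega> e" "incident e y z" using step by (auto simp: open_adj_iff)
    then have "\<exists>i. e = Ver i n \<and> y = (i, n)"
      using False step by (cases e) (auto simp: incident_def edge_ends_def)
    then show ?thesis using e step by auto
  qed (use step in auto)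
qed simp

text \<open>Only upper bounds on edge probabilities are assumed. Writing the vertical one as
  \<open>1 - exp (- s i)\<close> makes the probability of a closed level at least the exponential of
  minus a sum over its columns.\<close>

locale column_percolation = bond_percolation M X
  for M :: "'a measure" and X :: "edge \<Rightarrow> 'a \<Rightarrow> bool" +
  fixes s hb :: "nat \<Rightarrow> real"
  assumes s_nonneg: "0 \<le> s i" and hb_nonneg: "0 \<le> hb i" and hb_le_1: "hb i \<le> 1"
    and Ver_le: "Prob (\<lambda>\<omega>. \<omega> (Ver i n)) \<le> 1 - exp (- s i)"
    and Hor_le: "Prob (\<lambda>\<omega>. \<omega> (Hor i n)) \<le> hb i"
begin

lemma Prob_level_blocked:
  assumes "finite J"
  shows "exp (- sum s J) \<le> Prob (\<lambda>\<omega>. \<forall>i\<in>J. \<not> \<omega> (Ver i n))"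
  using assms
proof induction
  case empty
  then show ?case by (simp add: prob_space)
next
  case (insert j J)
  have m: "{w \<in> space M. X (Ver j n) w} \<in> events" by measurable
  have "Prob (\<lambda>\<omega>. \<not> \<omega> (Ver j n)) = 1 - Prob (\<lambda>\<omega>. \<omega> (Ver j n))"
    using prob_neg[OF m] by simp
  then have 1: "exp (- s j) \<le> Prob (\<lambda>\<omega>. \<not> \<omega> (Ver j n))" using Ver_le[of j n] by simp
  have "Prob (\<lambda>\<omega>. \<forall>i\<in>insert j J. \<not> \<omega> (Ver i n)) =
    Prob (\<lambda>\<omega>. \<not> \<omega> (Ver j n) \<and> (\<forall>i\<in>J. \<not> \<omega> (Ver i n)))" by simp
  also have "\<dots> = Prob (\<lambda>\<omega>. \<not> \<omega> (Ver j n)) * Prob (\<lambda>\<omega>. \<forall>i\<in>J. \<not> \<omega> (Ver i n))"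
    by (rule Prob_conj_dep_on[of "{Ver j n}" "(\<lambda>i. Ver i n) ` J"])
      (use insert in \<open>auto simp: dep_on_def\<close>)
  also have "\<dots> \<ge> exp (- s j) * exp (- sum s J)"
    using 1 insert by (intro mult_mono) auto
  finally show ?case using insert by (simp add: exp_add[symmetric] algebra_simps)
qed

lemma Prob_levels_crossed:
  assumes J: "finite J" and T: "finite T"
  shows "Prob (\<lambda>\<omega>. \<forall>n\<in>T. \<exists>i\<in>J. \<omega> (Ver i n)) \<le> (1 - exp (- sum s J)) ^ card T"
  using T
proof induction
  case (insert t T)
  have m: "{w \<in> space M. \<forall>i\<in>J. \<not> X (Ver i t) w} \<in> events"
    using J by (intro sets.sets_Collect_finite_All) measurable
  have "Prob (\<lambda>\<omega>. \<exists>i\<in>J. \<omega> (Ver i t)) = 1 - Prob (\<lambda>\<omega>. \<forall>i\<in>J. \<not> \<omega> (Ver i t))"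
    using prob_neg[OF m] by simp
  then have 1: "Prob (\<lambda>\<omega>. \<exists>i\<in>J. \<omega> (Ver i t)) \<le> 1 - exp (- sum s J)"
    using Prob_level_blocked[OF J, of t] by simp
  have d: "dep_on ((\<lambda>(i, n). Ver i n) ` (J \<times> U)) (\<lambda>\<omega>. \<forall>n\<in>U. \<exists>i\<in>J. \<omega> (Ver i n))" for U
    by (rule dep_onI) (force simp: image_iff)
  have "Prob (\<lambda>\<omega>. \<forall>n\<in>insert t T. \<exists>i\<in>J. \<omega> (Ver i n)) =
    Prob (\<lambda>\<omega>. (\<forall>n\<in>{t}. \<exists>i\<in>J. \<omega> (Ver i n)) \<and> (\<forall>n\<in>T. \<exists>i\<in>J. \<omega> (Ver i n)))" by simp
  also have "\<dots> = Prob (\<lambda>\<omega>. \<forall>n\<in>{t}. \<exists>i\<in>J. \<omega> (Ver i n)) * Prob (\<lambda>\<omega>. \<forall>n\<in>T. \<exists>i\<in>J. \<omega> (Ver i n))"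
    by (rule Prob_conj_dep_on[OF _ _ _ d d]) (use insert J in auto)
  also have "\<dots> \<le> (1 - exp (- sum s J)) * (1 - exp (- sum s J)) ^ card T"
    using 1 insert by (intro mult_mono) (auto simp: sum_nonneg s_nonneg)
  finally show ?case using insert by simp
qed (simp add: prob_space)

lemma tau_levels:
  assumes "finite A" "finite J" "A \<subseteq> J \<times> UNIV"
  shows "tau A (u, h) (v, k) \<le> (1 - exp (- sum s J)) ^ (max h k - min h k)"
proof -
  have "{w \<in> space M. \<forall>n\<in>{min h k..<max h k}. \<exists>i\<in>J. X (Ver i n) w} \<in> events"
    using assms by (intro sets.sets_Collect_finite_All sets.sets_Collect_finite_Ex) auto
  moreover have "\<forall>n\<in>{min h k..<max h k}. \<exists>i\<in>J. \<omega> (Ver i n)"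
    if "conn \<omega> A (u, h) (v, k)" for \<omega>
  proof
    fix n assume "n \<in> {min h k..<max h k}"
    then show "\<exists>i\<in>J. \<omega> (Ver i n)"
    using that conn_crosses_levels[OF _ assms(3), of \<omega> "(u, h)" "(v, k)" n]
      conn_crosses_levels[OF conn_sym assms(3), of \<omega> "(u, h)" "(v, k)" n]
    by (cases "h \<le> k") auto
  qed
  ultimately have "tau A (u, h) (v, k) \<le> Prob (\<lambda>\<omega>. \<forall>n\<in>{min h k..<max h k}. \<exists>i\<in>J. \<omega> (Ver i n))"
    unfolding tau_def by (intro finite_measure_mono) blast+
  also have "\<dots> \<le> (1 - exp (- sum s J)) ^ card {min h k..<max h k}"
    by (rule Prob_levels_crossed) (use assms in auto)
  finally show ?thesis by simp
qed

text \<open>The height cut \<open>H\<close> keeps sums and explored clusters finite. All estimates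
  are uniform in \<open>H\<close>, and only events are later taken to the limit.\<close>

definition row :: "nat \<Rightarrow> nat set \<Rightarrow> nat \<Rightarrow> nat \<Rightarrow> nat \<Rightarrow> real" where
  "row H J u v h = (\<Sum>k\<le>H. tau (J \<times> {..H}) (u, h) (v, k))"

text \<open>As a maximal row sum, G is submultiplicative under concatenation of kernels.\<close>

definition G :: "nat \<Rightarrow> nat set \<Rightarrow> nat \<Rightarrow> nat \<Rightarrow> real" where
  "G H J u v = Max (row H J u v ` {..H})"

lemma row_le_G: "h \<le> H \<Longrightarrow> row H J u v h \<le> G H J u v"
  by (simp add: G_def)

lemma G_le: "(\<And>h. h \<le> H \<Longrightarrow> row H J u v h \<le> c) \<Longrightarrow> G H J u v \<le> c"
  by (simp add: G_def)

lemma row_nonneg: "0 \<le> row H J u v h"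
  by (simp add: row_def sum_nonneg tau_nonneg)

lemma G_nonneg: "0 \<le> G H J u v"
  using row_nonneg row_le_G[of 0 H] by (metis order_trans zero_le)

lemma G_outside: "u \<notin> J \<or> v \<notin> J \<Longrightarrow> G H J u v = 0"
proof (rule antisym[OF G_le G_nonneg])
  assume "u \<notin> J \<or> v \<notin> J"
  then have "tau (J \<times> {..H}) (u, h) (v, k) = 0" for h k by (intro tau_outside) auto
  then show "row H J u v h \<le> 0" for h by (simp add: row_def)
qed

lemma G_le_exp:
  assumes "finite J"
  shows "G H J u v \<le> 2 * exp (sum s J)"
proof (rule G_le)
  fix h
  define r where "r = 1 - exp (- sum s J)"
  have r: "0 \<le> r" "r < 1" by (auto simp: r_def sum_nonneg s_nonneg)
  have "row H J u v h \<le> (\<Sum>k\<le>H. r ^ (max h k - min h k))"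
    unfolding row_def r_def by (intro sum_mono tau_levels) (use assms in auto)
  also have "\<dots> \<le> 2 / (1 - r)" by (rule sum_geometric_two_sided[OF r])
  finally show "row H J u v h \<le> 2 * exp (sum s J)" by (simp add: r_def exp_minus divide_inverse)
qed

text \<open>The explored strip has the full height of the box, so it is left only horizontally: to
  the left from column \<open>c\<close>, unless \<open>c = 0\<close>, or to the right from column
  \<open>d\<close>.\<close>

lemma G_first_exit:
  assumes I: "finite I" and J: "{c..d} \<subseteq> I" and u: "c \<le> u" "u \<le> d"
  shows "G H I u v \<le> G H {c..d} u v +
    (if c = 0 then 0 else G H {c..d} u c * hb (c - 1) * G H I (c - 1) v) +
    G H {c..d} u d * hb d * G H I (Suc d) v"
proof (rule G_le)
  fix h assume h: "h \<le> H"
  let ?A = "I \<times> {..H}" and ?D = "{c..d} \<times> {..H}"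
  define BL where "BL = (if c = 0 then {} else (\<lambda>h. (Hor (c - 1) h, (c, h), (c - 1, h))) ` {..H})"
  define BR where "BR = (\<lambda>h. (Hor d h, (d, h), (Suc d, h))) ` {..H}"
  define F where "F y = (\<lambda>(e, u', v'). tau ?D (u, h) u' * (Prob (\<lambda>\<omega>. \<omega> e) * tau ?A v' y))" for y
  have BR0: "BL \<inter> BR = {}" by (auto simp: BL_def BR_def)
  have first: "tau ?A (u, h) y \<le> tau ?D (u, h) y + sum (F y) (BL \<union> BR)" for y
    unfolding F_def
  proof (rule tau_first_exit)
    fix e u' v' assume *: "u' \<in> ?D" "v' \<in> ?A - ?D" "incident e u' v'"
    show "(e, u', v') \<in> BL \<union> BR"
    proof (cases e)
      case (Hor i n)
      consider "u' = (i, n)" "v' = (Suc i, n)" | "v' = (i, n)" "u' = (Suc i, n)"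
        using * Hor by (auto simp: incident_def edge_ends_def)
      then show ?thesis
      proof cases
        case 1
        then have "i = d" using * by auto
        then show ?thesis using 1 * Hor by (auto simp: BR_def)
      next
        case 2
        then have "Suc i = c" using * by auto
        then show ?thesis using 2 * Hor by (auto simp: BL_def)
      qed
    next
      case (Ver i n)
      then show ?thesis using * by (auto simp: incident_def edge_ends_def)
    qed
  qed (use I J u h in \<open>auto simp: BL_def BR_def incident_def edge_ends_def split: if_splits\<close>)
  have L: "(\<Sum>k\<le>H. sum (F (v, k)) BL) \<le>
    (if c = 0 then 0 else G H {c..d} u c * hb (c - 1) * G H I (c - 1) v)"
  proof (cases "c = 0")
    case False
    have "sum (F (v, k)) BL = (\<Sum>m\<le>H. tau ?D (u, h) (c, m) * (Prob (\<lambda>\<omega>. \<omega> (Hor (c - 1) m)) * tau ?A (c - 1, m) (v, k)))" for k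
      using False by (simp add: BL_def F_def sum.reindex inj_on_def)
    then have "(\<Sum>k\<le>H. sum (F (v, k)) BL) =
      (\<Sum>m\<le>H. tau ?D (u, h) (c, m) * (Prob (\<lambda>\<omega>. \<omega> (Hor (c - 1) m)) * row H I (c - 1) v m))"
      unfolding row_def by (simp add: sum_distrib_left) (rule sum.swap)
    \<comment> \<open>The sum over final heights has become a row sum from the entry height
      \<open>m\<close>; its bound does not depend on \<open>m\<close>, so the remaining sum over
      \<open>m\<close> is a row sum as well.\<close>
    also have "\<dots> \<le> (\<Sum>m\<le>H. tau ?D (u, h) (c, m) * (hb (c - 1) * G H I (c - 1) v))"
      by (intro sum_mono mult_left_mono mult_mono Hor_le row_le_G) (auto simp: tau_nonneg hb_nonneg row_nonneg)
    also have "\<dots> = row H {c..d} u c h * (hb (c - 1) * G H I (c - 1) v)"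
      by (simp add: row_def sum_distrib_right)
    also have "\<dots> \<le> G H {c..d} u c * (hb (c - 1) * G H I (c - 1) v)"
      using h by (intro mult_right_mono row_le_G) (auto simp: hb_nonneg G_nonneg)
    finally show ?thesis using False by (simp add: mult_ac)
  qed (simp add: BL_def)
  have R: "(\<Sum>k\<le>H. sum (F (v, k)) BR) \<le> G H {c..d} u d * hb d * G H I (Suc d) v"
  proof -
    have "sum (F (v, k)) BR = (\<Sum>m\<le>H. tau ?D (u, h) (d, m) * (Prob (\<lambda>\<omega>. \<omega> (Hor d m)) * tau ?A (Suc d, m) (v, k)))" for k
      by (simp add: BR_def F_def sum.reindex inj_on_def)
    then have "(\<Sum>k\<le>H. sum (F (v, k)) BR) =
      (\<Sum>m\<le>H. tau ?D (u, h) (d, m) * (Prob (\<lambda>\<omega>. \<omega> (Hor d m)) * row H I (Suc d) v m))"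
      unfolding row_def by (simp add: sum_distrib_left) (rule sum.swap)
    also have "\<dots> \<le> (\<Sum>m\<le>H. tau ?D (u, h) (d, m) * (hb d * G H I (Suc d) v))"
      by (intro sum_mono mult_left_mono mult_mono Hor_le row_le_G) (auto simp: tau_nonneg hb_nonneg row_nonneg)
    also have "\<dots> = row H {c..d} u d h * (hb d * G H I (Suc d) v)"
      by (simp add: row_def sum_distrib_right)
    also have "\<dots> \<le> G H {c..d} u d * (hb d * G H I (Suc d) v)"
      using h by (intro mult_right_mono row_le_G) (auto simp: hb_nonneg G_nonneg)
    finally show ?thesis by (simp add: mult_ac)
  qed
  have "row H I u v h \<le> (\<Sum>k\<le>H. tau ?D (u, h) (v, k) + sum (F (v, k)) (BL \<union> BR))"
    unfolding row_def by (intro sum_mono first)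
  also have "\<dots> = row H {c..d} u v h + (\<Sum>k\<le>H. sum (F (v, k)) BL) + (\<Sum>k\<le>H. sum (F (v, k)) BR)"
    by (subst sum.union_disjoint[OF _ _ BR0]) (auto simp: BL_def BR_def row_def sum.distrib)
  also have "row H {c..d} u v h \<le> G H {c..d} u v" using h by (rule row_le_G)
  finally show "row H I u v h \<le> G H {c..d} u v +
    (if c = 0 then 0 else G H {c..d} u c * hb (c - 1) * G H I (c - 1) v) +
    G H {c..d} u d * hb d * G H I (Suc d) v"
    using L R by linarith
qed

end

section \<open>Renormalisation in the column index\<close>

definition width :: "nat \<Rightarrow> nat" where "width K = 2 ^ (K ^ 2)"
definition ratio :: "nat \<Rightarrow> nat" where "ratio K = 2 ^ (2 * K + 1)"

lemma width_Suc: "width (Suc K) = width K * ratio K"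
  by (simp add: width_def ratio_def power2_eq_square power_add[symmetric] algebra_simps)

lemma width_pos: "0 < width K" and ratio_pos: "0 < ratio K"
  by (simp_all add: width_def ratio_def)

text \<open>Block j at level k has scale k + r. T K j stands for a moderate sum of s over block j of scale K,
  G0 for an additional condition at the base scale r.\<close>

primrec good :: "(nat \<Rightarrow> nat \<Rightarrow> bool) \<Rightarrow> (nat \<Rightarrow> bool) \<Rightarrow> nat \<Rightarrow> nat \<Rightarrow> nat \<Rightarrow> bool" where
  "good T G0 r 0 j \<longleftrightarrow> G0 j \<and> T r j"
| "good T G0 r (Suc k) j \<longleftrightarrow> (\<forall>i\<in>{j * ratio (k + r)..<Suc j * ratio (k + r)}. T (k + r) i) \<and>
    card {i \<in> {j * ratio (k + r)..<Suc j * ratio (k + r)}. \<not> good T G0 r k i} \<le> 1"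

text \<open>The exponential rate decreases with the scale but stays above 1/2.\<close>

definition exit_bound :: "nat \<Rightarrow> real" where
  "exit_bound K = exp (- ((1 / 2 + (1 / 2) ^ K) * width K))"

lemma sum_blocks:
  fixes s :: "nat \<Rightarrow> real"
  assumes "a \<le> b" "\<And>j. a \<le> j \<Longrightarrow> j < b \<Longrightarrow> sum s {j * L..<Suc j * L} \<le> c"
  shows "sum s {a * L..<b * L} \<le> real (b - a) * c"
  using assms
proof (induction b rule: dec_induct)
  case (step b)
  have "sum s {a * L..<Suc b * L} = sum s {a * L..<b * L} + sum s {b * L..<Suc b * L}"
    using step by (intro sum.atLeastLessThan_concat[symmetric]) auto
  also have "\<dots> \<le> real (b - a) * c + c" using step by (intro add_mono) auto
  also have "\<dots> = real (Suc b - a) * c" using step by (simp add: Suc_diff_le algebra_simps of_nat_diff)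
  finally show ?case .
qed simp

section \<open>Walks on the block junctions\<close>

context column_percolation
begin

text \<open>The explored interval lies strictly between the junctions \<open>(i - 1) * L\<close> and
  \<open>(i + 1) * L\<close>, and each kernel is multiplied by the edge into the next junction. An
  exit thus lands exactly on a junction, and exits of successive junctions form a nearest-neighbour
  walk.\<close>

definition exits_le :: "nat \<Rightarrow> nat \<Rightarrow> real \<Rightarrow> bool" where
  "exits_le L i x \<longleftrightarrow> (\<forall>H.
     G H {(i - 1) * L + 1..(i + 1) * L - 1} (i * L) ((i - 1) * L + 1) * hb ((i - 1) * L) \<le> x \<and>
     G H {(i - 1) * L + 1..(i + 1) * L - 1} (i * L) ((i + 1) * L - 1) * hb ((i + 1) * L - 1) \<le> x)"

lemma G_junction:
  assumes L: "0 < L" and U: "finite U" "{lo * L + 1..hi * L - 1} \<subseteq> U" and i: "lo < i" "i < hi"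
  shows "G H U (i * L) v \<le> G H {lo * L + 1..hi * L - 1} (i * L) v +
    G H {lo * L + 1..hi * L - 1} (i * L) (lo * L + 1) * hb (lo * L) * G H U (lo * L) v +
    G H {lo * L + 1..hi * L - 1} (i * L) (hi * L - 1) * hb (hi * L - 1) * G H U (hi * L) v"
proof -
  have "Suc lo * L \<le> i * L" "Suc i * L \<le> hi * L" using i by (auto intro!: mult_le_mono1 simp del: mult_Suc)
  then have "lo * L + 1 \<le> i * L" "i * L \<le> hi * L - 1" "Suc (hi * L - 1) = hi * L" using L by auto
  with G_first_exit[OF U this(1,2), of H v] show ?thesis by simp
qed

lemma G_hb_le_exp: "finite J \<Longrightarrow> G H J u v * hb w \<le> 2 * exp (sum s J)"
  using mult_mono[OF G_le_exp[of J H u v] hb_le_1[of w]] hb_nonneg by simp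

lemma G_hb_blocks_le:
  fixes n :: nat and c :: real
  assumes "lo \<le> hi" "hi - lo \<le> n" "\<And>j. lo \<le> j \<Longrightarrow> j < hi \<Longrightarrow> sum s {j * L..<Suc j * L} \<le> c" "0 \<le> c"
    and J: "J \<subseteq> {lo * L..<hi * L}"
  shows "G H J u v * hb w \<le> 2 * exp (n * c)"
proof -
  have "sum s J \<le> sum s {lo * L..<hi * L}" using J s_nonneg by (intro sum_mono2) auto
  also have "\<dots> \<le> real (hi - lo) * c" by (rule sum_blocks[OF assms(1,3)])
  also have "\<dots> \<le> n * c" using assms by (intro mult_right_mono) auto
  finally have "2 * exp (sum s J) \<le> 2 * exp (n * c)" by simp
  then show ?thesis by (rule order_trans[OF G_hb_le_exp[OF finite_subset[OF J]], rotated]) simp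
qed

text \<open>The exit functions of the large interval, read at the junctions of the sub-blocks,
  satisfy the hypotheses of \<open>walk_bound_few\<close>. The lost 12 steps are 3 for each of at
  most 4 spoiled junctions.\<close>

lemma exits_le_step:
  fixes B L l :: nat and c x :: real
  defines "p \<equiv> (B - 1) * l" and "q \<equiv> (B + 1) * l"
  assumes L: "0 < L" and l: "0 < l" and B: "1 \<le> B"
    and bad: "card {i \<in> {p..<q}. bad i} \<le> 2"
    and ok: "\<And>i. p < i \<Longrightarrow> i < q \<Longrightarrow> \<not> bad (i - 1) \<Longrightarrow> \<not> bad i \<Longrightarrow> exits_le L i x"
    and sums: "\<And>j. p \<le> j \<Longrightarrow> j < q \<Longrightarrow> sum s {j * L..<Suc j * L} \<le> c" and c: "0 \<le> c"
    and x: "0 < x" "32 * x * exp (5 * c) \<le> 1"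
  shows "exits_le (L * l) B ((4 * x) ^ (l - 12) * (8 * exp (5 * c)))"
proof -
  define m where "m = B * l"
  \<comment> \<open>Junction \<open>i\<close> sees the sub-blocks \<open>i - 1\<close> and
    \<open>i\<close>, so each of the two bad sub-blocks spoils two junctions.\<close>
  define R where "R = {i \<in> {p<..<q}. bad i \<or> bad (i - 1)}"
  \<comment> \<open>A run of at most four spoiled junctions spans at most five sub-blocks, each with
    sum at most \<open>c\<close>.\<close>
  define \<Omega> where "\<Omega> = 2 * exp (5 * c)"
  have \<Omega>: "1 \<le> \<Omega>" "16 * x * \<Omega> \<le> 1" using x c by (auto simp: \<Omega>_def intro: order_trans[of _ 2])
  have pm: "p < m" "m < q" "q - m = l" "p + q = 2 * m" "m - p = l"
    using l B by (cases B; auto simp: p_def m_def q_def algebra_simps)+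
  have cardR: "card R \<le> 4"
  proof -
    let ?D = "{i \<in> {p..<q}. bad i}"
    have "R \<subseteq> ?D \<union> Suc ` ?D"
    proof
      fix i assume "i \<in> R"
      then have "i \<in> ?D \<or> i - 1 \<in> ?D \<and> i = Suc (i - 1)" by (auto simp: R_def)
      then show "i \<in> ?D \<union> Suc ` ?D" by blast
    qed
    then have "card R \<le> card (?D \<union> Suc ` ?D)" by (intro card_mono) auto
    also have "\<dots> \<le> card ?D + card (Suc ` ?D)" by (rule card_Un_le)
    also have "\<dots> \<le> 2 * card ?D" using card_image_le[of ?D Suc] by simp
    finally show ?thesis using bad by simp
  qed
  show ?thesis unfolding exits_le_def
  proof (intro allI)
    fix H
    define U where "U = {p * L + 1..q * L - 1}"
    have Lm: "a * L < b * L" "Suc a * L \<le> b * L" if "a < b" for a b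
      using that L by (auto intro!: mult_le_mono1 simp del: mult_Suc)
    have sub: "{lo * L + 1..hi * L - 1} \<subseteq> U" if "p \<le> lo" "hi \<le> q" for lo hi
      using mult_le_mono1[OF that(1), of L] diff_le_mono[OF mult_le_mono1[OF that(2), of L], of 1]
      by (auto simp: U_def)
    have J: "{lo * L + 1..hi * L - 1} \<subseteq> {lo * L..<hi * L}" if "lo < hi" for lo hi
      using Lm[OF that] by (auto simp: )
    \<comment> \<open>The end junctions are not in \<open>U\<close>, so the walk is absorbed
      there.\<close>
    have out: "G H U (p * L) v = 0" "G H U (q * L) v = 0" for v
      by (rule G_outside; use Lm[OF pm(1)] Lm[OF pm(2)] in \<open>auto simp: U_def\<close>)+
    have step: "G H U (i * L) v * h \<le> G H {lo * L + 1..hi * L - 1} (i * L) v * h +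
        G H {lo * L + 1..hi * L - 1} (i * L) (lo * L + 1) * hb (lo * L) * (G H U (lo * L) v * h) +
        G H {lo * L + 1..hi * L - 1} (i * L) (hi * L - 1) * hb (hi * L - 1) * (G H U (hi * L) v * h)"
      if "p \<le> lo" "lo < i" "i < hi" "hi \<le> q" "0 \<le> h" for lo i hi v h
    proof -
      have "finite U" by (simp add: U_def)
      from mult_right_mono[OF G_junction[OF L this sub that(2,3), of H v] that(5)] that
      show ?thesis by (simp add: algebra_simps)
    qed
    have normal: "G H {(i - 1) * L + 1..(i + 1) * L - 1} (i * L) ((i - 1) * L + 1) * hb ((i - 1) * L) \<le> x"
        "G H {(i - 1) * L + 1..(i + 1) * L - 1} (i * L) ((i + 1) * L - 1) * hb ((i + 1) * L - 1) \<le> x"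
      if "p < i" "i < q" "i \<notin> R" for i
      using ok[of i] that by (auto simp: R_def exits_le_def)
    have abn: "G H {lo * L + 1..hi * L - 1} u v * hb w \<le> \<Omega>"
      if "p \<le> lo" "lo < i" "i < hi" "hi \<le> q" "{lo<..<hi} \<subseteq> R" for lo i hi u v w
    proof -
      have "card {lo<..<hi} \<le> card R" using that by (intro card_mono) (auto simp: R_def)
      then have "hi - lo \<le> 5" using cardR by simp
      then show ?thesis unfolding \<Omega>_def
        using that G_hb_blocks_le[of lo hi 5 L c, OF _ _ sums c J] by simp
    qed
    \<comment> \<open>The value 1 at \<open>q\<close> encodes the direct term of the first-exit
      inequality. For \<open>hi = q\<close> that term is itself the exit; for smaller
      \<open>hi\<close> the target column is outside the explored interval and the term vanishes.
      \<open>fl\<close> treats the left end in the same way.\<close>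
    define fr where "fr i = (if i = q then 1 else G H U (i * L) (q * L - 1) * hb (q * L - 1))" for i
    define fl where "fl i = (if i = p then 1 else G H U (i * L) (p * L + 1) * hb (p * L))" for i
    have frn: "0 \<le> fr i" "0 \<le> fl i" for i by (auto simp: fr_def fl_def G_nonneg hb_nonneg)
    have fr: "fr i \<le> G H {lo * L + 1..hi * L - 1} (i * L) (lo * L + 1) * hb (lo * L) * fr lo +
        G H {lo * L + 1..hi * L - 1} (i * L) (hi * L - 1) * hb (hi * L - 1) * fr hi"
      if *: "p \<le> lo" "lo < i" "i < hi" "hi \<le> q" for lo i hi
    proof (cases "hi = q")
      case True
      then show ?thesis using step[OF *, of "hb (q * L - 1)" "q * L - 1"] * out hb_nonneg
        by (auto simp: fr_def)
    next
      case False
      then have "q * L - 1 \<notin> {lo * L + 1..hi * L - 1}" using Lm[of hi q] * Lm[of lo hi] L by auto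
      then have "G H {lo * L + 1..hi * L - 1} (i * L) (q * L - 1) = 0" by (intro G_outside) auto
      then show ?thesis using step[OF *, of "hb (q * L - 1)" "q * L - 1"] * False hb_nonneg
        by (auto simp: fr_def)
    qed
    have fl: "fl i \<le> G H {lo * L + 1..hi * L - 1} (i * L) (lo * L + 1) * hb (lo * L) * fl lo +
        G H {lo * L + 1..hi * L - 1} (i * L) (hi * L - 1) * hb (hi * L - 1) * fl hi"
      if *: "p \<le> lo" "lo < i" "i < hi" "hi \<le> q" for lo i hi
    proof (cases "lo = p")
      case True
      then show ?thesis using step[OF *, of "hb (p * L)" "p * L + 1"] * out hb_nonneg
        by (auto simp: fl_def)
    next
      case False
      then have "p * L + 1 \<notin> {lo * L + 1..hi * L - 1}" using Lm[of p lo] * L by auto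
      then have "G H {lo * L + 1..hi * L - 1} (i * L) (p * L + 1) = 0" by (intro G_outside) auto
      then show ?thesis using step[OF *, of "hb (p * L)" "p * L + 1"] * False hb_nonneg
        by (auto simp: fl_def)
    qed
    have "fr m \<le> (4 * x) ^ (q - m - 3 * 4) * (4 * \<Omega>)"
    proof (rule walk_bound_few[OF x(1) \<Omega> _ _ _ cardR])
      show "fr p = 0" using pm by (simp add: fr_def out)
      fix i assume i: "p < i" "i < q" "i \<notin> R"
      have "p \<le> i - 1" "i - 1 < i" "i < i + 1" "i + 1 \<le> q" using i by auto
      from fr[OF this] show "fr i \<le> x * (fr (i - 1) + fr (i + 1))"
        using mult_right_mono[OF normal(1)[OF i] frn(1)[of "i - 1"]]
          mult_right_mono[OF normal(2)[OF i] frn(1)[of "i + 1"]] by (simp add: algebra_simps)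
    next
      fix lo i hi assume *: "p \<le> lo" "lo < i" "i < hi" "hi \<le> q" "{lo<..<hi} \<subseteq> R"
      show "fr i \<le> \<Omega> * (fr lo + fr hi)"
        using fr[OF *(1-4)] mult_right_mono[OF abn[OF *] frn(1)[of lo], of "i * L" "lo * L + 1" "lo * L"]
          mult_right_mono[OF abn[OF *] frn(1)[of hi], of "i * L" "hi * L - 1" "hi * L - 1"] by (simp add: algebra_simps)
    qed (use pm in \<open>auto simp: fr_def R_def\<close>)
    \<comment> \<open>Exits to the left are handled by reflecting the walk at \<open>m\<close>,
      which exchanges \<open>p\<close> and \<open>q\<close> since
      \<open>p + q = 2 * m\<close>.\<close>
    moreover have "fl (2 * m - m) \<le> (4 * x) ^ (q - m - 3 * 4) * (4 * \<Omega>)"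
    proof (rule walk_bound_few[where f = "\<lambda>i. fl (2 * m - i)" and R = "(\<lambda>i. 2 * m - i) ` R" and p = p and c = 4, OF x(1) \<Omega>])
      have fin: "finite R" by (simp add: R_def)
      show "fl (2 * m - p) = 0" using pm out by (simp add: fl_def flip: pm(4))
      show "fl (2 * m - q) = 1" using pm by (simp add: fl_def flip: pm(4))
      show "(\<lambda>i. 2 * m - i) ` R \<subseteq> {p<..<q}" using pm by (auto simp: R_def)
      show "card ((\<lambda>i. 2 * m - i) ` R) \<le> 4" using card_image_le[OF fin, of "\<lambda>i. 2 * m - i"] cardR by linarith
      have inR: "2 * m - i \<in> R \<Longrightarrow> i \<in> (\<lambda>i. 2 * m - i) ` R" if "p \<le> i" "i \<le> q" for i
        using that pm by (intro image_eqI[of _ _ "2 * m - i"]) auto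
      have inR': "2 * m - i \<in> R" if "i \<in> (\<lambda>i. 2 * m - i) ` R" for i
        using that pm by (auto simp: R_def)
      {
        fix i assume i: "p < i" "i < q" "i \<notin> (\<lambda>i. 2 * m - i) ` R"
        define j where "j = 2 * m - i"
        have j: "p < j" "j < q" "j \<notin> R" "2 * m - (i - 1) = j + 1" "2 * m - (i + 1) = j - 1"
          using i pm inR[of i] by (auto simp: j_def)
        have "p \<le> j - 1" "j - 1 < j" "j < j + 1" "j + 1 \<le> q" using j by auto
        from fl[OF this] show "fl (2 * m - i) \<le> x * (fl (2 * m - (i - 1)) + fl (2 * m - (i + 1)))"
          using mult_right_mono[OF normal(1)[OF j(1-3)] frn(2)[of "j - 1"]]
            mult_right_mono[OF normal(2)[OF j(1-3)] frn(2)[of "j + 1"]]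
          unfolding j(4,5) j_def[symmetric] by (simp add: algebra_simps)
      }
      {
        fix lo i hi assume *: "p \<le> lo" "lo < i" "i < hi" "hi \<le> q" "{lo<..<hi} \<subseteq> (\<lambda>i. 2 * m - i) ` R"
        have **: "p \<le> 2 * m - hi" "2 * m - hi < 2 * m - i" "2 * m - i < 2 * m - lo" "2 * m - lo \<le> q"
          using * pm by auto
        have sR: "{2 * m - hi<..<2 * m - lo} \<subseteq> R"
        proof
          fix k assume k: "k \<in> {2 * m - hi<..<2 * m - lo}"
          then have "2 * m - k \<in> {lo<..<hi}" using * pm by auto
          then have "2 * m - (2 * m - k) \<in> R" using *(5) inR' by blast
          then show "k \<in> R" using k * pm by auto
        qed
        note A = abn[OF ** sR]
        show "fl (2 * m - i) \<le> \<Omega> * (fl (2 * m - lo) + fl (2 * m - hi))"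
          using fl[OF **] mult_right_mono[OF A frn(2)[of "2 * m - hi"], of "(2 * m - i) * L" "(2 * m - hi) * L + 1" "(2 * m - hi) * L"]
            mult_right_mono[OF A frn(2)[of "2 * m - lo"], of "(2 * m - i) * L" "(2 * m - lo) * L - 1" "(2 * m - lo) * L - 1"]
          by (simp add: algebra_simps)
      }
    qed (use pm in auto)
    ultimately show "G H {(B - 1) * (L * l) + 1..(B + 1) * (L * l) - 1} (B * (L * l)) ((B - 1) * (L * l) + 1) * hb ((B - 1) * (L * l))
       \<le> (4 * x) ^ (l - 12) * (8 * exp (5 * c)) \<and>
      G H {(B - 1) * (L * l) + 1..(B + 1) * (L * l) - 1} (B * (L * l)) ((B + 1) * (L * l) - 1) * hb ((B + 1) * (L * l) - 1)
       \<le> (4 * x) ^ (l - 12) * (8 * exp (5 * c))"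
    proof -
      have eq: "(B - 1) * (L * l) = p * L" "(B + 1) * (L * l) = q * L" "B * (L * l) = m * L"
        by (auto simp: p_def q_def m_def mult_ac)
      assume "fr m \<le> (4 * x) ^ (q - m - 3 * 4) * (4 * \<Omega>)" "fl (2 * m - m) \<le> (4 * x) ^ (q - m - 3 * 4) * (4 * \<Omega>)"
      then show ?thesis unfolding eq using pm
        by (simp add: fr_def fl_def U_def \<Omega>_def)
    qed
  qed
qed

text \<open>Each of the two blocks contains a column that is left with probability at most \<beta>,
  and the exit on that side has to pass it. Cutting there leaves two kernels of size at most
  \<open>2 * exp (2 * c)\<close>, unless the exit edge is itself the rare one.\<close>

lemma exits_le_base:
  fixes c \<beta> :: real
  assumes L: "0 < L" and B: "1 \<le> B"
    and sums: "\<And>j. B - 1 \<le> j \<Longrightarrow> j \<le> B \<Longrightarrow> sum s {j * L..<Suc j * L} \<le> c" and c: "0 \<le> c"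
    and gap: "\<And>j. B - 1 \<le> j \<Longrightarrow> j \<le> B \<Longrightarrow> \<exists>i\<in>{j * L..<Suc j * L}. hb i \<le> \<beta>" and \<beta>: "0 \<le> \<beta>"
  shows "exits_le L B (4 * exp (4 * c) * \<beta>)"
  unfolding exits_le_def
proof (intro allI)
  fix H
  define a e where "a = (B - 1) * L + 1" and "e = (B + 1) * L - 1"
  obtain B' where B': "B = Suc B'" using B by (cases B) auto
  have ab: "a - 1 = (B - 1) * L" "Suc e = (B + 1) * L" "a \<le> B * L" "B * L \<le> e"
    using L by (auto simp: a_def e_def B')
  have a0: "a \<noteq> 0" by (simp add: a_def)
  have G_le: "G H J u v \<le> 2 * exp (2 * c)" if "J \<subseteq> {a..e}" for J u v
  proof -
    have fin: "finite J" using that by (rule finite_subset) simp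
    have "sum s J \<le> sum s {(B - 1) * L..<(B + 1) * L}"
      using that ab s_nonneg by (intro sum_mono2) (auto simp: a_def e_def)
    also have "\<dots> \<le> real (B + 1 - (B - 1)) * c" by (rule sum_blocks) (use sums in auto)
    also have "\<dots> = 2 * c" by (simp add: B')
    finally have "2 * exp (sum s J) \<le> 2 * exp (2 * c)" by simp
    then show ?thesis by (rule order_trans[OF G_le_exp[OF fin]])
  qed
  have out: "G H {a..e} (a - 1) v = 0" "G H {a..e} (Suc e) v = 0" for v
    by (rule G_outside, simp add: a_def)+
  have fin: "2 * exp (2 * c) * hb g * (2 * exp (2 * c)) * hb h \<le> 4 * exp (4 * c) * \<beta>"
    if "hb g \<le> \<beta>" for g h
  proof -
    have "hb g * hb h \<le> \<beta> * 1" using that hb_le_1 hb_nonneg \<beta> by (intro mult_mono) auto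
    then have "4 * exp (4 * c) * (hb g * hb h) \<le> 4 * exp (4 * c) * \<beta>" by simp
    moreover have "exp (2 * c) * exp (2 * c) = exp (4 * c)" by (simp add: exp_add[symmetric])
    ultimately show ?thesis by (simp add: mult_ac)
  qed
  have fin2: "2 * exp (2 * c) * hb g \<le> 4 * exp (4 * c) * \<beta>" if "hb g \<le> \<beta>" for g
  proof -
    have "2 * exp (2 * c) \<le> 4 * exp (4 * c)" using c by (intro mult_mono) auto
    then show ?thesis using that c hb_nonneg by (intro mult_mono) auto
  qed
  have R: "G H {a..e} (B * L) e * hb e \<le> 4 * exp (4 * c) * \<beta>"
  proof -
    obtain g where g: "B * L \<le> g" "g \<le> e" "hb g \<le> \<beta>" using gap[of B] by (auto simp: e_def)
    show ?thesis
    proof (cases "g = e")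
      case True
      have "G H {a..e} (B * L) e * hb e \<le> 2 * exp (2 * c) * hb e"
        using G_le[of "{a..e}"] hb_nonneg by (intro mult_right_mono) auto
      moreover have "hb e \<le> \<beta>" using g True by simp
      ultimately show ?thesis using fin2[of e] by linarith
    next
      case False
      have "G H {a..e} (B * L) e \<le> G H {a..g} (B * L) e +
          (if a = 0 then 0 else G H {a..g} (B * L) a * hb (a - 1) * G H {a..e} (a - 1) e) +
          G H {a..g} (B * L) g * hb g * G H {a..e} (Suc g) e"
        by (rule G_first_exit) (use g ab in auto)
      also have "G H {a..g} (B * L) e = 0" using False g by (intro G_outside) auto
      finally have "G H {a..e} (B * L) e \<le> G H {a..g} (B * L) g * hb g * G H {a..e} (Suc g) e"
        using out a0 by simp
      also have "\<dots> \<le> 2 * exp (2 * c) * hb g * (2 * exp (2 * c))"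
        using g by (intro mult_mono G_le) (auto simp: hb_nonneg G_nonneg)
      finally have "G H {a..e} (B * L) e * hb e \<le> 2 * exp (2 * c) * hb g * (2 * exp (2 * c)) * hb e"
        using hb_nonneg by (intro mult_right_mono) auto
      then show ?thesis using fin[OF g(3), of e] by linarith
    qed
  qed
  have Lf: "G H {a..e} (B * L) a * hb (a - 1) \<le> 4 * exp (4 * c) * \<beta>"
  proof -
    have "B * L = (B - 1) * L + L" by (simp add: B')
    then obtain g where g: "a - 1 \<le> g" "g < B * L" "hb g \<le> \<beta>"
      using gap[of "B - 1"] by (auto simp: a_def B')
    show ?thesis
    proof (cases "g = a - 1")
      case True
      have "G H {a..e} (B * L) a * hb (a - 1) \<le> 2 * exp (2 * c) * hb (a - 1)"
        using G_le[of "{a..e}"] hb_nonneg by (intro mult_right_mono) auto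
      moreover have "hb (a - 1) \<le> \<beta>" using g True by simp
      ultimately show ?thesis using fin2[of "a - 1"] by linarith
    next
      case False
      have "G H {a..e} (B * L) a \<le> G H {Suc g..e} (B * L) a +
          (if Suc g = 0 then 0 else G H {Suc g..e} (B * L) (Suc g) * hb (Suc g - 1) * G H {a..e} (Suc g - 1) a) +
          G H {Suc g..e} (B * L) e * hb e * G H {a..e} (Suc e) a"
        by (rule G_first_exit) (use g ab in auto)
      also have "G H {Suc g..e} (B * L) a = 0" using False g by (intro G_outside) auto
      finally have "G H {a..e} (B * L) a \<le> G H {Suc g..e} (B * L) (Suc g) * hb g * G H {a..e} g a"
        using out a0 by simp
      also have "\<dots> \<le> 2 * exp (2 * c) * hb g * (2 * exp (2 * c))"
        using g False by (intro mult_mono G_le) (auto simp: hb_nonneg G_nonneg)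
      finally have "G H {a..e} (B * L) a * hb (a - 1) \<le> 2 * exp (2 * c) * hb g * (2 * exp (2 * c)) * hb (a - 1)"
        using hb_nonneg by (intro mult_right_mono) auto
      then show ?thesis using fin[OF g(3), of "a - 1"] by linarith
    qed
  qed
  show "G H {(B - 1) * L + 1..(B + 1) * L - 1} (B * L) ((B - 1) * L + 1) * hb ((B - 1) * L) \<le> 4 * exp (4 * c) * \<beta> \<and>
    G H {(B - 1) * L + 1..(B + 1) * L - 1} (B * L) ((B + 1) * L - 1) * hb ((B + 1) * L - 1) \<le> 4 * exp (4 * c) * \<beta>"
    using Lf R unfolding ab(1) unfolding a_def e_def by simp
qed

end

lemma two_power_le_exp: "2 ^ n \<le> exp (real n)"
proof -
  have "(2 :: real) ^ n \<le> exp 1 ^ n" using exp_ge_add_one_self[of 1] by (intro power_mono) auto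
  then show ?thesis by (simp add: exp_of_nat_mult[symmetric])
qed

lemma width_bounds:
  assumes "5 \<le> K"
  shows "ratio K \<le> width K" "12 \<le> ratio K" "1024 \<le> width K"
proof -
  have "5 * K \<le> K ^ 2" using assms by (auto simp: power2_eq_square)
  then have *: "2 * K + 1 \<le> K ^ 2" "10 \<le> K ^ 2" using assms by linarith+
  show "ratio K \<le> width K" unfolding ratio_def width_def using * by (intro power_increasing) auto
  have "(2::nat) ^ 4 \<le> 2 ^ (2 * K + 1)" using assms by (intro power_increasing) auto
  then show "12 \<le> ratio K" by (simp add: ratio_def)
  have "(2::nat) ^ 10 \<le> 2 ^ (K ^ 2)" using * by (intro power_increasing) auto
  then show "1024 \<le> width K" by (simp add: width_def)
qed

text \<open>The three claims are the smallness needed by the walk bound, the passage to the next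
  scale, and the cost of crossing \<open>j\<close> blocks. The bound 1/256 on \<kappa> makes
  \<open>5 * c\<close> at most 1/16 of the width, small against the exponent, which is at least half
  the width.\<close>

lemma exit_bound_step:
  fixes \<kappa> :: real
  assumes K: "5 \<le> K" and \<kappa>: "0 \<le> \<kappa>" "\<kappa> \<le> 1 / 256"
  defines "c \<equiv> \<kappa> * width K"
  shows "32 * exit_bound K * exp (5 * c) \<le> 1"
    and "(4 * exit_bound K) ^ (ratio K - 12) * (8 * exp (5 * c)) \<le> exit_bound (Suc K)"
    and "4 \<le> j \<Longrightarrow> (4 * exit_bound K) ^ (j - 3) * (8 * exp (5 * c)) \<le> exp (- (real (j * width K) / 16))"
proof -
  define L where "L = real (width K)"
  define l where "l = real (ratio K)"
  define a where "a = 1 / 2 + (1 / 2 :: real) ^ K"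
  have L: "1024 \<le> L" "l \<le> L" "12 \<le> l" using width_bounds[OF K] by (auto simp: L_def l_def)
  have a: "1 / 2 \<le> a" "a \<le> 1" using power_decreasing[of 1 K "1 / 2 :: real"] K by (auto simp: a_def)
  have aL: "L / 2 \<le> a * L" using mult_right_mono[OF a(1), of L] L by (simp add: field_simps)
  have c: "5 * c \<le> L / 16" using mult_right_mono[OF \<kappa>(2), of L] L by (simp add: c_def L_def)
  have e: "exit_bound K = exp (- (a * L))" by (simp add: exit_bound_def a_def L_def)
  have eb: "4 * exit_bound K \<le> exp (2 - a * L)"
    using mult_right_mono[OF two_power_le_exp[of 2], of "exp (- (a * L))"]
    by (simp add: e exp_add[symmetric])
  have e0: "0 \<le> 4 * exit_bound K" by (simp add: exit_bound_def)
  have 8: "8 * exp (5 * c) \<le> exp (3 + L / 16)"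
    using mult_mono[OF two_power_le_exp[of 3], of "exp (5 * c)" "exp (L / 16)"] c by (simp add: exp_add)
  have pw: "(4 * exit_bound K) ^ n * (8 * exp (5 * c)) \<le> exp (real n * (2 - a * L) + (3 + L / 16))" for n
    using mult_mono[OF power_mono[OF eb e0, of n] 8] by (simp add: exp_of_nat_mult[symmetric] exp_add e)
  have "32 * exit_bound K * exp (5 * c) \<le> exp 5 * exp (- (a * L)) * exp (L / 16)"
    using two_power_le_exp[of 5] c by (intro mult_mono) (auto simp: e)
  also have "\<dots> = exp (5 - a * L + L / 16)" by (simp add: exp_add[symmetric])
  also have "\<dots> \<le> 1"
  proof -
    have "5 - a * L + L / 16 \<le> 0" using aL L by linarith
    then show ?thesis by simp
  qed
  finally show "32 * exit_bound K * exp (5 * c) \<le> 1" .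
  have "(l - 12) * (2 - a * L) + (3 + L / 16) \<le> - ((1 / 2 + (1 / 2) ^ Suc K) * (L * l))"
  proof -
    \<comment> \<open>Halving the surplus rate frees \<open>2 ^ K * L \<ge> 32 * L\<close> in the
      exponent. This pays for the 12 lost steps, worth at most \<open>L\<close> each, and for the
      constants; it is where \<open>5 \<le> K\<close> enters.\<close>
    have p: "(1 / 2 :: real) ^ Suc K * l = 2 ^ K"
    proof -
      have "2 * K + 1 = Suc K + K" by simp
      then have l: "l = 2 ^ Suc K * 2 ^ K" unfolding l_def ratio_def by (simp only: power_add of_nat_mult of_nat_power of_nat_numeral)
      have "(1 / 2 :: real) ^ Suc K * l = ((1 / 2) ^ Suc K * 2 ^ Suc K) * 2 ^ K"
        unfolding l by (rule mult.assoc[symmetric])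
      also have "(1 / 2 :: real) ^ Suc K * 2 ^ Suc K = 1"
        unfolding power_mult_distrib[symmetric] by simp
      finally show ?thesis by simp
    qed
    have "(1 / 2 + (1 / 2) ^ Suc K) * (L * l) = a * L * l - (1 / 2) ^ Suc K * l * L"
      by (simp add: a_def algebra_simps)
    also have "\<dots> = a * L * l - 2 ^ K * L" by (simp only: p)
    also have "\<dots> \<le> a * L * l - 32 * L"
      using power_increasing[OF K, of "2 :: real"] L by simp
    finally have "(1 / 2 + (1 / 2) ^ Suc K) * (L * l) \<le> a * L * l - 32 * L" .
    moreover have "a * L \<le> L" using mult_right_mono[OF a(2), of L] L by simp
    moreover have "(l - 12) * (2 - a * L) = 2 * l - a * L * l - 24 + 12 * (a * L)"
      by (simp add: algebra_simps)
    ultimately show ?thesis using L by linarith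
  qed
  then show "(4 * exit_bound K) ^ (ratio K - 12) * (8 * exp (5 * c)) \<le> exit_bound (Suc K)"
    using pw[of "ratio K - 12"] L
    by (auto simp: exit_bound_def width_Suc L_def l_def of_nat_diff intro: order_trans)
  assume j: "4 \<le> j"
  \<comment> \<open>For \<open>4 \<le> j\<close> at least a quarter of the steps survive, each worth
    3/8 of \<open>L\<close>; the resulting rate 3/32 leaves room above 1/16 for the
    prefactor.\<close>
  have "real (j - 3) * (2 - a * L) \<le> real j / 4 * (- (3 / 8) * L)"
  proof -
    have "real j / 4 \<le> real (j - 3)" using j by (simp add: of_nat_diff)
    moreover have "0 \<le> (3 / 8) * L" "(3 / 8) * L \<le> a * L - 2" using L aL by linarith+
    ultimately have "real j / 4 * ((3 / 8) * L) \<le> real (j - 3) * (a * L - 2)" by (intro mult_mono) auto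
    then show ?thesis by (simp add: algebra_simps)
  qed
  moreover have "4 * L \<le> real j * L" using j L by (intro mult_right_mono) auto
  moreover have "real j / 4 * (- (3 / 8) * L) = - (3 / 32) * (real j * L)" by simp
  ultimately have "real (j - 3) * (2 - a * L) + (3 + L / 16) \<le> - (real j * L / 16)" using L by linarith
  then show "(4 * exit_bound K) ^ (j - 3) * (8 * exp (5 * c)) \<le> exp (- (real (j * width K) / 16))"
    using pw[of "j - 3"] by (auto simp: L_def intro: order_trans)
qed

context column_percolation
begin

lemma exits_le_mono: "exits_le L i x \<Longrightarrow> x \<le> y \<Longrightarrow> exits_le L i y"
  unfolding exits_le_def by (meson order_trans)

text \<open>The exploration from junction \<open>B\<close> covers the blocks \<open>B - 1\<close>
  and \<open>B\<close>. If both are good they contain at most two bad sub-blocks together, which is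
  what \<open>exits_le_step\<close> tolerates.\<close>

lemma good_exits_le:
  fixes \<kappa> \<beta> :: real
  assumes r: "5 \<le> r" and \<kappa>: "0 \<le> \<kappa>" "\<kappa> \<le> 1 / 256"
    and T: "\<And>K j. T K j \<Longrightarrow> sum s {j * width K..<Suc j * width K} \<le> \<kappa> * width K"
    and G0: "\<And>j. G0 j \<Longrightarrow> \<exists>i\<in>{j * width r..<Suc j * width r}. hb i \<le> \<beta>"
    and \<beta>: "0 \<le> \<beta>" "4 * exp (4 * (\<kappa> * width r)) * \<beta> \<le> exit_bound r"
    and B: "1 \<le> B" "good T G0 r k (B - 1)" "good T G0 r k B"
  shows "exits_le (width (k + r)) B (exit_bound (k + r))"
  using B
proof (induction k arbitrary: B)
  case 0
  have eq: "j = B - 1 \<or> j = B" if "B - 1 \<le> j" "j \<le> B" for j using that by auto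
  have "exits_le (width r) B (4 * exp (4 * (\<kappa> * width r)) * \<beta>)"
  proof (rule exits_le_base)
    fix j assume "B - 1 \<le> j" "j \<le> B"
    then have "good T G0 r 0 j" using 0 eq by blast
    then show "sum s {j * width r..<Suc j * width r} \<le> \<kappa> * width r"
      "\<exists>i\<in>{j * width r..<Suc j * width r}. hb i \<le> \<beta>"
      using T G0 by (simp_all del: mult_Suc)
  qed (use width_pos 0 \<beta> \<kappa> in auto)
  then show ?case using exits_le_mono[OF _ \<beta>(2)] by simp
next
  case (Suc k)
  define K where "K = k + r"
  define l where "l = ratio K"
  have K: "5 \<le> K" using r by (simp add: K_def)
  obtain B' where B': "B = Suc B'" using Suc.prems by (cases B) auto
  have un: "{(B - 1) * l..<(B + 1) * l} = {B' * l..<Suc B' * l} \<union> {B * l..<Suc B * l}"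
    by (auto simp: B')
  have g: "\<forall>i\<in>{j * l..<Suc j * l}. T K i" "card {i \<in> {j * l..<Suc j * l}. \<not> good T G0 r k i} \<le> 1"
    if "j = B \<or> j = B'" for j
    using Suc.prems that by (auto simp: l_def K_def B' simp del: mult_Suc)
  have "exits_le (width K * l) B ((4 * exit_bound K) ^ (l - 12) * (8 * exp (5 * (\<kappa> * width K))))"
  proof (rule exits_le_step[where bad = "\<lambda>i. \<not> good T G0 r k i"])
    have "card {i \<in> {(B - 1) * l..<(B + 1) * l}. \<not> good T G0 r k i} =
      card ({i \<in> {B' * l..<Suc B' * l}. \<not> good T G0 r k i} \<union> {i \<in> {B * l..<Suc B * l}. \<not> good T G0 r k i})"
      unfolding un by (intro arg_cong[where f = card]) auto
    also have "\<dots> \<le> card {i \<in> {B' * l..<Suc B' * l}. \<not> good T G0 r k i} + card {i \<in> {B * l..<Suc B * l}. \<not> good T G0 r k i}"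
      by (rule card_Un_le)
    also have "\<dots> \<le> 1 + 1" using g by (intro add_mono) auto
    finally show "card {i \<in> {(B - 1) * l..<(B + 1) * l}. \<not> good T G0 r k i} \<le> 2" by simp
    show "exits_le (width K) i (exit_bound K)"
      if "(B - 1) * l < i" "\<not> \<not> good T G0 r k (i - 1)" "\<not> \<not> good T G0 r k i" for i
      using Suc.IH[of i] that by (simp add: K_def)
    show "sum s {j * width K..<Suc j * width K} \<le> \<kappa> * width K"
      if "(B - 1) * l \<le> j" "j < (B + 1) * l" for j
    proof -
      have "j \<in> {B' * l..<Suc B' * l} \<union> {B * l..<Suc B * l}" using that un by auto
      then have "T K j" using g by blast
      then show ?thesis by (rule T)
    qed
  qed (use width_pos ratio_pos Suc.prems \<kappa> exit_bound_step(1)[OF K \<kappa>] in \<open>auto simp: l_def exit_bound_def\<close>)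
  then have "exits_le (width K * l) B (exit_bound (Suc K))"
    by (rule exits_le_mono) (use exit_bound_step(2)[OF K \<kappa>] in \<open>simp add: l_def\<close>)
  then show ?case by (simp add: K_def l_def width_Suc)
qed

text \<open>The lattice ends at column 0, where no two-sided exit bound is available. The indices
  are shifted by one to make room for a fictitious absorbing site 0; site 1, which stands for column
  0, is the single element of \<open>R\<close> and is passed at the cost of one block.\<close>

lemma crossing_bound:
  fixes c x :: real
  assumes L: "0 < L" and j: "2 \<le> j" and ex: "\<And>i. 1 \<le> i \<Longrightarrow> i < j \<Longrightarrow> exits_le L i x"
    and c: "sum s {0..<L} \<le> c" "0 \<le> c" and x: "0 < x" "32 * x * exp (5 * c) \<le> 1"
  shows "G H {0..j * L - 1} 0 (j * L - 1) * hb (j * L - 1) \<le> (4 * x) ^ (j - 3) * (8 * exp (5 * c))"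
proof -
  define U e \<Omega> where "U = {0..j * L - 1}" and "e = j * L - 1" and "\<Omega> = 2 * exp (5 * c)"
  have \<Omega>: "1 \<le> \<Omega>" "16 * x * \<Omega> \<le> 1" using x c by (auto simp: \<Omega>_def intro: order_trans[of _ 2])
  define f where "f i = (if i = 0 then 0 else if i = j + 1 then 1 else G H U ((i - 1) * L) e * hb e)" for i
  have f0: "0 \<le> f i" for i by (simp add: f_def G_nonneg hb_nonneg)
  have Lm: "a * L < b * L" "Suc a * L \<le> b * L" if "a < b" for a b
    using that L by (auto intro!: mult_le_mono1 simp del: mult_Suc)
  have jL: "0 < j * L" using L j by simp
  have "f 1 \<le> (4 * x) ^ (j + 1 - 1 - 3 * 1) * (4 * \<Omega>)"
  proof (rule walk_bound_few[OF x(1) \<Omega>, where p = 0 and R = "{1}"])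
    fix i assume i: "0 < i" "i < j + 1" "i \<notin> {1}"
    define k where "k = i - 1"
    have k: "1 \<le> k" "k < j" "i - 1 = k" "k - 1 < k" "k < k + 1" using i by (auto simp: k_def)
    define A where "A = {(k - 1) * L + 1..(k + 1) * L - 1}"
    have sub: "A \<subseteq> U" using k diff_le_mono[OF Lm(2)[of k j], of 1] by (auto simp: U_def A_def)
    have J: "G H U (k * L) e \<le> G H A (k * L) e + G H A (k * L) ((k - 1) * L + 1) * hb ((k - 1) * L) * G H U ((k - 1) * L) e +
      G H A (k * L) ((k + 1) * L - 1) * hb ((k + 1) * L - 1) * G H U ((k + 1) * L) e"
      unfolding A_def by (rule G_junction[OF L _ sub[unfolded A_def] k(4,5)]) (simp add: U_def)
    have E: "G H A (k * L) ((k - 1) * L + 1) * hb ((k - 1) * L) \<le> x" "G H A (k * L) ((k + 1) * L - 1) * hb ((k + 1) * L - 1) \<le> x"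
      using ex[OF k(1,2)] by (auto simp: exits_le_def A_def)
    have fi: "f i = G H U (k * L) e * hb e" using i k by (simp add: f_def)
    have fl: "G H U ((k - 1) * L) e * hb e = f (i - 1)" using i k by (auto simp: f_def)
    have "f i \<le> G H A (k * L) ((k - 1) * L + 1) * hb ((k - 1) * L) * f (i - 1) +
      G H A (k * L) ((k + 1) * L - 1) * hb ((k + 1) * L - 1) * f (i + 1)"
    proof (cases "k + 1 = j")
      case True
      have "G H U ((k + 1) * L) e = 0" unfolding True by (intro G_outside) (use jL in \<open>simp add: U_def del: nat_0_less_mult_iff\<close>)
      moreover have "f (i + 1) = 1" using True i by (simp add: f_def k_def)
      moreover have "(k + 1) * L - 1 = e" by (simp only: True e_def)
      ultimately show ?thesis
        using mult_right_mono[OF J hb_nonneg[of e]] unfolding fi fl[symmetric]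
        by (simp add: algebra_simps)
    next
      case False
      have "e \<notin> A" using Lm(1)[of "k + 1" j] False k L by (auto simp: e_def A_def)
      then have "G H A (k * L) e = 0" by (intro G_outside) auto
      moreover have "f (i + 1) = G H U ((k + 1) * L) e * hb e" using False i by (simp add: f_def k_def)
      ultimately show ?thesis
        using mult_right_mono[OF J hb_nonneg[of e]] unfolding fi fl[symmetric] by (simp add: algebra_simps)
    qed
    then show "f i \<le> x * (f (i - 1) + f (i + 1))"
      using mult_right_mono[OF E(1) f0[of "i - 1"]] mult_right_mono[OF E(2) f0[of "i + 1"]]
      by (simp add: algebra_simps)
  next
    fix lo i hi assume *: "0 \<le> lo" "lo < i" "i < hi" "hi \<le> j + 1" "{lo<..<hi} \<subseteq> {1::nat}"
    then have "i = 1" by auto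
    moreover have "hi = 2"
    proof (rule ccontr)
      assume "hi \<noteq> 2"
      then have "2 \<in> {lo<..<hi}" using * \<open>i = 1\<close> by auto
      then show False using * by auto
    qed
    ultimately have **: "i = 1" "hi = 2" "lo = 0" using * by auto
    have Ue: "U = {0..e}" by (simp add: U_def e_def)
    have "1 * L < j * L" by (rule Lm) (use j in simp)
    then have Le: "L - 1 < e" unfolding e_def mult_1 using L by arith
    have "G H U 0 e \<le> G H {0..L - 1} 0 e + (if (0::nat) = 0 then 0 else G H {0..L - 1} 0 0 * hb (0 - 1) * G H U (0 - 1) e) +
      G H {0..L - 1} 0 (L - 1) * hb (L - 1) * G H U (Suc (L - 1)) e"
      by (rule G_first_exit) (use Le in \<open>auto simp: Ue\<close>)
    also have "G H {0..L - 1} 0 e = 0" using Le by (intro G_outside) auto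
    finally have 1: "G H U 0 e \<le> G H {0..L - 1} 0 (L - 1) * hb (L - 1) * G H U L e" using L by simp
    have "G H {0..L - 1} 0 (L - 1) * hb (L - 1) \<le> \<Omega>"
    proof -
      have "{0..L - 1} = {0..<L}" using L by auto
      then have "G H {0..L - 1} 0 (L - 1) * hb (L - 1) \<le> 2 * exp (sum s {0..<L})"
        using G_hb_le_exp[of "{0..L - 1}"] by simp
      also have "\<dots> \<le> \<Omega>" using c by (simp add: \<Omega>_def)
      finally show ?thesis .
    qed
    from mult_right_mono[OF this G_nonneg[of H U L e]] 1 have "G H U 0 e \<le> \<Omega> * G H U L e" by linarith
    from mult_right_mono[OF this hb_nonneg[of e]] show "f i \<le> \<Omega> * (f lo + f hi)"
      using j by (simp add: ** f_def)
  qed (use j in \<open>auto simp: f_def\<close>)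
  then show ?thesis using j by (simp add: f_def \<Omega>_def U_def e_def)
qed

end

section \<open>Connection estimates and planar duality\<close>

lemma le_width: "K \<le> width K"
  using less_exp[of "K ^ 2"] by (auto simp: width_def power2_eq_square intro: order_trans[OF le_square] less_imp_le)

lemma conn_box_of_rtrancl:
  assumes "(x, y) \<in> (open_adj \<omega>)\<^sup>*"
  shows "\<exists>n. conn \<omega> ({0..n} \<times> {..n}) x y"
  using assms
proof (induction rule: rtrancl_induct)
  case base
  show ?case by (rule exI[of _ "fst x + snd x"]) (cases x, auto intro: conn_refl)
next
  case (step y z)
  then obtain n where n: "conn \<omega> ({0..n} \<times> {..n}) x y" by blast
  define m where "m = n + fst z + snd z"
  have "conn \<omega> ({0..m} \<times> {..m}) x y" using n by (rule conn_mono) (auto simp: m_def)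
  then have "conn \<omega> ({0..m} \<times> {..m}) x z"
    by (rule conn_step[OF _ step(2)]) (cases z, auto simp: m_def)
  then show ?case by blast
qed

lemma conn_imp_rtrancl: "conn \<omega> A x y \<Longrightarrow> (x, y) \<in> (open_adj \<omega>)\<^sup>*"
  by (induction rule: conn_induct) (auto intro: rtrancl_into_rtrancl)

definition leaves :: "(edge \<Rightarrow> bool) \<Rightarrow> nat \<Rightarrow> nat \<Rightarrow> nat \<Rightarrow> bool" where
  "leaves \<omega> M h H \<longleftrightarrow> (\<exists>m\<le>H. conn \<omega> ({0..M - 1} \<times> {..H}) (0, h) (M - 1, m) \<and> \<omega> (Hor (M - 1) m))"

text \<open>Cut at the last exit from the first \<open>M\<close> columns of a box containing the
  path. This strip is as high as the box and starts at column 0, so only its right side can be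
  left.\<close>

lemma confined_or_leaves:
  assumes "((0, h), y) \<in> (open_adj \<omega>)\<^sup>*" and M: "0 < M"
  shows "(\<exists>H. conn \<omega> ({0..M - 1} \<times> {..H}) (0, h) y) \<or> (\<exists>H. leaves \<omega> M h H)"
proof -
  obtain n where n: "conn \<omega> ({0..n} \<times> {..n}) (0, h) y" using conn_box_of_rtrancl[OF assms(1)] by blast
  let ?A = "{0..n + M} \<times> {..n}" and ?D = "{0..M - 1} \<times> {..n}"
  have A: "conn \<omega> ?A (0, h) y" using n by (rule conn_mono) auto
  have h: "h \<le> n" using connD[OF n] by auto
  show ?thesis
  proof (rule disjE[OF conn_last_exit[OF A, of ?D]])
    assume "\<exists>e u v. conn \<omega> ?D (0, h) u \<and> v \<in> ?A - ?D \<and> incident e u v \<and> \<omega> e \<and>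
      conn \<omega> (?A - cluster \<omega> ?D (0, h)) v y"
    then obtain e u v where *: "conn \<omega> ?D (0, h) u" "v \<in> ?A - ?D" "incident e u v" "\<omega> e" by blast
    obtain i m where u: "u = (i, m)" "i \<le> M - 1" "m \<le> n" using connD[OF *(1)] by (cases u) auto
    have "i = M - 1 \<and> e = Hor i m"
      using * u by (cases e) (auto simp: incident_def edge_ends_def)
    then have "leaves \<omega> M h n" using * u by (auto simp: leaves_def)
    then show ?thesis by blast
  qed (use h M in auto)
qed

context column_percolation
begin

lemma events_leaves: "{w \<in> space M. leaves (\<lambda>e. X e w) m h H} \<in> events"
proof -
  have "{w \<in> space M. leaves (\<lambda>e. X e w) m h H} = (\<Union>k\<in>{..H}.
      {w \<in> space M. conn (\<lambda>e. X e w) ({0..m - 1} \<times> {..H}) (0, h) (m - 1, k)} \<inter> {w \<in> space M. X (Hor (m - 1) k) w})"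
    by (auto simp: leaves_def)
  also have "\<dots> \<in> events"
    by (intro sets.finite_UN sets.Int events_conn) auto
  finally show ?thesis .
qed

text \<open>First moment over the exit heights: the exit edge has one end outside the strip and is
  therefore independent of the connection inside it.\<close>

lemma Prob_leaves_le:
  assumes "0 < m" and b: "\<And>H. G H {0..m - 1} 0 (m - 1) * hb (m - 1) \<le> b"
  shows "Prob (\<lambda>\<omega>. leaves \<omega> m h H) \<le> b"
proof (cases "h \<le> H")
  case True
  let ?D = "{0..m - 1} \<times> {..H}"
  let ?E = "\<lambda>k. {w \<in> space M. conn (\<lambda>e. X e w) ?D (0, h) (m - 1, k) \<and> X (Hor (m - 1) k) w}"
  have ev: "?E k \<in> events" for k
  proof -
    have "?E k = {w \<in> space M. conn (\<lambda>e. X e w) ?D (0, h) (m - 1, k)} \<inter> {w \<in> space M. X (Hor (m - 1) k) w}" by auto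
    also have "\<dots> \<in> events" by (intro sets.Int events_conn) auto
    finally show ?thesis .
  qed
  have "Prob (\<lambda>\<omega>. leaves \<omega> m h H) = prob (\<Union>k\<in>{..H}. ?E k)"
    by (rule arg_cong[where f = prob]) (auto simp: leaves_def)
  also have "\<dots> \<le> (\<Sum>k\<le>H. prob (?E k))"
    using ev by (intro finite_measure_subadditive_finite) auto
  also have "\<dots> \<le> (\<Sum>k\<le>H. tau ?D (0, h) (m - 1, k) * hb (m - 1))"
  proof (rule sum_mono)
    fix k
    have "prob (?E k) = tau ?D (0, h) (m - 1, k) * Prob (\<lambda>\<omega>. \<omega> (Hor (m - 1) k))"
      unfolding tau_def
      by (rule Prob_conj_dep_on[OF finite_edges_in _ _ dep_on_conn, of _ "{Hor (m - 1) k}"])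
        (use assms(1) in \<open>auto simp: edges_in_def edge_ends_def dep_on_def\<close>)
    then show "prob (?E k) \<le> tau ?D (0, h) (m - 1, k) * hb (m - 1)"
      using Hor_le[of "m - 1" k] tau_nonneg by (auto intro!: mult_left_mono)
  qed
  also have "\<dots> = row H {0..m - 1} 0 (m - 1) h * hb (m - 1)"
    by (simp add: row_def sum_distrib_right)
  also have "\<dots> \<le> G H {0..m - 1} 0 (m - 1) * hb (m - 1)"
    using True hb_nonneg by (intro mult_right_mono row_le_G) auto
  finally show ?thesis using b[of H] by linarith
next
  case False
  then have "{w \<in> space M. leaves (\<lambda>e. X e w) m h H} = {}"
    by (auto simp: leaves_def dest!: connD)
  moreover have "0 \<le> b" using b[of 0] G_nonneg[of 0 "{0..m - 1}" 0 "m - 1"] hb_nonneg[of "m - 1"]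
    by (meson mult_nonneg_nonneg order_trans)
  ultimately show ?thesis by (simp only: measure_empty)
qed

text \<open>The events increase with \<open>H\<close>, so a bound uniform in \<open>H\<close> passes
  to their union.\<close>

lemma Prob_ex_leaves_le:
  assumes "0 < m" and b: "\<And>H. G H {0..m - 1} 0 (m - 1) * hb (m - 1) \<le> b"
  shows "{w \<in> space M. \<exists>H. leaves (\<lambda>e. X e w) m h H} \<in> events"
    and "Prob (\<lambda>\<omega>. \<exists>H. leaves \<omega> m h H) \<le> b"
proof -
  define A where "A H = {w \<in> space M. leaves (\<lambda>e. X e w) m h H}" for H
  have A: "A H \<in> events" for H unfolding A_def by (rule events_leaves)
  have eq: "{w \<in> space M. \<exists>H. leaves (\<lambda>e. X e w) m h H} = (\<Union>H. A H)" by (auto simp: A_def)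
  show "{w \<in> space M. \<exists>H. leaves (\<lambda>e. X e w) m h H} \<in> events" unfolding eq using A by auto
  have "incseq A"
  proof (rule incseq_SucI, rule subsetI)
    fix n w assume "w \<in> A n"
    then obtain k where "w \<in> space M" "k \<le> n" "conn (\<lambda>e. X e w) ({0..m - 1} \<times> {..n}) (0, h) (m - 1, k)" "X (Hor (m - 1) k) w"
      by (auto simp: A_def leaves_def)
    moreover have "conn (\<lambda>e. X e w) ({0..m - 1} \<times> {..Suc n}) (0, h) (m - 1, k)"
      using calculation(3) by (rule conn_mono) auto
    ultimately show "w \<in> A (Suc n)" unfolding A_def leaves_def by (auto intro!: exI[of _ k])
  qed
  then have "(\<lambda>H. prob (A H)) \<longlonglongrightarrow> prob (\<Union>H. A H)"
    using A by (intro finite_Lim_measure_incseq) auto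
  then have "prob (\<Union>H. A H) \<le> b"
    by (rule LIMSEQ_le_const2) (use Prob_leaves_le[OF assms] in \<open>auto simp: A_def\<close>)
  then show "Prob (\<lambda>\<omega>. \<exists>H. leaves \<omega> m h H) \<le> b" by (simp add: eq)
qed

lemma events_levels: "finite J \<Longrightarrow> finite T \<Longrightarrow> {w \<in> space M. \<forall>n\<in>T. \<exists>i\<in>J. X (Ver i n) w} \<in> events"
  by (intro sets.sets_Collect_finite_All sets.sets_Collect_finite_Ex) auto

text \<open>A path that does not leave the first \<open>m\<close> columns has to cross all
  \<open>h\<close> levels below its start within them.\<close>

lemma Prob_reach_row_le:
  assumes m: "0 < m" and b: "\<And>H. G H {0..m - 1} 0 (m - 1) * hb (m - 1) \<le> b"
  shows "Prob (\<lambda>\<omega>. \<exists>v. ((0, h), (v, 0)) \<in> (open_adj \<omega>)\<^sup>*) \<le> b + (1 - exp (- sum s {0..m - 1})) ^ h"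
proof -
  let ?L = "{w \<in> space M. \<exists>H. leaves (\<lambda>e. X e w) m h H}"
  let ?V = "{w \<in> space M. \<forall>n\<in>{0..<h}. \<exists>i\<in>{0..m - 1}. X (Ver i n) w}"
  have ev: "?L \<in> events" "?V \<in> events" using Prob_ex_leaves_le(1)[OF assms] events_levels by auto
  have "Prob (\<lambda>\<omega>. \<exists>v. ((0, h), (v, 0)) \<in> (open_adj \<omega>)\<^sup>*) \<le> prob (?L \<union> ?V)"
  proof (rule finite_measure_mono)
    show "{w \<in> space M. \<exists>v. ((0, h), (v, 0)) \<in> (open_adj (\<lambda>e. X e w))\<^sup>*} \<subseteq> ?L \<union> ?V"
    proof (rule subsetI)
      fix w assume "w \<in> {w \<in> space M. \<exists>v. ((0, h), (v, 0)) \<in> (open_adj (\<lambda>e. X e w))\<^sup>*}"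
      then obtain v where w: "w \<in> space M" and r: "((0, h), (v, 0)) \<in> (open_adj (\<lambda>e. X e w))\<^sup>*" by blast
      from confined_or_leaves[OF r m] show "w \<in> ?L \<union> ?V"
      proof
        assume "\<exists>H. conn (\<lambda>e. X e w) ({0..m - 1} \<times> {..H}) (0, h) (v, 0)"
        then obtain H where H: "conn (\<lambda>e. X e w) ({0..m - 1} \<times> {..H}) (0, h) (v, 0)" by blast
        have "\<exists>i\<in>{0..m - 1}. X (Ver i n) w" if "n \<in> {0..<h}" for n
          using conn_crosses_levels[OF conn_sym[OF H], of "{0..m - 1}" n] that by auto
        then show ?thesis using w by blast
      qed (use w in blast)
    qed
  qed (use ev in auto)
  also have "\<dots> \<le> prob ?L + prob ?V" by (intro measure_Un_le ev)
  also have "prob ?V \<le> (1 - exp (- sum s {0..m - 1})) ^ card {0..<h}"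
    by (rule Prob_levels_crossed) auto
  finally show ?thesis using Prob_ex_leaves_le(2)[OF assms, of h] by simp
qed

text \<open>An infinite cluster that stays in the first \<open>m\<close> columns would cross every
  level there. For fixed \<open>m\<close> this has probability zero, so only the cost of leaving the
  columns remains.\<close>

lemma Prob_infinite_cluster_eq_0:
  assumes "\<And>\<epsilon>. 0 < \<epsilon> \<Longrightarrow> \<exists>m>0. \<forall>H. G H {0..m - 1} 0 (m - 1) * hb (m - 1) \<le> \<epsilon>"
  shows "Prob (\<lambda>\<omega>. infinite (open_cluster \<omega> (0, 0))) = 0"
proof -
  have "Prob (\<lambda>\<omega>. infinite (open_cluster \<omega> (0, 0))) \<le> \<epsilon>" if \<epsilon>: "0 < \<epsilon>" for \<epsilon>
  proof -
    obtain m where m: "0 < m" and b: "\<And>H. G H {0..m - 1} 0 (m - 1) * hb (m - 1) \<le> \<epsilon>"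
      using assms[OF \<epsilon>] by blast
    let ?L = "{w \<in> space M. \<exists>H. leaves (\<lambda>e. X e w) m 0 H}"
    let ?V = "\<lambda>h. {w \<in> space M. \<forall>n\<in>{0..<h}. \<exists>i\<in>{0..m - 1}. X (Ver i n) w}"
    define r where "r = 1 - exp (- sum s {0..m - 1})"
    have r: "0 \<le> r" "r < 1" by (auto simp: r_def sum_nonneg s_nonneg)
    have ev: "?L \<in> events" "?V h \<in> events" for h using Prob_ex_leaves_le(1)[OF m b] events_levels by auto
    have "Prob (\<lambda>\<omega>. infinite (open_cluster \<omega> (0, 0))) \<le> \<epsilon> + r ^ h" for h
    proof -
      have "Prob (\<lambda>\<omega>. infinite (open_cluster \<omega> (0, 0))) \<le> prob (?L \<union> ?V h)"
      proof (rule finite_measure_mono)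
        show "{w \<in> space M. infinite (open_cluster (\<lambda>e. X e w) (0, 0))} \<subseteq> ?L \<union> ?V h"
        proof (rule subsetI)
          fix w assume "w \<in> {w \<in> space M. infinite (open_cluster (\<lambda>e. X e w) (0, 0))}"
          then have w: "w \<in> space M" and i: "infinite (open_cluster (\<lambda>e. X e w) (0, 0))" by auto
          have "\<not> open_cluster (\<lambda>e. X e w) (0, 0) \<subseteq> {0..m - 1} \<times> {..h}"
            using i by (meson finite_SigmaI finite_atLeastAtMost finite_atMost finite_subset)
          then obtain y where y: "((0, 0), y) \<in> (open_adj (\<lambda>e. X e w))\<^sup>*" "y \<notin> {0..m - 1} \<times> {..h}"
            by (auto simp: open_cluster_def)
          from confined_or_leaves[OF y(1) m] show "w \<in> ?L \<union> ?V h"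
          proof
            assume "\<exists>H. conn (\<lambda>e. X e w) ({0..m - 1} \<times> {..H}) (0, 0) y"
            then obtain H where H: "conn (\<lambda>e. X e w) ({0..m - 1} \<times> {..H}) (0, 0) y" by blast
            have "\<exists>i\<in>{0..m - 1}. X (Ver i n) w" if "n \<in> {0..<h}" for n
            proof -
              have "n < snd y" using connD[OF H] y(2) that by auto
              then show ?thesis using conn_crosses_levels[OF H, of "{0..m - 1}" n] by auto
            qed
            then show ?thesis using w by blast
          qed (use w in blast)
        qed
      qed (use ev in auto)
      also have "\<dots> \<le> prob ?L + prob (?V h)" by (intro measure_Un_le ev)
      also have "prob (?V h) \<le> (1 - exp (- sum s {0..m - 1})) ^ card {0..<h}"
        by (rule Prob_levels_crossed) auto
      finally show ?thesis using Prob_ex_leaves_le(2)[OF m b, of 0] by (simp add: r_def)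
    qed
    moreover have "(\<lambda>h. \<epsilon> + r ^ h) \<longlonglongrightarrow> \<epsilon> + 0" using r by (intro tendsto_intros) auto
    ultimately show ?thesis by (intro LIMSEQ_le_const[of "\<lambda>h. \<epsilon> + r ^ h" \<epsilon>]) auto
  qed
  then have "Prob (\<lambda>\<omega>. infinite (open_cluster \<omega> (0, 0))) \<le> 0" by (rule field_le_epsilon) simp
  then show ?thesis by (simp add: measure_le_0_iff)
qed

end

text \<open>Fourth power of \<open>z \<le> exp z\<close> at z = sqrt x / 4; it turns the stretched
  exponential into a summable bound.\<close>

lemma exp_minus_sqrt_le:
  assumes x: "0 < x"
  shows "exp (- sqrt x) \<le> 256 / x\<^sup>2"
proof -
  have "sqrt x / 4 \<le> exp (sqrt x / 4)" using exp_ge_add_one_self[of "sqrt x / 4"] by linarith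
  then have "(sqrt x / 4) ^ 4 \<le> exp (sqrt x / 4) ^ 4" using x by (intro power_mono) auto
  also have "exp (sqrt x / 4) ^ 4 = exp (sqrt x)" by (simp add: exp_of_nat_mult[symmetric])
  also have "(sqrt x / 4) ^ 4 = x\<^sup>2 / 256"
    using x by (simp add: power4_eq_xxxx power2_eq_square)
  finally show ?thesis using x by (simp add: exp_minus field_simps)
qed

section \<open>Regular scales\<close>

context column_percolation
begin

text \<open>With \<open>4 * ratio K\<close> blocks, scale \<open>K\<close> handles all lengths from
  \<open>4 * width K\<close> to \<open>4 * width (Suc K)\<close>, so successive scales leave no
  gap.\<close>

definition regular :: "real \<Rightarrow> nat \<Rightarrow> bool" where
  "regular \<kappa> K \<longleftrightarrow> (\<forall>i. 1 \<le> i \<and> i < 4 * ratio K \<longrightarrow> exits_le (width K) i (exit_bound K)) \<and>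
    (\<forall>j<4 * ratio K. sum s {j * width K..<Suc j * width K} \<le> \<kappa> * width K)"

lemma regular_crossing:
  assumes K: "5 \<le> K" and \<kappa>: "0 \<le> \<kappa>" "\<kappa> \<le> 1 / 256" and R: "regular \<kappa> K" and j: "4 \<le> j" "j \<le> 4 * ratio K"
  shows "G H {0..j * width K - 1} 0 (j * width K - 1) * hb (j * width K - 1) \<le> exp (- (real (j * width K) / 16))"
proof -
  have "G H {0..j * width K - 1} 0 (j * width K - 1) * hb (j * width K - 1)
     \<le> (4 * exit_bound K) ^ (j - 3) * (8 * exp (5 * (\<kappa> * width K)))"
  proof (rule crossing_bound)
    have "sum s {0 * width K..<Suc 0 * width K} \<le> \<kappa> * width K"
      using R ratio_pos[of K] unfolding regular_def by (elim conjE allE[of _ 0]) simp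
    then show "sum s {0..<width K} \<le> \<kappa> * width K" by simp
  qed (use R j width_pos \<kappa> exit_bound_step(1)[OF K \<kappa>] in \<open>auto simp: regular_def exit_bound_def\<close>)
  also have "\<dots> \<le> exp (- (real (j * width K) / 16))" by (rule exit_bound_step(3)[OF K \<kappa> j(1)])
  finally show ?thesis .
qed

lemma Prob_infinite_cluster_eq_0_regular:
  assumes \<kappa>: "0 \<le> \<kappa>" "\<kappa> \<le> 1 / 256" and R: "\<And>K. K0 \<le> K \<Longrightarrow> regular \<kappa> K"
  shows "Prob (\<lambda>\<omega>. infinite (open_cluster \<omega> (0, 0))) = 0"
proof (rule Prob_infinite_cluster_eq_0)
  fix \<epsilon> :: real assume \<epsilon>: "0 < \<epsilon>"
  define K where "K = 5 + K0 + nat \<lceil>- 4 * ln \<epsilon>\<rceil>"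
  have "- 4 * ln \<epsilon> \<le> real (width K)"
  proof -
    note le_width[of K]
    moreover have "nat \<lceil>- 4 * ln \<epsilon>\<rceil> \<le> K" unfolding K_def by (rule le_add2)
    ultimately have "nat \<lceil>- 4 * ln \<epsilon>\<rceil> \<le> width K" by (rule order_trans[rotated])
    then show ?thesis by linarith
  qed
  then have "- (real (4 * width K) / 16) \<le> ln \<epsilon>" by simp
  then have "exp (- (real (4 * width K) / 16)) \<le> exp (ln \<epsilon>)" unfolding exp_le_cancel_iff .
  moreover have "G H {0..4 * width K - 1} 0 (4 * width K - 1) * hb (4 * width K - 1) \<le> exp (- (real (4 * width K) / 16))" for H
    by (rule regular_crossing[OF _ \<kappa> R]) (use ratio_pos[of K] in \<open>auto simp: K_def\<close>)
  ultimately show "\<exists>m>0. \<forall>H. G H {0..m - 1} 0 (m - 1) * hb (m - 1) \<le> \<epsilon>"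
    using width_pos[of K] \<epsilon> by (intro exI[of _ "4 * width K"]) (auto intro: order_trans)
qed

text \<open>The number of columns is logarithmic in the height: large enough that leaving them has
  probability at most n^(-2), small enough that their vertical reach stays well below n.\<close>

lemma Prob_reach_row_regular:
  assumes K: "5 \<le> K" and \<kappa>: "0 \<le> \<kappa>" "\<kappa> \<le> 1 / 256" and R: "regular \<kappa> K"
    and t: "4 * width K \<le> 64 * ln (real n)" "64 * ln (real n) < 4 * width (Suc K)" and n: "1 \<le> n"
  shows "Prob (\<lambda>\<omega>. \<exists>v. ((0, n), (v, 0)) \<in> (open_adj \<omega>)\<^sup>*) \<le> 257 / (real n)\<^sup>2"
proof -
  define t where "t = 64 * ln (real n)"
  define j where "j = nat \<lceil>t / width K\<rceil>"
  have L: "0 < real (width K)" using width_pos by simp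
  have t0: "4 * real (width K) \<le> t" "t < 4 * real (width K) * real (ratio K)"
    using t by (auto simp: t_def width_Suc)
  have jt: "t \<le> j * width K" "j * real (width K) \<le> t + width K"
  proof -
    have "0 \<le> t / width K" using t0 L by simp
    then have "t / width K \<le> j" "j \<le> t / width K + 1" unfolding j_def by linarith+
    then show "t \<le> j * width K" "j * real (width K) \<le> t + width K" using L by (simp_all add: field_simps)
  qed
  have "4 * real (width K) \<le> real j * width K" using jt t0 by simp
  then have j4: "4 \<le> j" using L by simp
  have jr: "j \<le> 4 * ratio K"
  proof -
    have "t / width K \<le> real (4 * ratio K)" using t0 L by (simp add: field_simps)
    then show ?thesis unfolding j_def by (simp add: nat_le_iff ceiling_le_iff)
  qed
  have m: "0 < j * width K" using j4 width_pos by simp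
  define b where "b = exp (- (real (j * width K) / 16))"
  have "Prob (\<lambda>\<omega>. \<exists>v. ((0, n), (v, 0)) \<in> (open_adj \<omega>)\<^sup>*) \<le> b + (1 - exp (- sum s {0..j * width K - 1})) ^ n"
    unfolding b_def by (rule Prob_reach_row_le[OF m regular_crossing[OF K \<kappa> R j4 jr]])
  also have "b \<le> 1 / (real n)\<^sup>2"
  proof -
    have "0 \<le> ln (real n)" using n by simp
    then have "- (real (j * width K) / 16) \<le> - (2 * ln (real n))"
      using jt(1) unfolding t_def by linarith
    then have "b \<le> exp (- (2 * ln (real n)))" by (simp only: b_def exp_le_cancel_iff)
    moreover have "exp (2 * ln (real n)) = (real n)\<^sup>2" unfolding exp_double using n by simp
    then have "exp (- (2 * ln (real n))) = 1 / (real n)\<^sup>2" by (simp only: exp_minus inverse_eq_divide)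
    ultimately show ?thesis by simp
  qed
  also have "(1 - exp (- sum s {0..j * width K - 1})) ^ n \<le> 256 / (real n)\<^sup>2"
  proof -
    have eq: "{0..j * width K - 1} = {0 * width K..<j * width K}"
      using m by (auto simp del: nat_0_less_mult_iff)
    have "sum s {0..j * width K - 1} \<le> real (j - 0) * (\<kappa> * width K)"
      unfolding eq
    proof (rule sum_blocks)
      fix i assume "i < j"
      then show "sum s {i * width K..<Suc i * width K} \<le> \<kappa> * width K"
        using R jr unfolding regular_def by (meson le_trans less_le_trans)
    qed simp
    also have "\<dots> = \<kappa> * (j * real (width K))" by simp
    \<comment> \<open>Rounding up to whole blocks at most doubles \<open>t\<close>, and 2 * 64 / 256
      = 1/2: a level is closed with probability at least \<open>1 / sqrt n\<close>.\<close>
    also have "\<dots> \<le> 1 / 256 * (2 * t)"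
    proof (rule mult_mono[OF \<kappa>(2)])
      show "j * real (width K) \<le> 2 * t" using jt t0 L by linarith
    qed simp_all
    also have "\<dots> = ln n / 2" by (simp add: t_def)
    also have "\<dots> = ln (sqrt n)" using n by (simp add: ln_sqrt)
    finally have "exp (- ln (sqrt n)) \<le> exp (- sum s {0..j * width K - 1})" by simp
    then have q: "1 / sqrt n \<le> exp (- sum s {0..j * width K - 1})" using n by (simp add: exp_minus divide_inverse)
    have "(1 - exp (- sum s {0..j * width K - 1})) ^ n \<le> exp (- (1 / sqrt n)) ^ n"
    proof (rule power_mono)
      show "1 - exp (- sum s {0..j * width K - 1}) \<le> exp (- (1 / sqrt n))"
        using exp_ge_add_one_self[of "- (1 / sqrt n)"] q by linarith
      show "0 \<le> 1 - exp (- sum s {0..j * width K - 1})" by (simp add: sum_nonneg s_nonneg)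
    qed
    also have "\<dots> = exp (- sqrt n)"
      using n by (simp add: exp_of_nat_mult[symmetric] real_div_sqrt)
    also have "\<dots> \<le> 256 / (real n)\<^sup>2" using n by (intro exp_minus_sqrt_le) auto
    finally show ?thesis .
  qed
  finally show ?thesis by (simp add: add_divide_distrib[symmetric])
qed

lemma Prob_reach_row_summable:
  assumes \<kappa>: "0 \<le> \<kappa>" "\<kappa> \<le> 1 / 256" and R: "\<And>K. K0 \<le> K \<Longrightarrow> regular \<kappa> K"
  shows "summable (\<lambda>n. Prob (\<lambda>\<omega>. \<exists>v. ((0, n), (v, 0)) \<in> (open_adj \<omega>)\<^sup>*))"
proof (rule summable_comparison_test_ev)
  show "summable (\<lambda>n. 257 * (1 / (real n)\<^sup>2))"
    using inverse_power_summable[of 2, where ?'a = real] by (intro summable_mult) (simp add: divide_inverse)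
  have "filterlim (\<lambda>n. 64 * ln (real n)) at_top sequentially"
    by real_asymp
  then have "\<forall>\<^sub>F n in sequentially. 4 * real (width (max 5 K0)) \<le> 64 * ln (real n)"
    by (rule filterlim_at_top[THEN iffD1, rule_format])
  then show "\<forall>\<^sub>F n in sequentially. norm (Prob (\<lambda>\<omega>. \<exists>v. ((0, n), (v, 0)) \<in> (open_adj \<omega>)\<^sup>*)) \<le> 257 * (1 / (real n)\<^sup>2)"
    using eventually_ge_at_top[of 1]
  proof eventually_elim
    case (elim n)
    let ?P = "\<lambda>K. 4 * real (width K) \<le> 64 * ln (real n)"
    have bd: "K \<le> nat \<lceil>64 * ln (real n)\<rceil>" if "?P K" for K
    proof -
      have "real K \<le> real (width K)" using le_width by simp
      then have "real K \<le> 64 * ln (real n)" using that by linarith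
      also have "\<dots> \<le> real (nat \<lceil>64 * ln (real n)\<rceil>)" by (rule real_nat_ceiling_ge)
      finally show ?thesis by simp
    qed
    \<comment> \<open>The scale is chosen according to the height; it exceeds \<open>K0\<close> as
      soon as the height is large.\<close>
    define K where "K = (GREATEST K. ?P K)"
    have "?P K" unfolding K_def by (rule GreatestI_nat[of ?P, OF elim(1)]) (use bd in blast)
    moreover have K: "max 5 K0 \<le> K" unfolding K_def by (rule Greatest_le_nat[of ?P, OF elim(1)]) (use bd in blast)
    moreover have "\<not> ?P (Suc K)"
    proof
      assume "?P (Suc K)"
      then have "Suc K \<le> K" unfolding K_def by (rule Greatest_le_nat) (use bd in blast)
      then show False by simp
    qed
    ultimately show ?case
      using Prob_reach_row_regular[OF _ \<kappa> R, of K n] elim by simp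
  qed
qed

end

text \<open>A dual edge crosses the common side of two faces: the right side of face
  \<open>(i, n)\<close> for \<open>Hor i n\<close>, the upper side for \<open>Ver i n\<close>. No
  dual edge crosses a side lying on one of the two axes.\<close>

definition dual :: "(edge \<Rightarrow> bool) \<Rightarrow> edge \<Rightarrow> bool" where
  "dual \<omega> e = (case e of Hor i n \<Rightarrow> \<not> \<omega> (Ver (Suc i) n) | Ver i n \<Rightarrow> \<not> \<omega> (Hor i (Suc n)))"

lemma even_sum_consecutive:
  fixes a :: "nat \<Rightarrow> nat"
  shows "even (\<Sum>n<B. a n + a (Suc n)) \<longleftrightarrow> even (a 0 + a B)"
  by (induction B) auto

text \<open>Vertex (i,n) of the dual lattice is the face with lower left corner (i,n). The boundary of the
  cluster has even degree at every face, so by the handshake lemma the boundary component entering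
  through the left side must leave through the bottom.\<close>

lemma dual_path_of_finite_cluster:
  assumes fin: "finite (open_cluster \<omega> (0, 0))" and col: "\<And>m. m < n0 \<Longrightarrow> \<omega> (Ver 0 m)"
  shows "\<exists>n\<ge>n0. \<exists>v. ((0, n), (v, 0)) \<in> (open_adj (dual \<omega>))\<^sup>*"
proof (rule ccontr)
  assume contra: "\<not> ?thesis"
  define C where "C = open_cluster \<omega> (0, 0)"
  define c where "c i n = (of_bool ((i, n) \<in> C) :: nat)" for i n
  define V where "V i n = (of_bool (((i, n) \<in> C) \<noteq> ((i, Suc n) \<in> C)) :: nat)" for i n
  define Hh where "Hh i n = (of_bool (((i, n) \<in> C) \<noteq> ((Suc i, n) \<in> C)) :: nat)" for i n
  define R where "R = {f. \<exists>n. V 0 n = 1 \<and> ((0, n), f) \<in> (open_adj (dual \<omega>))\<^sup>*}"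
  define r where "r i n = (of_bool ((i, n) \<in> R) :: nat)" for i n
  have C_step: "y \<in> C \<longleftrightarrow> z \<in> C" if "\<omega> e" "incident e y z" for e y z
  proof -
    have "(y, z) \<in> open_adj \<omega>" using that by (auto simp: open_adj_iff)
    then show ?thesis using open_adj_sym[of y z \<omega>]
      by (auto simp: C_def open_cluster_def intro: rtrancl_into_rtrancl)
  qed
  have Vc: "\<not> \<omega> (Ver i n)" if "V i n \<noteq> 0" for i n
    using C_step[of "Ver i n" "(i, n)" "(i, Suc n)"] that by (auto simp: V_def incident_def edge_ends_def)
  have Hc: "\<not> \<omega> (Hor i n)" if "Hh i n \<noteq> 0" for i n
    using C_step[of "Hor i n" "(i, n)" "(Suc i, n)"] that by (auto simp: Hh_def incident_def edge_ends_def)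
  have R_step: "f \<in> R \<longleftrightarrow> g \<in> R" if "dual \<omega> e" "incident e f g" for e f g
  proof -
    have "(f, g) \<in> open_adj (dual \<omega>)" using that by (auto simp: open_adj_iff)
    then show ?thesis using open_adj_sym[of f g "dual \<omega>"]
      by (auto simp: R_def intro: rtrancl_into_rtrancl)
  qed
  \<comment> \<open>A boundary edge is closed, so the two faces beside it are joined by an open dual
    edge and lie in \<open>R\<close> together. Such an edge is counted twice in the degree sum,
    except on the axes.\<close>
  have rH: "r i n * Hh i (Suc n) = r i (Suc n) * Hh i (Suc n)" for i n
    using Hc[of i "Suc n"] R_step[of "Ver i n" "(i, n)" "(i, Suc n)"]
    by (cases "Hh i (Suc n) = 0") (auto simp: r_def dual_def incident_def edge_ends_def)
  have rV: "r i n * V (Suc i) n = r (Suc i) n * V (Suc i) n" for i n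
    using Vc[of "Suc i" n] R_step[of "Hor i n" "(i, n)" "(Suc i, n)"]
    by (cases "V (Suc i) n = 0") (auto simp: r_def dual_def incident_def edge_ends_def)
  \<comment> \<open>Boundary edges on the left axis are closed and so start at height at least
    \<open>n0\<close>; a dual path from there to the bottom row is excluded by assumption.\<close>
  have bottom: "r i 0 = 0" for i
  proof -
    have "(i, 0) \<notin> R"
    proof
      assume "(i, 0) \<in> R"
      then obtain n where n: "V 0 n = 1" "((0, n), (i, 0)) \<in> (open_adj (dual \<omega>))\<^sup>*" by (auto simp: R_def)
      then have "n0 \<le> n" using Vc[of 0 n] col[of n] by force
      then show False using n contra by blast
    qed
    then show ?thesis by (simp add: r_def)
  qed
  have left: "r 0 n * V 0 n = V 0 n" for n
    by (cases "V 0 n = 0") (auto simp: r_def R_def V_def)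
  obtain B where B: "C \<subseteq> {..<B} \<times> {..<B}"
  proof -
    have f: "finite (fst ` C \<union> snd ` C)" using fin by (simp add: C_def)
    then obtain B where "fst ` C \<union> snd ` C \<subseteq> {..<B}" using finite_nat_iff_bounded by blast
    then have "C \<subseteq> {..<B} \<times> {..<B}" by (auto simp: subset_iff image_iff)
    then show ?thesis by (rule that)
  qed
  have HB: "Hh i B = 0" and VB: "V B n = 0" for i n using B by (auto simp: Hh_def V_def)
  \<comment> \<open>Around a face, membership in \<open>C\<close> changes an even number of
    times.\<close>
  have face: "even (Hh i n + Hh i (Suc n) + V i n + V (Suc i) n)" for i n
    by (auto simp: Hh_def V_def)
  have "even (\<Sum>i<B. \<Sum>n<B. r i n * (Hh i n + Hh i (Suc n) + V i n + V (Suc i) n))"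
    using face by (intro dvd_sum dvd_mult) auto
  also have "(\<Sum>i<B. \<Sum>n<B. r i n * (Hh i n + Hh i (Suc n) + V i n + V (Suc i) n)) =
    (\<Sum>i<B. \<Sum>n<B. r i n * Hh i n + r i (Suc n) * Hh i (Suc n)) +
    (\<Sum>i<B. \<Sum>n<B. r i n * V i n + r (Suc i) n * V (Suc i) n)"
    by (simp add: distrib_left sum.distrib rH rV)
  also have "(\<Sum>i<B. \<Sum>n<B. r i n * V i n + r (Suc i) n * V (Suc i) n) =
     (\<Sum>n<B. \<Sum>i<B. r i n * V i n + r (Suc i) n * V (Suc i) n)" by (rule sum.swap)
  finally have "even ((\<Sum>i<B. \<Sum>n<B. r i n * Hh i n + r i (Suc n) * Hh i (Suc n)) +
     (\<Sum>n<B. \<Sum>i<B. r i n * V i n + r (Suc i) n * V (Suc i) n))" .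
  moreover have "even (\<Sum>i<B. \<Sum>n<B. r i n * Hh i n + r i (Suc n) * Hh i (Suc n))"
  proof (rule dvd_sum)
    show "even (\<Sum>n<B. r i n * Hh i n + r i (Suc n) * Hh i (Suc n))" for i
      unfolding even_sum_consecutive[of "\<lambda>n. r i n * Hh i n" B] by (simp add: bottom HB)
  qed
  ultimately have "even (\<Sum>n<B. \<Sum>i<B. r i n * V i n + r (Suc i) n * V (Suc i) n)" by simp
  moreover have "even (\<Sum>n<B. \<Sum>i<B. r i n * V i n + r (Suc i) n * V (Suc i) n) \<longleftrightarrow> even (\<Sum>n<B. V 0 n)"
  proof -
    have "even (\<Sum>i<B. r i n * V i n + r (Suc i) n * V (Suc i) n) \<longleftrightarrow> even (V 0 n)" for n
      unfolding even_sum_consecutive[of "\<lambda>i. r i n * V i n" B] by (simp add: left VB)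
    then show ?thesis unfolding even_sum_iff[OF finite_lessThan] by simp
  qed
  moreover have "even (\<Sum>n<B. V 0 n) \<longleftrightarrow> even (\<Sum>n<B. c 0 n + c 0 (Suc n))"
  proof -
    have "odd (V 0 n) \<longleftrightarrow> odd (c 0 n + c 0 (Suc n))" for n by (simp add: c_def V_def)
    then show ?thesis unfolding even_sum_iff[OF finite_lessThan] by simp
  qed
  \<comment> \<open>Along the left axis membership in \<open>C\<close> starts true and ends false,
    so it changes an odd number of times; the degree count has just given an even number.\<close>
  moreover have "c 0 0 = 1" "c 0 B = 0" using B by (auto simp: c_def C_def open_cluster_def)
  ultimately show False using even_sum_consecutive[of "c 0" B] by simp
qed

section \<open>Random environments\<close>

lemma (in prob_space) expectation_square_sum_indep:
  fixes U :: "'i \<Rightarrow> 'a \<Rightarrow> real"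
  assumes "finite I" "indep_vars (\<lambda>_. borel) U I"
    and "\<And>i. i \<in> I \<Longrightarrow> expectation (U i) = 0" "\<And>i x. i \<in> I \<Longrightarrow> \<bar>U i x\<bar> \<le> B"
  shows "expectation (\<lambda>x. (\<Sum>i\<in>I. U i x)\<^sup>2) = (\<Sum>i\<in>I. expectation (\<lambda>x. (U i x)\<^sup>2))"
  using assms
proof (induction I rule: finite_induct)
  case (insert i I)
  let ?S = "\<lambda>x. \<Sum>i\<in>I. U i x"
  have rv: "random_variable borel (U j)" if "j \<in> insert i I" for j
    using insert.prems(1) that by (auto simp: indep_vars_def)
  have int: "integrable M (U j)" if "j \<in> insert i I" for j
    by (rule integrable_const_bound[of _ B]) (use insert.prems(3) rv that in auto)
  have S: "random_variable borel ?S" using rv by (intro borel_measurable_sum) auto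
  have Sb: "\<bar>?S x\<bar> \<le> of_nat (card I) * B" for x
    using insert.prems(3) by (intro order_trans[OF sum_abs sum_bounded_above]) auto
  have intS: "integrable M ?S" using int by (intro Bochner_Integration.integrable_sum) auto
  have ind: "indep_var borel (U i) borel ?S"
    by (rule indep_vars_sum) (use insert in auto)
  have sq: "integrable M (\<lambda>x. (U i x)\<^sup>2)"
  proof (rule integrable_const_bound[of _ "B\<^sup>2"])
    have "\<bar>U i x\<bar>\<^sup>2 \<le> B\<^sup>2" for x using insert.prems(3)[of i x] by (intro power_mono) auto
    then show "AE x in M. norm ((U i x)\<^sup>2) \<le> B\<^sup>2" by simp
  qed (use rv in auto)
  have sqS: "integrable M (\<lambda>x. (?S x)\<^sup>2)"
  proof (rule integrable_const_bound[of _ "(of_nat (card I) * B)\<^sup>2"])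
    have "\<bar>?S x\<bar>\<^sup>2 \<le> (of_nat (card I) * B)\<^sup>2" for x using Sb[of x] by (intro power_mono) auto
    then show "AE x in M. norm ((?S x)\<^sup>2) \<le> (of_nat (card I) * B)\<^sup>2" by simp
  qed (use S in auto)
  have "expectation (\<lambda>x. (\<Sum>i\<in>insert i I. U i x)\<^sup>2) =
    expectation (\<lambda>x. (U i x)\<^sup>2 + (2 * (U i x * ?S x) + (?S x)\<^sup>2))"
    using insert.hyps by (intro Bochner_Integration.integral_cong) (auto simp: power2_sum algebra_simps)
  also have "\<dots> = expectation (\<lambda>x. (U i x)\<^sup>2) + (2 * expectation (\<lambda>x. U i x * ?S x) + expectation (\<lambda>x. (?S x)\<^sup>2))"
    using sq sqS indep_var_integrable[OF ind int intS] by simp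
  also have "expectation (\<lambda>x. U i x * ?S x) = 0"
    using indep_var_lebesgue_integral[OF ind int intS] insert.prems(2)[of i] by simp
  also have "expectation (\<lambda>x. (?S x)\<^sup>2) = (\<Sum>i\<in>I. expectation (\<lambda>x. (U i x)\<^sup>2))"
    using insert.prems indep_vars_subset[OF insert.prems(1), of I] by (intro insert.IH) auto
  finally show ?case using insert.hyps by simp
qed simp

text \<open>Truncate at the number of summands and apply Chebyshev.\<close>

lemma (in prob_space) prob_sum_large_le:
  fixes Y :: "'i \<Rightarrow> 'a \<Rightarrow> real" and m \<eta> :: real
  assumes I: "finite I" "I \<noteq> {}" and ind: "indep_vars (\<lambda>_. borel) Y I"
    and nn: "\<And>i x. i \<in> I \<Longrightarrow> 0 \<le> Y i x" and \<eta>: "1 < \<eta>" "\<eta> \<le> 2"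
    and int: "\<And>i. i \<in> I \<Longrightarrow> integrable M (\<lambda>x. Y i x powr \<eta>)"
    and m: "\<And>i. i \<in> I \<Longrightarrow> expectation (\<lambda>x. Y i x powr \<eta>) \<le> m"
  shows "prob {x \<in> space M. (m + 2) * card I < (\<Sum>i\<in>I. Y i x)} \<le> 2 * m * card I powr (1 - \<eta>)"
proof -
  define L where "L = real (card I)"
  have L: "1 \<le> L" using I by (simp add: L_def Suc_leI card_gt_0_iff)
  define Z where "Z i x = min (Y i x) L" for i x
  define U where "U i x = Z i x - expectation (Z i)" for i x
  have rv [measurable]: "i \<in> I \<Longrightarrow> random_variable borel (Y i)" for i
    using ind by (auto simp: indep_vars_def)
  have rvZ [measurable]: "i \<in> I \<Longrightarrow> random_variable borel (Z i)" for i
    unfolding Z_def by measurable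
  have Zb: "0 \<le> Z i x" "Z i x \<le> L" if "i \<in> I" for i x using nn[OF that] L by (auto simp: Z_def)
  have intZ: "integrable M (Z i)" if "i \<in> I" for i
    by (rule integrable_const_bound[of _ L]) (use Zb that in auto)
  \<comment> \<open>This bounds the truncated mean by \<open>1 + m\<close>. A sum above
    \<open>(m + 2) * L\<close> therefore deviates from its mean by at least
    \<open>L\<close>.\<close>
  have Zle: "Z i x \<le> 1 + Y i x powr \<eta>" if "i \<in> I" for i x
  proof (cases "Y i x \<le> 1")
    case True
    then show ?thesis unfolding Z_def by (smt (verit) powr_ge_zero)
  next
    case False
    then have "Y i x powr 1 \<le> Y i x powr \<eta>" using \<eta> by (intro powr_mono) auto
    then show ?thesis using False unfolding Z_def by simp
  qed
  have EZ: "expectation (Z i) \<le> 1 + m" "0 \<le> expectation (Z i)" "expectation (Z i) \<le> L" if i: "i \<in> I" for i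
  proof -
    have "expectation (Z i) \<le> expectation (\<lambda>x. 1 + Y i x powr \<eta>)"
      using Zle[OF i] int[OF i] intZ[OF i] by (intro integral_mono) auto
    also have "\<dots> = 1 + expectation (\<lambda>x. Y i x powr \<eta>)" using int[OF i] by (simp add: prob_space)
    finally show "expectation (Z i) \<le> 1 + m" using m[OF i] by linarith
    show "0 \<le> expectation (Z i)" using Zb i by (intro integral_nonneg_AE) auto
    have "expectation (Z i) \<le> expectation (\<lambda>_. L)" using Zb i intZ by (intro integral_mono) auto
    then show "expectation (Z i) \<le> L" by (simp add: prob_space)
  qed
  \<comment> \<open>Part of the square is paid by the truncation level. The variance of the sum is
    then at most \<open>L * (m * L powr (2 - \<eta>))\<close>, and against a deviation
    \<open>L\<close> Chebyshev yields \<open>m * L powr (1 - \<eta>)\<close>.\<close>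
  have Zsq: "(Z i x)\<^sup>2 \<le> L powr (2 - \<eta>) * Y i x powr \<eta>" if i: "i \<in> I" for i x
  proof (cases "Z i x = 0")
    case False
    then have pos: "0 < Z i x" using Zb(1)[OF i, of x] by simp
    have "(Z i x)\<^sup>2 = Z i x powr (2 - \<eta>) * Z i x powr \<eta>"
      using pos by (simp flip: powr_add)
    also have "\<dots> \<le> L powr (2 - \<eta>) * Y i x powr \<eta>"
      using pos Zb(2)[OF i, of x] \<eta> by (intro mult_mono powr_mono2) (auto simp: Z_def)
    finally show ?thesis .
  qed simp
  have intZ2: "integrable M (\<lambda>x. (Z i x)\<^sup>2)" if i: "i \<in> I" for i
    by (rule integrable_const_bound[of _ "L\<^sup>2"]) (use Zb i in \<open>auto intro!: power_mono\<close>)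
  have EU2: "expectation (\<lambda>x. (U i x)\<^sup>2) \<le> m * L powr (2 - \<eta>)" if i: "i \<in> I" for i
  proof -
    have "expectation (\<lambda>x. (U i x)\<^sup>2) \<le> expectation (\<lambda>x. (Z i x)\<^sup>2)"
      unfolding U_def variance_eq[OF intZ[OF i] intZ2[OF i]] by simp
    also have "\<dots> \<le> expectation (\<lambda>x. L powr (2 - \<eta>) * Y i x powr \<eta>)"
      using Zsq[OF i] intZ2[OF i] int[OF i] by (intro integral_mono) auto
    also have "\<dots> = L powr (2 - \<eta>) * expectation (\<lambda>x. Y i x powr \<eta>)" by simp
    also have "\<dots> \<le> L powr (2 - \<eta>) * m" using m[OF i] by (intro mult_left_mono) auto
    finally show ?thesis by (simp add: mult.commute)
  qed
  have rvU [measurable]: "i \<in> I \<Longrightarrow> random_variable borel (U i)" for i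
    unfolding U_def by measurable
  have indU: "indep_vars (\<lambda>_. borel) U I"
    unfolding U_def Z_def
    by (rule indep_vars_compose2[where Y = "\<lambda>i y. min y L - expectation (\<lambda>x. min (Y i x) L)", OF ind]) measurable
  have EU: "expectation (U i) = 0" if "i \<in> I" for i
    unfolding U_def using intZ[OF that] by (simp add: prob_space)
  have Ub: "\<bar>U i x\<bar> \<le> L" if "i \<in> I" for i x
    using Zb[OF that, of x] EZ(2,3)[OF that] by (auto simp: U_def)
  let ?S = "\<lambda>x. \<Sum>i\<in>I. U i x"
  have Sb: "\<bar>?S x\<bar> \<le> of_nat (card I) * L" for x
    using Ub by (intro order_trans[OF sum_abs sum_bounded_above]) auto
  have ES: "expectation ?S = 0"
  proof -
    have "integrable M (U i)" if "i \<in> I" for i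
      by (rule integrable_const_bound[of _ L]) (use Ub that rvU in auto)
    then show ?thesis using EU by simp
  qed
  have "prob {x \<in> space M. \<bar>?S x - expectation ?S\<bar> \<ge> L} \<le> variance ?S / L\<^sup>2"
  proof (rule Chebyshev_inequality)
    show "integrable M (\<lambda>x. (?S x)\<^sup>2)"
    proof (rule integrable_const_bound[of _ "(of_nat (card I) * L)\<^sup>2"])
      have "\<bar>?S x\<bar>\<^sup>2 \<le> (of_nat (card I) * L)\<^sup>2" for x using Sb[of x] by (intro power_mono) auto
      then show "AE x in M. norm ((?S x)\<^sup>2) \<le> (of_nat (card I) * L)\<^sup>2" by simp
    qed measurable
    show "0 < L" using L by simp
  qed measurable
  also have "variance ?S = (\<Sum>i\<in>I. expectation (\<lambda>x. (U i x)\<^sup>2))"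
    unfolding ES using expectation_square_sum_indep[OF I(1) indU EU Ub] by simp
  also have "\<dots> \<le> L * (m * L powr (2 - \<eta>))"
    using sum_bounded_above[of I "\<lambda>i. expectation (\<lambda>x. (U i x)\<^sup>2)", OF EU2] by (simp add: L_def)
  also have "L * (m * L powr (2 - \<eta>)) / L\<^sup>2 = m * L powr (1 - \<eta>)"
  proof -
    have "L powr (2 - \<eta>) = L * L powr (1 - \<eta>)" using L powr_add[of L 1 "1 - \<eta>"] by simp
    then show ?thesis using L by (simp add: power2_eq_square)
  qed
  finally have 1: "prob {x \<in> space M. \<bar>?S x\<bar> \<ge> L} \<le> m * L powr (1 - \<eta>)"
    using L by (simp add: ES divide_right_mono)
  have 2: "prob {x \<in> space M. L \<le> Y i x} \<le> m * L powr (- \<eta>)" if i: "i \<in> I" for i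
  proof -
    have "{x \<in> space M. L \<le> Y i x} \<subseteq> {x \<in> space M. L powr \<eta> \<le> Y i x powr \<eta>}"
      using L \<eta> by (auto intro!: powr_mono2)
    then have "prob {x \<in> space M. L \<le> Y i x} \<le> prob {x \<in> space M. L powr \<eta> \<le> Y i x powr \<eta>}"
      using i by (intro finite_measure_mono) auto
    also have "\<dots> \<le> expectation (\<lambda>x. Y i x powr \<eta>) / L powr \<eta>"
      using L by (intro integral_Markov_inequality_measure[OF int[OF i], where A = "{}"]) auto
    also have "\<dots> \<le> m / L powr \<eta>" using m[OF i] by (intro divide_right_mono) auto
    finally show ?thesis by (simp add: powr_minus divide_inverse)
  qed
  have evS: "{x \<in> space M. \<bar>?S x\<bar> \<ge> L} \<in> events" by measurable
  have evY: "(\<Union>i\<in>I. {x \<in> space M. L \<le> Y i x}) \<in> events"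
    using I(1) by (intro sets.finite_UN) measurable
  have "{x \<in> space M. (m + 2) * card I < (\<Sum>i\<in>I. Y i x)} \<subseteq>
    {x \<in> space M. \<bar>?S x\<bar> \<ge> L} \<union> (\<Union>i\<in>I. {x \<in> space M. L \<le> Y i x})"
  proof safe
    fix x assume x: "x \<in> space M" "(m + 2) * card I < (\<Sum>i\<in>I. Y i x)" "x \<notin> (\<Union>i\<in>I. {x \<in> space M. L \<le> Y i x})"
    then have "Z i x = Y i x" if "i \<in> I" for i using that by (auto simp: Z_def)
    then have "?S x = (\<Sum>i\<in>I. Y i x) - (\<Sum>i\<in>I. expectation (Z i))"
      by (simp add: U_def sum_subtractf)
    moreover have "(\<Sum>i\<in>I. expectation (Z i)) \<le> L * (1 + m)"
      using sum_bounded_above[of I "\<lambda>i. expectation (Z i)", OF EZ(1)] by (simp add: L_def)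
    ultimately show "L \<le> \<bar>?S x\<bar>" using x(2) by (simp add: L_def algebra_simps)
  qed
  then have "prob {x \<in> space M. (m + 2) * card I < (\<Sum>i\<in>I. Y i x)} \<le>
    prob ({x \<in> space M. \<bar>?S x\<bar> \<ge> L} \<union> (\<Union>i\<in>I. {x \<in> space M. L \<le> Y i x}))"
    by (rule finite_measure_mono[OF _ sets.Un[OF evS evY]])
  also have "\<dots> \<le> prob {x \<in> space M. \<bar>?S x\<bar> \<ge> L} + prob (\<Union>i\<in>I. {x \<in> space M. L \<le> Y i x})"
    by (rule measure_Un_le[OF evS evY])
  also have "prob (\<Union>i\<in>I. {x \<in> space M. L \<le> Y i x}) \<le> (\<Sum>i\<in>I. prob {x \<in> space M. L \<le> Y i x})"
    using I(1) by (intro finite_measure_subadditive_finite) auto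
  also have "\<dots> \<le> L * (m * L powr (- \<eta>))"
    using sum_bounded_above[of I "\<lambda>i. prob {x \<in> space M. L \<le> Y i x}", OF 2] by (simp add: L_def)
  also have "L * (m * L powr (- \<eta>)) = m * L powr (1 - \<eta>)"
    using L powr_add[of L 1 "- \<eta>"] by simp
  finally show ?thesis using 1 by (simp add: L_def)
qed

section \<open>Failure probabilities of blocks\<close>

definition block :: "nat \<Rightarrow> nat \<Rightarrow> nat set" where
  "block K j = {j * width K..<Suc j * width K}"

lemma finite_block: "finite (block K j)" and card_block: "card (block K j) = width K"
  by (simp_all add: block_def)

lemma block_disjoint: "i \<noteq> j \<Longrightarrow> block K i \<inter> block K j = {}"
proof -
  have "block K i \<inter> block K j = {}" if "i < j" for i j
  proof -
    have "Suc i * width K \<le> j * width K" using that by (intro mult_le_mono1) auto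
    then show ?thesis by (auto simp: block_def)
  qed
  then show "i \<noteq> j \<Longrightarrow> block K i \<inter> block K j = {}" by (metis inf_commute linorder_neqE_nat)
qed

lemma block_subset:
  assumes "i \<in> {j * ratio K..<Suc j * ratio K}"
  shows "block K i \<subseteq> block (Suc K) j"
proof -
  have "j * ratio K \<le> i" "Suc i \<le> Suc j * ratio K" using assms by auto
  from mult_le_mono1[OF this(1), of "width K"] mult_le_mono1[OF this(2), of "width K"]
  show ?thesis by (auto simp: block_def width_Suc mult_ac simp del: mult_Suc)
qed

text \<open>Stating the tolerance as the absence of two distinct bad sub-blocks gives measurability
  and suits the union bound over pairs.\<close>

lemma good_Suc_iff:
  "good T G0 r (Suc k) j \<longleftrightarrow> (\<forall>i\<in>{j * ratio (k + r)..<Suc j * ratio (k + r)}. T (k + r) i) \<and>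
    (\<forall>i\<in>{j * ratio (k + r)..<Suc j * ratio (k + r)}. \<forall>i'\<in>{j * ratio (k + r)..<Suc j * ratio (k + r)}.
      i \<noteq> i' \<longrightarrow> good T G0 r k i \<or> good T G0 r k i')"
proof -
  have "card {i \<in> A. P i} \<le> 1 \<longleftrightarrow> (\<forall>i\<in>A. \<forall>i'\<in>A. i \<noteq> i' \<longrightarrow> \<not> P i \<or> \<not> P i')" if "finite A" for A :: "nat set" and P
    using card_le_Suc0_iff_eq[of "{i \<in> A. P i}"] that by auto
  note card = this[OF finite_atLeastLessThan, where P = "\<lambda>i. \<not> good T G0 r k i"]
  show ?thesis by (simp only: good.simps card not_not)
qed

text \<open>Serves both phases. For small p the base condition \<open>G0\<close> carries the
  randomness, with \<open>T\<close> trivial; for p near 1 it is \<open>T\<close>, the moderate sums,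
  with \<open>G0\<close> trivial.\<close>

locale block_environment = prob_space M for M :: "'a measure" +
  fixes Y :: "nat \<Rightarrow> 'a \<Rightarrow> real"
    and T :: "nat \<Rightarrow> nat \<Rightarrow> (nat \<Rightarrow> real) \<Rightarrow> bool" and G0 :: "nat \<Rightarrow> (nat \<Rightarrow> real) \<Rightarrow> bool"
    and r :: nat and \<alpha> C1 :: real
  assumes indep_Y: "indep_vars (\<lambda>_. borel) Y UNIV"
    and T_local: "(\<And>i. i \<in> block K j \<Longrightarrow> g i = g' i) \<Longrightarrow> T K j g \<longleftrightarrow> T K j g'"
    and G0_local: "(\<And>i. i \<in> block r j \<Longrightarrow> g i = g' i) \<Longrightarrow> G0 j g \<longleftrightarrow> G0 j g'"
    and T_meas: "block K j \<subseteq> E \<Longrightarrow> Measurable.pred (PiM E (\<lambda>_. borel)) (T K j)"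
    and G0_meas: "block r j \<subseteq> E \<Longrightarrow> Measurable.pred (PiM E (\<lambda>_. borel)) (G0 j)"
    and \<alpha>: "0 < \<alpha>" "\<alpha> \<le> 1" and C1: "0 \<le> C1"
    and scales: "\<And>K. r \<le> K \<Longrightarrow> (C1 + 1) * real (ratio K) ^ 3 \<le> real (width K) powr \<alpha>"
    and T_prob: "r \<le> K \<Longrightarrow> prob {x \<in> space M. \<not> T K j (\<lambda>i. Y i x)} \<le> C1 * real (width K) powr (- (2 * \<alpha>))"
    and base_prob: "prob {x \<in> space M. \<not> (G0 j (\<lambda>i. Y i x) \<and> T r j (\<lambda>i. Y i x))} \<le> real (width r) powr (- \<alpha>)"
begin

definition gd :: "nat \<Rightarrow> nat \<Rightarrow> (nat \<Rightarrow> real) \<Rightarrow> bool" where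
  "gd k j g = good (\<lambda>K j. T K j g) (\<lambda>j. G0 j g) r k j"

lemma gd_0: "gd 0 j g \<longleftrightarrow> G0 j g \<and> T r j g"
  by (simp add: gd_def)

lemma gd_Suc: "gd (Suc k) j g \<longleftrightarrow> (\<forall>i\<in>{j * ratio (k + r)..<Suc j * ratio (k + r)}. T (k + r) i g) \<and>
    (\<forall>i\<in>{j * ratio (k + r)..<Suc j * ratio (k + r)}. \<forall>i'\<in>{j * ratio (k + r)..<Suc j * ratio (k + r)}.
      i \<noteq> i' \<longrightarrow> gd k i g \<or> gd k i' g)"
  unfolding gd_def good_Suc_iff ..

lemma gd_local: "(\<And>i. i \<in> block (k + r) j \<Longrightarrow> g i = g' i) \<Longrightarrow> gd k j g \<longleftrightarrow> gd k j g'"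
proof (induction k arbitrary: j)
  case 0
  then show ?case using T_local[of r j g g'] G0_local[of j g g'] by (simp add: gd_0)
next
  case (Suc k)
  have "T (k + r) i g = T (k + r) i g' \<and> gd k i g = gd k i g'"
    if i: "i \<in> {j * ratio (k + r)..<Suc j * ratio (k + r)}" for i
  proof -
    have "g l = g' l" if "l \<in> block (k + r) i" for l
      using block_subset[OF i] Suc.prems that by auto
    then show ?thesis using Suc.IH[of i] T_local[of "k + r" i g g'] by blast
  qed
  then show ?case unfolding gd_Suc by blast
qed

lemma gd_meas: "block (k + r) j \<subseteq> E \<Longrightarrow> Measurable.pred (PiM E (\<lambda>_. borel)) (gd k j)"
proof (induction k arbitrary: j)
  case 0
  then show ?case using T_meas[of r j E] G0_meas[of j E] by (simp add: gd_0)
next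
  case (Suc k)
  let ?I = "{j * ratio (k + r)..<Suc j * ratio (k + r)}"
  have sub: "block (k + r) i \<subseteq> E" if "i \<in> ?I" for i
    using block_subset[OF that] Suc.prems by auto
  have 1: "Measurable.pred (PiM E (\<lambda>_. borel)) (T (k + r) i)" "Measurable.pred (PiM E (\<lambda>_. borel)) (gd k i)"
    if "i \<in> ?I" for i
    using sub[OF that] T_meas Suc.IH by auto
  have "Measurable.pred (PiM E (\<lambda>_. borel)) (\<lambda>g. (\<forall>i\<in>?I. T (k + r) i g) \<and>
    (\<forall>i\<in>?I. \<forall>i'\<in>?I. i \<noteq> i' \<longrightarrow> gd k i g \<or> gd k i' g))"
    by (intro pred_intros_logic pred_intros_finite) (use 1 in auto)
  then show ?case by (simp add: gd_Suc[abs_def])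
qed

abbreviation bad :: "nat \<Rightarrow> nat \<Rightarrow> 'a set" where
  "bad k j \<equiv> {x \<in> space M. \<not> gd k j (\<lambda>i. Y i x)}"

abbreviation wild :: "nat \<Rightarrow> nat \<Rightarrow> 'a set" where
  "wild K j \<equiv> {x \<in> space M. \<not> T K j (\<lambda>i. Y i x)}"

lemma rv_Y [measurable]: "random_variable borel (Y i)"
  using indep_Y by (auto simp: indep_vars_def)

lemma events_gd: "bad k j \<in> events"
  and events_T: "wild K j \<in> events"
proof -
  have m: "(\<lambda>x. \<lambda>i\<in>UNIV. Y i x) \<in> measurable M (PiM UNIV (\<lambda>_. borel))" by measurable
  have "Measurable.pred M (\<lambda>x. gd k j (\<lambda>i. Y i x))"
    using measurable_compose[OF m gd_meas[OF subset_UNIV, of k j]] by (simp only: restrict_UNIV)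
  then show "bad k j \<in> events"
    by (intro predE pred_intros_logic)
  have "Measurable.pred M (\<lambda>x. T K j (\<lambda>i. Y i x))"
    using measurable_compose[OF m T_meas[OF subset_UNIV, of K j]] by (simp only: restrict_UNIV)
  then show "wild K j \<in> events"
    by (intro predE pred_intros_logic)
qed

lemma prob_two_bad:
  assumes "i \<noteq> j"
  shows "prob (bad k i \<inter> bad k j) = prob (bad k i) * prob (bad k j)"
proof -
  have eq: "bad k i \<inter> bad k j = {x \<in> space M. \<not> gd k i (\<lambda>i. Y i x) \<and> \<not> gd k j (\<lambda>i. Y i x)}" by auto
  have "{g \<in> space (PiM (block (k + r) i) (\<lambda>_. borel)). \<not> gd k i g} \<in> sets (PiM (block (k + r) i) (\<lambda>_. borel))" for i
    using gd_meas[of k i "block (k + r) i"] by auto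
  from prob_indep_measurable[OF indep_Y subset_UNIV subset_UNIV block_disjoint[OF assms] this this]
  show ?thesis unfolding eq
    using gd_local[of k i "restrict _ (block (k + r) i)"] gd_local[of k j "restrict _ (block (k + r) j)"] by simp
qed

text \<open>A bad block contains a wild sub-block or two bad ones. The latter depend on disjoint
  sets of gaps, so both alternatives cost \<open>W powr (- (2 * \<alpha>))\<close> up to powers of
  the ratio.\<close>

lemma prob_bad_le: "prob (bad k j) \<le> real (width (k + r)) powr (- \<alpha>)"
proof (induction k arbitrary: j)
  case 0
  then show ?case using base_prob[of j] by (simp add: gd_0)
next
  case (Suc k)
  define K where "K = k + r"
  define l where "l = real (ratio K)"
  define W where "W = real (width K)"
  let ?I = "{j * ratio K..<Suc j * ratio K}"
  have l: "1 \<le> l" using ratio_pos[of K] by (simp add: l_def Suc_leI)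
  have W: "1 \<le> W" using width_pos[of K] by (simp add: W_def Suc_leI)
  have card: "real (card ?I) = l" by (simp add: l_def)
  let ?A = "\<Union>i\<in>?I. wild K i"
  let ?B = "\<Union>i\<in>?I. \<Union>i'\<in>?I - {i}. bad k i \<inter> bad k i'"
  have ev: "?A \<in> events" "?B \<in> events" by (auto intro!: sets.Int sets.finite_UN events_T events_gd)
  have "prob (bad (Suc k) j) \<le> prob (?A \<union> ?B)"
    by (rule finite_measure_mono) (use ev in \<open>auto simp: gd_Suc K_def\<close>)
  also have "\<dots> \<le> prob ?A + prob ?B" by (intro measure_Un_le ev)
  also have "prob ?A \<le> (\<Sum>i\<in>?I. prob (wild K i))"
    using events_T by (intro finite_measure_subadditive_finite) auto
  also have "\<dots> \<le> of_nat (card ?I) * (C1 * W powr (- (2 * \<alpha>)))"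
    unfolding W_def by (rule sum_bounded_above[OF T_prob]) (simp add: K_def)
  also have "prob ?B \<le> (\<Sum>i\<in>?I. prob (\<Union>i'\<in>?I - {i}. bad k i \<inter> bad k i'))"
    by (intro finite_measure_subadditive_finite) (auto intro!: sets.Int sets.finite_UN events_gd)
  also have "\<dots> \<le> of_nat (card ?I) * (l * W powr (- (2 * \<alpha>)))"
  proof (rule sum_bounded_above)
    fix i assume i: "i \<in> ?I"
    have "prob (\<Union>i'\<in>?I - {i}. bad k i \<inter> bad k i')
      \<le> (\<Sum>i'\<in>?I - {i}. prob (bad k i \<inter> bad k i'))"
      by (intro finite_measure_subadditive_finite) (auto intro!: sets.Int sets.finite_UN events_gd)
    also have "\<dots> \<le> of_nat (card (?I - {i})) * W powr (- (2 * \<alpha>))"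
    proof (rule sum_bounded_above)
      fix i' assume "i' \<in> ?I - {i}"
      then have "prob (bad k i \<inter> bad k i') =
        prob (bad k i) * prob (bad k i')"
        by (intro prob_two_bad) auto
      also have "\<dots> \<le> W powr (- \<alpha>) * W powr (- \<alpha>)"
        unfolding W_def K_def by (intro mult_mono Suc.IH) auto
      finally show "prob (bad k i \<inter> bad k i') \<le> W powr (- (2 * \<alpha>))"
        by (simp add: powr_add[symmetric])
    qed
    also have "\<dots> \<le> l * W powr (- (2 * \<alpha>))"
    proof (rule mult_right_mono)
      have "card (?I - {i}) \<le> card ?I" by (intro card_mono) auto
      then have "real (card (?I - {i})) \<le> real (card ?I)" by (simp only: of_nat_le_iff)
      then show "real (card (?I - {i})) \<le> l" unfolding card .
    qed simp
    finally show "prob (\<Union>i'\<in>?I - {i}. bad k i \<inter> bad k i')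
      \<le> l * W powr (- (2 * \<alpha>))" .
  qed
  finally have "prob (bad (Suc k) j) \<le> (l * C1 + l * l) * W powr (- (2 * \<alpha>))"
    unfolding card by (simp add: algebra_simps)
  also have "\<dots> \<le> (C1 + 1) * l ^ 2 * W powr (- (2 * \<alpha>))"
  proof (rule mult_right_mono)
    have "l * C1 \<le> l ^ 2 * C1" using l C1 by (intro mult_right_mono) (auto simp: power2_eq_square)
    then show "l * C1 + l * l \<le> (C1 + 1) * l ^ 2" by (simp add: algebra_simps power2_eq_square)
  qed simp
  \<comment> \<open>Of the cube in \<open>scales\<close>, two factors pay for the pairs; the third
    becomes \<open>1 / l\<close> and, as \<open>\<alpha> \<le> 1\<close>, turns the power of
    \<open>W\<close> into one of \<open>W * l\<close>, the next width.\<close>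
  also have "\<dots> \<le> (W powr \<alpha> / l) * W powr (- (2 * \<alpha>))"
  proof (rule mult_right_mono)
    have "(C1 + 1) * l ^ 3 \<le> W powr \<alpha>" unfolding l_def W_def by (rule scales) (simp add: K_def)
    then show "(C1 + 1) * l ^ 2 \<le> W powr \<alpha> / l"
      using l by (simp add: pos_le_divide_eq power2_eq_square power3_eq_cube mult.assoc)
  qed simp
  also have "\<dots> = W powr (- \<alpha>) / l" by (simp add: powr_add[symmetric])
  also have "\<dots> \<le> W powr (- \<alpha>) * l powr (- \<alpha>)"
  proof -
    have "l powr (- 1) \<le> l powr (- \<alpha>)" using l \<alpha> by (intro powr_mono) auto
    then show ?thesis using l by (simp add: powr_minus_divide divide_inverse mult_left_mono)
  qed
  also have "\<dots> = real (width (Suc k + r)) powr (- \<alpha>)"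
    using W l by (simp add: width_Suc powr_mult W_def l_def K_def)
  finally show ?case .
qed

text \<open>Borel-Cantelli over the scales: by \<open>scales\<close>, the union over
  \<open>4 * ratio K\<close> blocks still has probability of order
  \<open>1 / ratio K ^ 2\<close>.\<close>

lemma AE_eventually_good:
  "AE x in M. \<exists>K0\<ge>r. \<forall>K\<ge>K0. \<forall>j<4 * ratio K. gd (K - r) j (\<lambda>i. Y i x) \<and> T K j (\<lambda>i. Y i x)"
proof -
  define A where "A k = (\<Union>j\<in>{..<4 * ratio (k + r)}. bad k j \<union> wild (k + r) j)" for k
  have ev: "A k \<in> events" for k unfolding A_def using events_gd events_T by auto
  have le: "prob (A k) \<le> 4 * (1 / 4) ^ k" for k
  proof -
    define K where "K = k + r"
    define l where "l = real (ratio K)"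
    define W where "W = real (width K)"
    have l: "1 \<le> l" using ratio_pos[of K] by (simp add: l_def Suc_leI)
    have W: "1 \<le> W" using width_pos[of K] by (simp add: W_def Suc_leI)
    have "prob (A k) \<le> (\<Sum>j\<in>{..<4 * ratio K}. prob (bad k j \<union> wild K j))"
      unfolding A_def K_def using events_gd events_T by (intro finite_measure_subadditive_finite) auto
    also have "\<dots> \<le> of_nat (card {..<4 * ratio K}) * ((1 + C1) * W powr (- \<alpha>))"
    proof (rule sum_bounded_above)
      fix j
      have "prob (bad k j \<union> wild K j) \<le>
        prob (bad k j) + prob (wild K j)"
        by (intro measure_Un_le events_gd events_T)
      also have "\<dots> \<le> W powr (- \<alpha>) + C1 * W powr (- (2 * \<alpha>))"
        using prob_bad_le[of k j] T_prob[of K j] by (intro add_mono) (auto simp: W_def K_def)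
      also have "\<dots> \<le> W powr (- \<alpha>) + C1 * W powr (- \<alpha>)"
        using W \<alpha> C1 by (intro add_left_mono mult_left_mono powr_mono) auto
      finally show "prob (bad k j \<union> wild K j) \<le> (1 + C1) * W powr (- \<alpha>)"
        by (simp add: algebra_simps)
    qed
    also have "\<dots> = 4 * l * (1 + C1) / W powr \<alpha>" by (simp add: l_def powr_minus divide_inverse)
    also have "\<dots> \<le> 4 / l ^ 2"
    proof -
      have "(C1 + 1) * l ^ 3 \<le> W powr \<alpha>" unfolding l_def W_def by (rule scales) (simp add: K_def)
      then show ?thesis using W l by (simp add: field_simps power2_eq_square power3_eq_cube)
    qed
    also have "\<dots> \<le> 4 * (1 / 4) ^ k"
    proof -
      have "(2::nat) ^ k \<le> ratio K" unfolding ratio_def K_def by (intro power_increasing) auto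
      then have "2 ^ k \<le> l" unfolding l_def by (metis of_nat_le_iff of_nat_numeral of_nat_power)
      then have "(2 ^ k)\<^sup>2 \<le> l\<^sup>2" by (intro power_mono) auto
      moreover have "(2 ^ k)\<^sup>2 = (4 :: real) ^ k" by (simp add: power2_eq_square flip: power_mult_distrib)
      ultimately have "(4 :: real) ^ k \<le> l\<^sup>2" by simp
      then have "4 / l\<^sup>2 \<le> 4 / 4 ^ k" by (intro divide_left_mono) (use l in auto)
      then show ?thesis unfolding power_one_over by simp
    qed
    finally show ?thesis .
  qed
  have "summable (\<lambda>k. prob (A k))"
  proof (rule summable_comparison_test[of _ "\<lambda>k. 4 * (1 / 4) ^ k"])
    show "\<exists>N. \<forall>n\<ge>N. norm (prob (A n)) \<le> 4 * (1 / 4) ^ n" using le by auto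
    show "summable (\<lambda>k. 4 * (1 / 4 :: real) ^ k)" by (intro summable_mult summable_geometric) auto
  qed
  then have "AE x in M. eventually (\<lambda>k. x \<in> space M - A k) sequentially"
    using ev by (intro borel_cantelli_AE1) (auto simp: less_top[symmetric])
  then show ?thesis
  proof eventually_elim
    case (elim x)
    then obtain k0 where k0: "\<And>k. k0 \<le> k \<Longrightarrow> x \<in> space M - A k" by (auto simp: eventually_sequentially)
    show ?case
    proof (intro exI[of _ "k0 + r"] conjI allI impI)
      fix K j assume "k0 + r \<le> K" "j < 4 * ratio K"
      then show "gd (K - r) j (\<lambda>i. Y i x)" "T K j (\<lambda>i. Y i x)"
        using k0[of "K - r"] by (auto simp: A_def)
    qed simp
  qed
qed

end

text \<open>The width is 2 to a quadratic exponent and the ratio 2 to a linear one, so every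
  positive power of the width eventually beats the cube of the ratio.\<close>

lemma ex_base_scale:
  fixes \<alpha> C1 :: real
  assumes "0 < \<alpha>" "0 \<le> C1"
  shows "\<exists>r\<ge>5. \<forall>K\<ge>r. (C1 + 1) * real (ratio K) ^ 3 \<le> real (width K) powr \<alpha>"
proof -
  define r where "r = 5 + nat \<lceil>12 / \<alpha>\<rceil> + nat \<lceil>C1 + 1\<rceil>"
  have "(C1 + 1) * real (ratio K) ^ 3 \<le> real (width K) powr \<alpha>" if K: "r \<le> K" for K
  proof -
    have "12 / \<alpha> \<le> real K" "C1 + 1 \<le> real K" "5 \<le> real K" using K by (auto simp: r_def) linarith+
    then have 1: "12 \<le> \<alpha> * real K" "C1 + 1 \<le> 2 ^ K" "5 \<le> real K"
      using assms(1) less_imp_le[OF of_nat_less_two_power[of K, where ?'a = real]]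
      by (simp add: field_simps, linarith, linarith)
    have "(C1 + 1) * real (ratio K) ^ 3 \<le> 2 ^ K * (2 ^ (2 * K + 1)) ^ 3"
      using 1 by (intro mult_mono) (auto simp: ratio_def)
    also have "\<dots> = 2 ^ (K + (2 * K + 1) * 3)" by (simp only: power_add power_mult)
    also have "\<dots> = 2 powr real (K + (2 * K + 1) * 3)" by (rule powr_realpow[symmetric]) simp
    also have "\<dots> \<le> 2 powr (\<alpha> * real K * real K)"
    proof (rule powr_mono)
      have "12 * real K \<le> \<alpha> * real K * real K" using 1 by (intro mult_right_mono) auto
      moreover have "real (K + (2 * K + 1) * 3) = 7 * real K + 3" by simp
      ultimately show "real (K + (2 * K + 1) * 3) \<le> \<alpha> * real K * real K" using 1(3) by linarith
    qed simp
    also have "\<dots> = (2 powr real (K ^ 2)) powr \<alpha>"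
      unfolding powr_powr by (simp add: power2_eq_square mult_ac)
    also have "2 powr real (K ^ 2) = real (width K)"
      unfolding width_def of_nat_power of_nat_numeral by (subst powr_realpow[symmetric]) simp_all
    finally show ?thesis .
  qed
  then show ?thesis by (intro exI[of _ r]) (auto simp: r_def)
qed

section \<open>Coupling and the zero-one law\<close>

lemma pred_conn:
  "finite A \<Longrightarrow> (\<And>e. X e \<in> measurable M (count_space UNIV)) \<Longrightarrow> Measurable.pred M (\<lambda>x. conn (\<lambda>e. X e x) A y z)"
  by (rule pred_dep_on[OF finite_edges_in dep_on_conn])

lemma open_rtrancl_iff: "(y, z) \<in> (open_adj \<omega>)\<^sup>* \<longleftrightarrow> (\<exists>n. conn \<omega> ({0..n} \<times> {..n}) y z)"
  using conn_box_of_rtrancl conn_imp_rtrancl by blast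

lemma pred_open_rtrancl:
  "(\<And>e. X e \<in> measurable M (count_space UNIV)) \<Longrightarrow> Measurable.pred M (\<lambda>x. (y, z) \<in> (open_adj (\<lambda>e. X e x))\<^sup>*)"
  unfolding open_rtrancl_iff by (intro pred_intros_countable pred_conn) auto

lemma pred_infinite_cluster:
  assumes "\<And>e. X e \<in> measurable M (count_space UNIV)"
  shows "Measurable.pred M (\<lambda>x. infinite (open_cluster (\<lambda>e. X e x) (0, 0)))"
proof -
  have "infinite C \<longleftrightarrow> (\<forall>n. \<exists>y. n \<le> fst y + snd y \<and> y \<in> C)" for C :: "(nat \<times> nat) set"
  proof
    assume C: "infinite C"
    show "\<forall>n. \<exists>y. n \<le> fst y + snd y \<and> y \<in> C"
    proof
      fix n
      have "\<not> C \<subseteq> {..n} \<times> {..n}" using C finite_subset by blast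
      then obtain y where "y \<in> C" "y \<notin> {..n} \<times> {..n}" by blast
      then show "\<exists>y. n \<le> fst y + snd y \<and> y \<in> C" by (intro exI[of _ y]) (cases y, auto)
    qed
  next
    assume *: "\<forall>n. \<exists>y. n \<le> fst y + snd y \<and> y \<in> C"
    show "infinite C"
    proof
      assume "finite C"
      then have "finite ((\<lambda>y. fst y + snd y) ` C)" by simp
      then obtain N where "(\<lambda>y. fst y + snd y) ` C \<subseteq> {..<N}" using finite_nat_iff_bounded by blast
      then show False using *[rule_format, of N] by (auto simp: subset_iff not_less[symmetric])
    qed
  qed
  then have "(\<lambda>x. infinite (open_cluster (\<lambda>e. X e x) (0, 0))) =
    (\<lambda>x. \<forall>n. \<exists>y. n \<le> fst y + snd y \<and> ((0, 0), y) \<in> (open_adj (\<lambda>e. X e x))\<^sup>*)"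
    by (simp add: open_cluster_def)
  also have "Measurable.pred M \<dots>"
    by (intro pred_intros_countable pred_intros_logic pred_open_rtrancl assms) auto
  finally show ?thesis .
qed

lemma open_cluster_mono:
  assumes "\<And>e. \<omega> e \<Longrightarrow> \<omega>' e"
  shows "open_cluster \<omega> v \<subseteq> open_cluster \<omega>' v"
proof -
  have "open_adj \<omega> \<subseteq> open_adj \<omega>'" using assms by (auto simp: open_adj_def)
  then show ?thesis unfolding open_cluster_def using rtrancl_mono by blast
qed

text \<open>The injection will be the identity or the map sending a dual edge to the edge it
  crosses.\<close>

lemma indep_vars_PiM_reindex:
  assumes M: "\<And>i. prob_space (M i)" and f: "inj f"
  shows "prob_space.indep_vars (PiM UNIV M) (\<lambda>j. M (f j)) (\<lambda>j \<omega>. \<omega> (f j)) UNIV"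
proof -
  interpret P: prob_space "PiM UNIV M" by (rule prob_space_PiM[OF M])
  have "distr (PiM UNIV M) (\<Pi>\<^sub>M j\<in>UNIV. M (f j)) (\<lambda>x. \<lambda>j\<in>UNIV. x (f j)) = (\<Pi>\<^sub>M j\<in>UNIV. M (f j))"
    by (rule distr_PiM_reindex) (use M f in auto)
  also have "\<dots> = (\<Pi>\<^sub>M j\<in>UNIV. distr (PiM UNIV M) (M (f j)) (\<lambda>x. x (f j)))"
  proof (rule PiM_cong)
    show "M (f j) = distr (PiM UNIV M) (M (f j)) (\<lambda>x. x (f j))" for j
      by (rule distr_PiM_component[symmetric]) (use M in auto)
  qed simp
  finally show ?thesis
    by (subst P.indep_vars_iff_distr_eq_PiM') auto
qed

lemma indep_vars_sets_cong:
  assumes "prob_space M" "prob_space.indep_vars M M' X I" "\<And>i. i \<in> I \<Longrightarrow> sets (M' i) = sets (N i)"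
  shows "prob_space.indep_vars M N X I"
proof -
  interpret prob_space M by fact
  have "indep_vars N (\<lambda>i x. (\<lambda>y. y) (X i x)) I"
    by (rule indep_vars_compose2[OF assms(2)]) (use assms(3) in \<open>auto intro: measurable_ident_sets\<close>)
  then show ?thesis by simp
qed

section \<open>Monotone coupling by uniform variables\<close>

abbreviation uniform01 :: "real measure" where
  "uniform01 \<equiv> uniform_measure lborel {0..1}"

abbreviation uniforms :: "(edge \<Rightarrow> real) measure" where
  "uniforms \<equiv> PiM UNIV (\<lambda>_. uniform01)"

lemma prob_space_uniform01: "prob_space uniform01"
  by (rule prob_space_uniform_measure) auto

interpretation uniforms: prob_space uniforms
  by (rule prob_space_PiM[OF prob_space_uniform01])

lemma space_uniforms [simp]: "space uniforms = UNIV"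
  by (simp add: space_PiM)

lemma measurable_uniforms [measurable]: "(\<lambda>U. U e) \<in> borel_measurable uniforms"
  using measurable_component_singleton[of e UNIV "\<lambda>_. uniform01"] by simp

lemma prob_uniform_less:
  assumes "0 \<le> q" "q \<le> 1"
  shows "uniforms.prob {U. U e < q} = q"
proof -
  have "uniforms.prob {U. U e < q} = uniforms.prob ((\<lambda>U. U e) -` {..<q} \<inter> space uniforms)"
    by (rule arg_cong[where f = uniforms.prob]) auto
  also have "\<dots> = measure (distr uniforms uniform01 (\<lambda>U. U e)) {..<q}"
    by (rule measure_distr[symmetric]) auto
  also have "distr uniforms uniform01 (\<lambda>U. U e) = uniform01"
    by (rule distr_PiM_component) (auto intro: prob_space_uniform01)
  also have "measure uniform01 {..<q} = measure lborel ({0..1} \<inter> {..<q}) / measure lborel {0..1::real}"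
    by (rule measure_uniform_measure) auto
  also have "{0..1} \<inter> {..<q} = {0..<q}" using assms by auto
  finally show ?thesis using assms by simp
qed

lemma indep_uniforms:
  fixes f :: "'i \<Rightarrow> edge"
  assumes "inj f"
  shows "uniforms.indep_vars (\<lambda>_. borel) (\<lambda>j U. U (f j)) UNIV"
  by (rule indep_vars_sets_cong[OF uniforms.prob_space_axioms indep_vars_PiM_reindex[OF prob_space_uniform01 assms]]) simp

definition config :: "real \<Rightarrow> (nat \<Rightarrow> real) \<Rightarrow> (edge \<Rightarrow> real) \<Rightarrow> edge \<Rightarrow> bool" where
  "config p g U e \<longleftrightarrow> U e < p powr edge_length g e"

definition perc_prob :: "real \<Rightarrow> (nat \<Rightarrow> real) \<Rightarrow> real" where
  "perc_prob p g = uniforms.prob {U. infinite (open_cluster (config p g U) (0, 0))}"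

lemma edge_length_simps [simp]: "edge_length g (Hor i n) = g i" "edge_length g (Ver i n) = 1"
  by (simp_all add: edge_length_def)

lemma edge_length_nonneg: "(\<And>i. 0 < g i) \<Longrightarrow> 0 \<le> edge_length g e"
  by (cases e) (auto intro: less_imp_le)

lemma prob_config:
  assumes "0 \<le> p" "p \<le> 1" "\<And>i. 0 < g i"
  shows "uniforms.prob {U. config p g U e} = p powr edge_length g e"
  unfolding config_def using assms edge_length_nonneg[of g e, OF assms(3)]
  by (intro prob_uniform_less) (auto intro: powr_le1)

lemma config_measurable [measurable]: "(\<lambda>U. config p g U e) \<in> measurable uniforms (count_space UNIV)"
  unfolding config_def by measurable

lemma indep_config: "indep_bools uniforms (\<lambda>e U. config p g U e)"
proof
  show "uniforms.indep_vars (\<lambda>_. count_space UNIV) (\<lambda>e U. config p g U e) UNIV"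
    unfolding config_def
    by (rule uniforms.indep_vars_compose2[OF indep_uniforms[of "\<lambda>e. e"]]) auto
qed

text \<open>Both sides are product measures with the same marginals. Positive gaps keep
  \<open>p powr edge_length g e\<close> in the unit interval, where it is the success probability of
  the Bernoulli law.\<close>

lemma perc_measure_eq_perc_prob:
  assumes "0 \<le> p" "p \<le> 1" "\<And>i. 0 < g i"
  shows "measure (perc_measure p g) origin_percolates = perc_prob p g"
proof -
  interpret indep_bools uniforms "\<lambda>e U. config p g U e" by (rule indep_config)
  let ?B = "PiM UNIV (\<lambda>_ :: edge. count_space (UNIV :: bool set))"
  have comp: "distr uniforms (count_space UNIV) (\<lambda>U. config p g U e) = measure_pmf (bernoulli_pmf (p powr edge_length g e))" for e
  proof (rule measure_eqI_finite[of _ UNIV])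
    fix b :: bool
    have q: "0 \<le> p powr edge_length g e" "p powr edge_length g e \<le> 1"
      using assms edge_length_nonneg[of g e, OF assms(3)] by (auto intro: powr_le1)
    have ev: "{U. config p g U e} \<in> uniforms.events" using rv_X[of e] by (auto simp: pred_def)
    have "emeasure (distr uniforms (count_space UNIV) (\<lambda>U. config p g U e)) {b} =
      emeasure uniforms {U. config p g U e = b}"
      by (subst emeasure_distr) (auto intro!: arg_cong[where f = "emeasure uniforms"])
    also have "\<dots> = ennreal (uniforms.prob {U. config p g U e = b})"
      by (rule uniforms.emeasure_eq_measure)
    also have "uniforms.prob {U. config p g U e = b} = (if b then p powr edge_length g e else 1 - p powr edge_length g e)"
    proof (cases b)
      case False
      have "uniforms.prob {U \<in> space uniforms. \<not> config p g U e} = 1 - uniforms.prob {U \<in> space uniforms. config p g U e}"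
        by (rule uniforms.prob_neg) (use ev in simp)
      then show ?thesis using False prob_config[OF assms] by simp
    qed (use prob_config[OF assms] in simp)
    also have "\<dots> = pmf (bernoulli_pmf (p powr edge_length g e)) b" using q by (cases b) auto
    finally show "emeasure (distr uniforms (count_space UNIV) (\<lambda>U. config p g U e)) {b} =
      emeasure (measure_pmf (bernoulli_pmf (p powr edge_length g e))) {b}"
      by (simp add: emeasure_pmf_single)
  qed auto
  have "perc_measure p g = PiM UNIV (\<lambda>e. distr uniforms (count_space UNIV) (\<lambda>U. config p g U e))"
    unfolding perc_measure_def comp ..
  also have "\<dots> = distr uniforms ?B (\<lambda>U. \<lambda>e\<in>UNIV. config p g U e)"
    using uniforms.indep_vars_iff_distr_eq_PiM'[where I = UNIV and M' = "\<lambda>_. count_space UNIV" and X = "\<lambda>e U. config p g U e"] indep_X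
    by simp
  finally have eq: "perc_measure p g = distr uniforms ?B (\<lambda>U. config p g U)" by (simp add: restrict_UNIV)
  have "Measurable.pred ?B (\<lambda>\<omega>. infinite (open_cluster (\<lambda>e. \<omega> e) (0, 0)))"
    by (rule pred_infinite_cluster) simp
  then have m: "origin_percolates \<in> sets ?B" by (simp add: pred_def space_PiM origin_percolates_def)
  have "(\<lambda>U. \<lambda>e\<in>UNIV. config p g U e) \<in> measurable uniforms ?B"
    by (rule measurable_restrict) measurable
  then have "(\<lambda>U. config p g U) \<in> measurable uniforms ?B" by (simp add: restrict_UNIV)
  then show ?thesis unfolding eq perc_prob_def
    by (subst measure_distr) (use m in \<open>auto simp: origin_percolates_def intro!: arg_cong[where f = uniforms.prob]\<close>)
qed

lemma events_percolation: "{U. infinite (open_cluster (config p g U) (0, 0))} \<in> uniforms.events"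
  using predE[OF pred_infinite_cluster[of "\<lambda>e U. config p g U e", OF config_measurable]] by simp

lemma perc_prob_mono:
  assumes "0 \<le> p" "p \<le> p'" "\<And>i. 0 < g i"
  shows "perc_prob p g \<le> perc_prob p' g"
  unfolding perc_prob_def
proof (rule uniforms.finite_measure_mono[OF _ events_percolation], rule subsetI)
  fix U assume U: "U \<in> {U. infinite (open_cluster (config p g U) (0, 0))}"
  have "p powr edge_length g e \<le> p' powr edge_length g e" for e
    using assms edge_length_nonneg[of g e, OF assms(3)] by (intro powr_mono2) auto
  then have "open_cluster (config p g U) (0, 0) \<subseteq> open_cluster (config p' g U) (0, 0)"
    by (intro open_cluster_mono) (auto simp: config_def intro: less_le_trans)
  then show "U \<in> {U. infinite (open_cluster (config p' g U) (0, 0))}" using U finite_subset by blast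
qed

text \<open>Percolation is measurable jointly in the environment and the uniform variables, and
  measures of sections depend measurably on the environment.\<close>

lemma perc_prob_measurable:
  assumes "sets N = sets (PiM UNIV (\<lambda>_. borel))"
  shows "Measurable.pred N (\<lambda>g. 0 < perc_prob p g)"
proof -
  have comp: "(\<lambda>g. g i) \<in> borel_measurable N" for i
    using measurable_component_singleton[of i UNIV "\<lambda>_. borel"] measurable_cong_sets[OF assms refl] by blast
  have "(\<lambda>g. edge_length g e) \<in> borel_measurable N" for e
    by (cases e) (simp_all add: comp)
  then have [measurable]: "(\<lambda>x. edge_length (fst x) e) \<in> borel_measurable (N \<Otimes>\<^sub>M uniforms)" for e
    by (rule measurable_compose[OF measurable_fst])
  have [measurable]: "(\<lambda>x. snd x e) \<in> borel_measurable (N \<Otimes>\<^sub>M uniforms)" for e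
    by (rule measurable_compose[OF measurable_snd measurable_uniforms])
  have "Measurable.pred (N \<Otimes>\<^sub>M uniforms) (\<lambda>x. infinite (open_cluster (\<lambda>e. config p (fst x) (snd x) e) (0, 0)))"
    unfolding config_def by (rule pred_infinite_cluster) measurable
  then have Q: "{x \<in> space (N \<Otimes>\<^sub>M uniforms). infinite (open_cluster (config p (fst x) (snd x)) (0, 0))} \<in> sets (N \<Otimes>\<^sub>M uniforms)"
    by (simp add: pred_def)
  have [measurable]: "(\<lambda>g. emeasure uniforms (Pair g -` {x \<in> space (N \<Otimes>\<^sub>M uniforms). infinite (open_cluster (config p (fst x) (snd x)) (0, 0))})) \<in> borel_measurable N"
    by (rule uniforms.measurable_emeasure_Pair[OF Q])
  have "Measurable.pred N (\<lambda>g. 0 < emeasure uniforms (Pair g -` {x \<in> space (N \<Otimes>\<^sub>M uniforms). infinite (open_cluster (config p (fst x) (snd x)) (0, 0))}))"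
    by measurable
  moreover have "space N = UNIV" using sets_eq_imp_space_eq[OF assms] by (simp add: space_PiM)
  ultimately show ?thesis
    by (simp add: vimage_def space_pair_measure perc_prob_def uniforms.emeasure_eq_measure)
qed

section \<open>Shifting the environment\<close>

definition shift_edge :: "edge \<Rightarrow> edge" where
  "shift_edge e = (case e of Hor i n \<Rightarrow> Hor (Suc i) n | Ver i n \<Rightarrow> Ver (Suc i) n)"

lemma inj_shift_edge: "inj shift_edge"
  by (rule injI) (auto simp: shift_edge_def split: edge.splits)

lemma open_cluster_shift:
  assumes "\<omega> (Hor 0 0)" "infinite (open_cluster (\<lambda>e. \<omega> (shift_edge e)) (0, 0))"
  shows "infinite (open_cluster \<omega> (0, 0))"
proof -
  let ?f = "\<lambda>(i, n :: nat). (Suc i, n)"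
  have start: "((0, 0), (1, 0)) \<in> open_adj \<omega>"
    using assms(1) unfolding open_adj_iff by (intro exI[of _ "Hor 0 0"]) (simp add: incident_def edge_ends_def)
  have step: "(?f y, ?f z) \<in> open_adj \<omega>" if yz: "(y, z) \<in> open_adj (\<lambda>e. \<omega> (shift_edge e))" for y z
  proof -
    obtain e where e: "\<omega> (shift_edge e)" "incident e y z" using yz by (auto simp: open_adj_iff)
    have "incident (shift_edge e) (?f y) (?f z)"
      using e(2) by (cases e) (auto simp: incident_def edge_ends_def shift_edge_def)
    then show ?thesis using e(1) by (auto simp: open_adj_iff)
  qed
  have "((0, 0), ?f y) \<in> (open_adj \<omega>)\<^sup>*" if "((0, 0), y) \<in> (open_adj (\<lambda>e. \<omega> (shift_edge e)))\<^sup>*" for y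
    using that
  proof (induction rule: rtrancl_induct)
    case base
    then show ?case using start by auto
  next
    case (step y z)
    then show ?case using \<open>\<And>y z. _ \<Longrightarrow> (?f y, ?f z) \<in> open_adj \<omega>\<close>[of y z] by (meson rtrancl.rtrancl_into_rtrancl)
  qed
  then have "?f ` open_cluster (\<lambda>e. \<omega> (shift_edge e)) (0, 0) \<subseteq> open_cluster \<omega> (0, 0)"
    by (auto simp: open_cluster_def)
  moreover have "inj ?f" by (auto simp: inj_def)
  ultimately show ?thesis using assms(2) by (metis finite_imageD finite_subset inj_on_subset subset_UNIV)
qed

text \<open>The edge \<open>Hor 0 0\<close> is not a shifted edge. It is open with probability
  \<open>p powr g 0 > 0\<close>, independently of percolation from its right end in the shifted
  lattice.\<close>

lemma perc_prob_shift_pos: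
  assumes p: "0 < p" "p \<le> 1" and pos: "\<And>i. 0 < g i" and sh: "0 < perc_prob p (\<lambda>i. g (Suc i))"
  shows "0 < perc_prob p g"
proof -
  let ?g = "\<lambda>i. g (Suc i)"
  let ?P = "\<lambda>U. U (Hor 0 0) < p powr g 0"
  let ?Q = "\<lambda>U. infinite (open_cluster (config p ?g (\<lambda>e. U (shift_edge e))) (0, 0))"
  have cfg: "config p ?g (\<lambda>e. U (shift_edge e)) e = config p g U (shift_edge e)" for U e
    by (cases e) (simp_all add: config_def shift_edge_def)
  have comp: "(\<lambda>U. U e) \<in> borel_measurable (PiM F (\<lambda>_. borel :: real measure))" if "e \<in> F" for e :: edge and F
    using that by simp
  have "uniforms.prob {U \<in> space uniforms. ?P (\<lambda>e\<in>{Hor 0 0}. U e) \<and> ?Q (\<lambda>e\<in>range shift_edge. U e)} =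
    uniforms.prob {U \<in> space uniforms. ?P (\<lambda>e\<in>{Hor 0 0}. U e)} * uniforms.prob {U \<in> space uniforms. ?Q (\<lambda>e\<in>range shift_edge. U e)}"
  proof (rule uniforms.prob_indep_measurable[OF indep_uniforms[of "\<lambda>e. e"]])
    show "{Hor 0 0} \<inter> range shift_edge = {}" by (auto simp: shift_edge_def split: edge.splits)
    show "{U \<in> space (PiM {Hor 0 0} (\<lambda>_. borel)). ?P U} \<in> sets (PiM {Hor 0 0} (\<lambda>_. borel :: real measure))"
      using comp[of "Hor 0 0" "{Hor 0 0}"] by measurable
    have "Measurable.pred (PiM (range shift_edge) (\<lambda>_. borel :: real measure)) (\<lambda>U. config p ?g (\<lambda>e. U (shift_edge e)) e)" for e
      unfolding config_def by (intro borel_measurable_pred_less comp borel_measurable_const) auto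
    from pred_infinite_cluster[OF this]
    have "Measurable.pred (PiM (range shift_edge) (\<lambda>_. borel :: real measure)) ?Q" .
    then show "{U \<in> space (PiM (range shift_edge) (\<lambda>_. borel)). ?Q U} \<in> sets (PiM (range shift_edge) (\<lambda>_. borel :: real measure))"
      by (rule predE)
  qed auto
  then have "uniforms.prob {U. ?P U \<and> ?Q U} = uniforms.prob {U. ?P U} * uniforms.prob {U. ?Q U}"
    by simp
  also have "uniforms.prob {U. ?Q U} = perc_prob p ?g"
  proof -
    have d: "distr uniforms uniforms (\<lambda>U. \<lambda>e\<in>UNIV. U (shift_edge e)) = uniforms"
      using distr_PiM_reindex[of UNIV "\<lambda>_. uniform01" shift_edge UNIV] prob_space_uniform01 inj_shift_edge by simp
    have m: "(\<lambda>U. \<lambda>e\<in>UNIV. U (shift_edge e)) \<in> measurable uniforms uniforms"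
      by (rule measurable_restrict) simp
    have "perc_prob p ?g = measure (distr uniforms uniforms (\<lambda>U. \<lambda>e\<in>UNIV. U (shift_edge e))) {U. infinite (open_cluster (config p ?g U) (0, 0))}"
      unfolding d perc_prob_def ..
    also have "\<dots> = uniforms.prob ((\<lambda>U. \<lambda>e\<in>UNIV. U (shift_edge e)) -` {U. infinite (open_cluster (config p ?g U) (0, 0))} \<inter> space uniforms)"
      by (rule measure_distr[OF m events_percolation])
    finally show ?thesis by (simp add: vimage_def restrict_UNIV)
  qed
  also have "uniforms.prob {U. ?P U} = p powr g 0"
    using p pos[of 0] by (intro prob_uniform_less powr_le1) auto
  finally have "0 < uniforms.prob {U. ?P U \<and> ?Q U}" using p sh by simp
  also have "\<dots> \<le> perc_prob p g"
    unfolding perc_prob_def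
  proof (rule uniforms.finite_measure_mono[OF _ events_percolation], rule subsetI)
    fix U assume "U \<in> {U. ?P U \<and> ?Q U}"
    then show "U \<in> {U. infinite (open_cluster (config p g U) (0, 0))}"
      using open_cluster_shift[of "config p g U"] unfolding cfg by (simp add: config_def)
  qed
  finally show ?thesis .
qed

text \<open>\<open>P\<close> need not be a tail event, but its shifts decrease almost surely and all
  have the same probability. Their upper limit is a tail event with that same probability.
  \<open>Q\<close> is an almost sure side condition, here positivity of all gaps.\<close>

lemma PiM_shift_zero_one:
  fixes D :: "real measure"
  assumes D: "prob_space D" "sets D = sets borel"
    and S: "Measurable.pred (PiM UNIV (\<lambda>_. D)) P"
    and mono: "\<And>g. Q g \<Longrightarrow> P (\<lambda>i. g (Suc i)) \<Longrightarrow> P g"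
    and Q: "AE g in PiM UNIV (\<lambda>_. D). Q g" "\<And>g. Q g \<Longrightarrow> Q (\<lambda>i. g (Suc i :: nat))"
  shows "(AE g in PiM UNIV (\<lambda>_. D). P g) \<or> (AE g in PiM UNIV (\<lambda>_. D). \<not> P g)"
proof -
  let ?E = "PiM UNIV (\<lambda>_ :: nat. D)"
  interpret E: prob_space ?E by (rule prob_space_PiM[OF D(1)])
  have sp: "space ?E = UNIV" using sets_eq_imp_space_eq[OF D(2)] by (simp add: space_PiM)
  define A where "A n = {g. P (\<lambda>i. g (i + n))}" for n
  have sh: "(\<lambda>g. \<lambda>i\<in>UNIV. g (i + n)) \<in> measurable ?E ?E" for n
    by (rule measurable_restrict) simp
  have P_ev: "{g. P g} \<in> E.events" using S by (simp add: pred_def sp)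
  have A_eq: "A n = (\<lambda>g. \<lambda>i\<in>UNIV. g (i + n)) -` {g. P g} \<inter> space ?E" for n
    by (auto simp: A_def sp restrict_UNIV)
  have A_ev: "A n \<in> E.events" for n unfolding A_eq by (rule measurable_sets[OF sh P_ev])
  have A_prob: "E.prob (A n) = E.prob {g. P g}" for n
  proof -
    have "distr ?E ?E (\<lambda>g. \<lambda>i\<in>UNIV. g (i + n)) = ?E"
      using distr_PiM_reindex[of UNIV "\<lambda>_. D" "\<lambda>i. i + n" UNIV] D(1) by simp
    then show ?thesis unfolding A_eq using measure_distr[OF sh P_ev, of n] by simp
  qed
  let ?F = "\<lambda>i. sigma_sets (space ?E) {(\<lambda>g. g i) -` B \<inter> space ?E | B. B \<in> sets D}"
  have ind: "E.indep_sets ?F UNIV"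
    using indep_vars_PiM_reindex[of "\<lambda>_. D" "\<lambda>i :: nat. i"] D(1) unfolding E.indep_vars_def by (auto simp: inj_on_def)
  have tail: "(\<Inter>n. \<Union>m\<in>{n..}. A m) \<in> E.tail_events ?F"
    unfolding E.tail_events_def
  proof
    fix k :: nat
    let ?G = "\<Union> (?F ` {k..})"
    interpret G: sigma_algebra UNIV "sigma_sets UNIV ?G" by (rule sigma_algebra_sigma_sets) auto
    have A_G: "A m \<in> sigma_sets UNIV ?G" if "k \<le> m" for m
    proof -
      have "(\<lambda>g. \<lambda>i\<in>UNIV. g (i + m)) \<in> measurable (sigma UNIV ?G) ?E"
      proof (rule measurable_restrict)
        fix i :: nat
        show "(\<lambda>g. g (i + m)) \<in> measurable (sigma UNIV ?G) D"
        proof (rule measurableI)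
          fix B assume "B \<in> sets D"
          then have "(\<lambda>g. g (i + m)) -` B \<inter> space ?E \<in> ?F (i + m)" by (intro sigma_sets.Basic) auto
          then have "(\<lambda>g. g (i + m)) -` B \<in> ?G" using that sp by (intro UN_I[of "i + m"]) auto
          then show "(\<lambda>g. g (i + m)) -` B \<inter> space (sigma UNIV ?G) \<in> sets (sigma UNIV ?G)" by auto
        qed (use sets_eq_imp_space_eq[OF D(2)] in simp)
      qed
      from measurable_sets[OF this P_ev] show ?thesis by (simp add: A_eq sp)
    qed
    \<comment> \<open>Dropping the first \<open>k\<close> events does not change the upper limit,
      and the remaining ones read only coordinates from \<open>k\<close> on.\<close>
    have "(\<Inter>n. \<Union>m\<in>{n..}. A m) = (\<Inter>n. \<Union>m\<in>{n + k..}. A m)"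
      by (auto simp: set_eq_iff) (meson atLeast_iff add_leD1)+
    also have "\<dots> \<in> sigma_sets UNIV ?G"
      using A_G by (intro G.countable_INT G.countable_UN') auto
    finally show "(\<Inter>n. \<Union>m\<in>{n..}. A m) \<in> sigma_sets (space ?E) ?G" by (simp add: sp)
  qed
  have Fsub: "sigma_algebra (space ?E) (?F i)" for i
    by (rule sigma_algebra_sigma_sets) auto
  have "E.prob (\<Inter>n. \<Union>m\<in>{n..}. A m) = 0 \<or> E.prob (\<Inter>n. \<Union>m\<in>{n..}. A m) = 1"
    by (rule E.kolmogorov_0_1_law[OF Fsub ind tail])
  moreover have "E.prob (\<Inter>n. \<Union>m\<in>{n..}. A m) = E.prob {g. P g}"
  proof -
    have "(\<lambda>n. E.prob (\<Union>m\<in>{n..}. A m)) \<longlonglongrightarrow> E.prob (\<Inter>n. \<Union>m\<in>{n..}. A m)"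
    proof (rule E.finite_Lim_measure_decseq)
      show "range (\<lambda>n. \<Union>m\<in>{n..}. A m) \<subseteq> E.events" using A_ev by auto
      show "decseq (\<lambda>n. \<Union>m\<in>{n..}. A m)" unfolding decseq_def by (intro allI impI UN_mono) auto
    qed
    moreover have "E.prob (\<Union>m\<in>{n..}. A m) = E.prob {g. P g}" for n
    proof -
      \<comment> \<open>By \<open>mono\<close>, each \<open>A (Suc m)\<close> is almost surely
        contained in \<open>A m\<close>, so the union is its first member.\<close>
      have "AE g in ?E. g \<in> (\<Union>m\<in>{n..}. A m) \<longleftrightarrow> g \<in> A n"
        using Q(1)
      proof eventually_elim
        case (elim g)
        have Qn: "Q (\<lambda>i. g (i + m))" for m
        proof (induction m)
          case (Suc m)
          from Q(2)[OF this] show ?case by simp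
        qed (use elim in simp)
        have step: "g \<in> A m" if "g \<in> A (Suc m)" for m
          using mono[OF Qn[of m]] that by (simp add: A_def)
        have "g \<in> A n" if "n \<le> m" "g \<in> A m" for m
          using that by (induction m rule: dec_induct) (use step in auto)
        then show ?case by auto
      qed
      then have "E.prob (\<Union>m\<in>{n..}. A m) = E.prob (A n)"
        using A_ev by (intro measure_eq_AE) auto
      then show ?thesis by (simp add: A_prob)
    qed
    ultimately show ?thesis by (simp add: LIMSEQ_const_iff)
  qed
  ultimately have "E.prob {g \<in> space ?E. P g} = 0 \<or> E.prob {g \<in> space ?E. P g} = 1" by (simp add: sp)
  then show ?thesis
  proof
    assume 0: "E.prob {g \<in> space ?E. P g} = 0"
    have "E.prob {g \<in> space ?E. \<not> P g} = 1"
      using E.prob_neg[of P] P_ev 0 by (simp add: sp)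
    then show ?thesis using E.prob_Collect_eq_1[of "\<lambda>g. \<not> P g"] S by simp
  next
    assume "E.prob {g \<in> space ?E. P g} = 1"
    then show ?thesis using E.prob_Collect_eq_1[of P] S by simp
  qed
qed

section \<open>The two phases\<close>

lemma PiM_pos:
  assumes "prob_space D" "AE x in D. (0 :: real) < x"
  shows "AE g in PiM UNIV (\<lambda>_ :: nat. D). \<forall>i. 0 < g i"
  unfolding AE_all_countable using assms by (auto intro!: AE_PiM_component)

lemma indep_vars_PiM_borel:
  assumes "prob_space D" "sets D = sets (borel :: real measure)"
  shows "prob_space.indep_vars (PiM UNIV (\<lambda>_ :: nat. D)) (\<lambda>_. borel) (\<lambda>i g. g i) UNIV"
  by (rule indep_vars_sets_cong[OF prob_space_PiM[OF assms(1)] indep_vars_PiM_reindex[OF assms(1), of "\<lambda>i. i"]])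
    (use assms in auto)

lemma column_percolation_config:
  assumes p: "0 < p" "p < 1" and g: "\<And>i. 0 < g i"
  shows "column_percolation uniforms (\<lambda>e U. config p g U e) (\<lambda>_. - ln (1 - p)) (\<lambda>i. p powr g i)"
proof -
  interpret indep_bools uniforms "\<lambda>e U. config p g U e" by (rule indep_config)
  show ?thesis
  proof unfold_locales
    fix i n
    show "p powr g i \<le> 1" using p g[of i] by (intro powr_le1) auto
    show "Prob (\<lambda>\<omega>. \<omega> (Ver i n)) \<le> 1 - exp (- (- ln (1 - p)))"
      using prob_config[of p g "Ver i n"] p g by simp
    show "Prob (\<lambda>\<omega>. \<omega> (Hor i n)) \<le> p powr g i"
      using prob_config[of p g "Hor i n"] p g by simp
  qed (use p in auto)
qed

text \<open>Presents the dual as a negated injective reindexing of the edges, so independence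
  carries over from the uniform variables.\<close>

definition crossed_edge :: "edge \<Rightarrow> edge" where
  "crossed_edge e = (case e of Hor i n \<Rightarrow> Ver (Suc i) n | Ver i n \<Rightarrow> Hor i (Suc n))"

lemma dual_eq: "dual \<omega> e \<longleftrightarrow> \<not> \<omega> (crossed_edge e)"
  by (cases e) (simp_all add: dual_def crossed_edge_def)

lemma inj_crossed_edge: "inj crossed_edge"
  by (rule injI) (auto simp: crossed_edge_def split: edge.splits)

text \<open>A vertical dual edge of column \<open>i\<close> crosses a horizontal edge of length
  \<open>g i\<close> and is closed with probability \<open>p powr g i\<close>, which is exactly
  \<open>exp (- s i)\<close> for this choice of \<open>s\<close>.\<close>

lemma column_percolation_dual:
  assumes p: "0 < p" "p < 1" and g: "\<And>i. 0 < g i"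
  shows "column_percolation uniforms (\<lambda>e U. dual (config p g U) e) (\<lambda>i. - ln p * g i) (\<lambda>_. 1 - p)"
proof -
  interpret indep_bools uniforms "\<lambda>e U. dual (config p g U) e"
  proof
    show "uniforms.indep_vars (\<lambda>_. count_space UNIV) (\<lambda>e U. dual (config p g U) e) UNIV"
      unfolding dual_eq config_def
      by (rule uniforms.indep_vars_compose2[OF indep_uniforms[OF inj_crossed_edge]]) auto
  qed
  have P: "Prob (\<lambda>\<omega>. \<omega> e) = 1 - p powr edge_length g (crossed_edge e)" for e
  proof -
    have "{U \<in> space uniforms. config p g U (crossed_edge e)} \<in> uniforms.events" by measurable
    from uniforms.prob_neg[OF this] show ?thesis
      using prob_config[of p g "crossed_edge e"] p g by (simp add: dual_eq)
  qed
  show ?thesis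
  proof unfold_locales
    fix i n
    show "0 \<le> - ln p * g i" using p g[of i] by (intro mult_nonneg_nonneg) auto
    show "Prob (\<lambda>\<omega>. \<omega> (Ver i n)) \<le> 1 - exp (- (- ln p * g i))"
      unfolding P using p by (simp add: crossed_edge_def powr_def mult.commute)
    show "Prob (\<lambda>\<omega>. \<omega> (Hor i n)) \<le> 1 - p"
      unfolding P using p by (simp add: crossed_edge_def)
  qed (use p in auto)
qed

lemma (in column_percolation) regular_of_good:
  fixes \<kappa> \<beta> :: real
  assumes r: "5 \<le> r" "r \<le> K" and \<kappa>: "0 \<le> \<kappa>" "\<kappa> \<le> 1 / 256"
    and T: "\<And>K j. T K j \<Longrightarrow> sum s (block K j) \<le> \<kappa> * width K"
    and base: "\<And>j. base j \<Longrightarrow> \<exists>i\<in>block r j. hb i \<le> \<beta>"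
    and \<beta>: "0 \<le> \<beta>" "4 * exp (4 * (\<kappa> * width r)) * \<beta> \<le> exit_bound r"
    and good: "\<And>j. j < 4 * ratio K \<Longrightarrow> good T base r (K - r) j \<and> T K j"
  shows "regular \<kappa> K"
  unfolding regular_def
proof (intro conjI allI impI)
  fix i assume "1 \<le> i \<and> i < 4 * ratio K"
  then show "exits_le (width K) i (exit_bound K)"
    using good_exits_le[OF r(1) \<kappa> T[unfolded block_def] base[unfolded block_def] \<beta>, where B = i and k = "K - r"] good[of "i - 1"] good[of i] r(2)
    by auto
next
  fix j assume "j < 4 * ratio K"
  then show "sum s {j * width K..<Suc j * width K} \<le> \<kappa> * width K"
    using good T unfolding block_def by blast
qed

lemma AE_no_percolation_small_p:
  fixes D :: "real measure"
  assumes D: "prob_space D" "sets D = sets borel" and pos: "AE x in D. 0 < x"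
  shows "\<exists>p. 0 < p \<and> p < 1 \<and> (AE g in PiM UNIV (\<lambda>_. D). perc_prob p g = 0)"
proof -
  interpret D: prob_space D by fact
  let ?E = "PiM UNIV (\<lambda>_ :: nat. D)"
  interpret E: prob_space ?E by (rule prob_space_PiM[OF D(1)])
  obtain r where r: "5 \<le> r" and scales: "\<And>K. r \<le> K \<Longrightarrow> (0 + 1) * real (ratio K) ^ 3 \<le> real (width K) powr 1"
    using ex_base_scale[of 1 0] by auto
  \<comment> \<open>The gaps are almost surely positive, so short ones become as rare as the base
    scale \<open>r\<close>, already fixed, requires.\<close>
  obtain \<delta> :: real where \<delta>: "0 < \<delta>" "D.prob {..<\<delta>} \<le> 1 / width r"
  proof -
    have "(\<lambda>n. D.prob {..<1 / real (Suc n)}) \<longlonglongrightarrow> D.prob (\<Inter>n. {..<1 / real (Suc n)})"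
      by (rule D.finite_Lim_measure_decseq) (auto simp: D(2) decseq_def field_simps intro: less_le_trans)
    moreover have "(\<Inter>n. {..<1 / real (Suc n)}) = {..0::real}"
    proof safe
      fix x :: real assume x: "x \<in> (\<Inter>n. {..<1 / real (Suc n)})"
      show "x \<le> 0"
      proof (rule ccontr)
        assume "\<not> x \<le> 0"
        then obtain n where "inverse (real (Suc n)) < x" using reals_Archimedean[of x] by auto
        then show False using x by (auto simp: inverse_eq_divide dest!: spec[of _ n])
      qed
    qed (auto intro: le_less_trans)
    moreover have "D.prob {..0} = 0"
      using pos by (intro D.prob_eq_0[THEN iffD2]) (auto simp: D(2) elim!: eventually_mono)
    ultimately have "(\<lambda>n. D.prob {..<1 / real (Suc n)}) \<longlonglongrightarrow> 0" by simp
    moreover have "0 < 1 / real (width r)" using width_pos[of r] by simp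
    ultimately have "\<forall>\<^sub>F n in sequentially. D.prob {..<1 / real (Suc n)} < 1 / width r"
      by (rule order_tendstoD(2))
    then obtain n where "D.prob {..<1 / real (Suc n)} < 1 / width r" by (auto simp: eventually_sequentially)
    then show ?thesis by (intro that[of "1 / real (Suc n)"]) auto
  qed
  define \<kappa> :: real where "\<kappa> = 1 / 256"
  define \<beta> where "\<beta> = exit_bound r / (4 * exp (4 * (\<kappa> * width r)))"
  have \<beta>: "0 < \<beta>" "4 * exp (4 * (\<kappa> * width r)) * \<beta> \<le> exit_bound r" by (auto simp: \<beta>_def exit_bound_def)
  \<comment> \<open>The first bound keeps the vertical weight \<open>- ln (1 - p)\<close> below
    \<kappa> per column; the second makes every gap of length at least \<delta> a crossing of
    probability at most \<beta>.\<close>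
  define p where "p = min (1 / 512) (\<beta> powr (1 / \<delta>))"
  have p: "0 < p" "p \<le> 1 / 512" "p < 1" using \<beta> by (auto simp: p_def)
  have p\<delta>: "p powr \<delta> \<le> \<beta>"
  proof -
    have "p powr \<delta> \<le> (\<beta> powr (1 / \<delta>)) powr \<delta>" using p \<delta> by (intro powr_mono2) (auto simp: p_def)
    also have "\<dots> = \<beta>" using \<delta> \<beta> by (simp add: powr_powr)
    finally show ?thesis .
  qed
  have ln_p: "- ln (1 - p) \<le> \<kappa>"
  proof -
    have "- p - 2 * p\<^sup>2 \<le> ln (1 - p)" using p by (intro ln_one_minus_pos_lower_bound) auto
    moreover have "p * p \<le> 1 / 512 * p" using p by (intro mult_right_mono) auto
    ultimately show ?thesis using p unfolding \<kappa>_def power2_eq_square by linarith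
  qed
  interpret env: block_environment ?E "\<lambda>i g. g i" "\<lambda>_ _ _. True" "\<lambda>j g. \<exists>i\<in>block r j. \<delta> \<le> g i" r 1 0
  proof unfold_locales
    show "E.indep_vars (\<lambda>_. borel) (\<lambda>i g. g i) UNIV" by (rule indep_vars_PiM_borel[OF D])
    show "(\<exists>i\<in>block r j. \<delta> \<le> g i) \<longleftrightarrow> (\<exists>i\<in>block r j. \<delta> \<le> g' i)" if "\<And>i. i \<in> block r j \<Longrightarrow> g i = g' i" for j and g g' :: "nat \<Rightarrow> real"
      using that by auto
    show "Measurable.pred (PiM F (\<lambda>_. borel)) (\<lambda>g. \<exists>i\<in>block r j. \<delta> \<le> (g i :: real))" if "block r j \<subseteq> F" for j F
    proof (intro pred_intros_finite finite_block)
      fix i assume "i \<in> block r j"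
      then have [measurable]: "(\<lambda>g. g i) \<in> borel_measurable (PiM F (\<lambda>_. borel :: real measure))"
        using that by (intro measurable_component_singleton) auto
      show "Measurable.pred (PiM F (\<lambda>_. borel)) (\<lambda>g. \<delta> \<le> g i)" by measurable
    qed
    fix j
    \<comment> \<open>A crude bound suffices: if all gaps of the block are short, so is the
      first.\<close>
    have "E.prob {g \<in> space ?E. \<not> ((\<exists>i\<in>block r j. \<delta> \<le> g i) \<and> True)} \<le> E.prob ((\<lambda>g. g (j * width r)) -` {..<\<delta>} \<inter> space ?E)"
    proof (rule E.finite_measure_mono)
      have "j * width r \<in> block r j" using width_pos[of r] by (simp add: block_def)
      then show "{g \<in> space ?E. \<not> ((\<exists>i\<in>block r j. \<delta> \<le> g i) \<and> True)} \<subseteq> (\<lambda>g. g (j * width r)) -` {..<\<delta>} \<inter> space ?E"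
        by (auto simp: not_le)
      show "(\<lambda>g. g (j * width r)) -` {..<\<delta>} \<inter> space ?E \<in> E.events"
        by (rule measurable_sets[of _ _ D]) (auto simp: D(2))
    qed
    also have "\<dots> = measure (distr ?E D (\<lambda>g. g (j * width r))) {..<\<delta>}"
      by (rule measure_distr[symmetric]) (auto simp: D(2))
    also have "distr ?E D (\<lambda>g. g (j * width r)) = D" by (rule distr_PiM_component) (auto intro: D(1))
    also have "D.prob {..<\<delta>} \<le> real (width r) powr - 1" using \<delta>(2) by (simp add: powr_minus_divide)
    finally show "E.prob {g \<in> space ?E. \<not> ((\<exists>i\<in>block r j. \<delta> \<le> g i) \<and> True)} \<le> real (width r) powr - 1" .
  qed (use scales in auto)
  have "AE g in ?E. perc_prob p g = 0"
    using env.AE_eventually_good PiM_pos[OF D(1) pos]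
  proof eventually_elim
    case (elim g)
    then obtain K0 where K0: "r \<le> K0" "\<And>K j. K0 \<le> K \<Longrightarrow> j < 4 * ratio K \<Longrightarrow> env.gd (K - r) j g" by blast
    interpret column_percolation uniforms "\<lambda>e U. config p g U e" "\<lambda>_. - ln (1 - p)" "\<lambda>i. p powr g i"
      by (rule column_percolation_config) (use p elim in auto)
    have "regular \<kappa> K" if K: "K0 \<le> K" for K
    proof (rule regular_of_good[where T = "\<lambda>_ _. True" and base = "\<lambda>j. \<exists>i\<in>block r j. \<delta> \<le> g i" and r = r and \<beta> = \<beta>])
      show "\<exists>i\<in>block r j. p powr g i \<le> \<beta>" if "\<exists>i\<in>block r j. \<delta> \<le> g i" for j
      proof -
        obtain i where i: "i \<in> block r j" "\<delta> \<le> g i" using \<open>\<exists>i\<in>block r j. \<delta> \<le> g i\<close> by blast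
        have "p powr g i \<le> p powr \<delta>" using i p by (intro powr_mono') auto
        then show ?thesis using i p\<delta> by (intro bexI[of _ i]) auto
      qed
      show "(\<Sum>i\<in>block K j. - ln (1 - p)) \<le> \<kappa> * width K" for K j
        using mult_right_mono[OF ln_p, of "width K"] by (simp add: card_block mult.commute)
    qed (use r K K0 \<beta> in \<open>auto simp: env.gd_def \<kappa>_def\<close>)
    from Prob_infinite_cluster_eq_0_regular[OF _ _ this] show ?case
      by (simp add: perc_prob_def \<kappa>_def)
  qed
  then show ?thesis using p by blast
qed

lemma AE_percolation_large_p:
  fixes D :: "real measure" and \<eta> :: real
  assumes D: "prob_space D" "sets D = sets borel" and pos: "AE x in D. 0 < x"
    and \<eta>: "1 < \<eta>" "\<eta> \<le> 2" and int: "integrable D (\<lambda>x. \<bar>x\<bar> powr \<eta>)"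
  shows "\<exists>p. 0 < p \<and> p < 1 \<and> (AE g in PiM UNIV (\<lambda>_. D). 0 < perc_prob p g)"
proof -
  interpret D: prob_space D by fact
  let ?E = "PiM UNIV (\<lambda>_ :: nat. D)"
  interpret E: prob_space ?E by (rule prob_space_PiM[OF D(1)])
  define m where "m = D.expectation (\<lambda>x. \<bar>x\<bar> powr \<eta>)"
  have m: "0 \<le> m" unfolding m_def by (intro integral_nonneg_AE) auto
  define \<alpha> where "\<alpha> = (\<eta> - 1) / 2"
  have \<alpha>: "0 < \<alpha>" "\<alpha> \<le> 1" "1 - \<eta> = - (2 * \<alpha>)" using \<eta> by (auto simp: \<alpha>_def field_simps)
  obtain r where r: "5 \<le> r" and scales: "\<And>K. r \<le> K \<Longrightarrow> (2 * m + 1) * real (ratio K) ^ 3 \<le> real (width K) powr \<alpha>"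
    using ex_base_scale[OF \<alpha>(1), of "2 * m"] m by auto
  define T where "T K j g \<longleftrightarrow> (\<Sum>i\<in>block K j. \<bar>g i :: real\<bar>) \<le> (m + 2) * width K" for K j g
  have distr_E: "distr ?E D (\<lambda>g. g i) = D" for i by (rule distr_PiM_component) (auto intro: D(1))
  have comp_E: "(\<lambda>g. g i) \<in> measurable ?E D" for i by simp
  have comp_borel [measurable]: "(\<lambda>g. g i) \<in> borel_measurable ?E" for i
    using comp_E[of i] measurable_cong_sets[OF refl D(2)] by blast
  have T_prob: "E.prob {g \<in> space ?E. \<not> T K j g} \<le> 2 * m * real (width K) powr (- (2 * \<alpha>))" for K j
  proof -
    have "(\<lambda>x. \<bar>x\<bar> powr \<eta>) \<in> borel_measurable D" using int by auto
    then have "integrable (distr ?E D (\<lambda>g. g i)) (\<lambda>x. \<bar>x\<bar> powr \<eta>)" for i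
      using int unfolding distr_E by simp
    then have intE: "integrable ?E (\<lambda>g. \<bar>g i\<bar> powr \<eta>)" for i
      by (rule integrable_distr[OF comp_E])
    have expE: "E.expectation (\<lambda>g. \<bar>g i\<bar> powr \<eta>) = m" for i
    proof -
      have "m = integral\<^sup>L (distr ?E D (\<lambda>g. g i)) (\<lambda>x. \<bar>x\<bar> powr \<eta>)" unfolding distr_E m_def ..
      also have "\<dots> = E.expectation (\<lambda>g. \<bar>g i\<bar> powr \<eta>)"
        by (rule integral_distr[OF comp_E]) (use int in auto)
      finally show ?thesis ..
    qed
    have ind: "E.indep_vars (\<lambda>_. borel) (\<lambda>i g. \<bar>g i\<bar>) (block K j)"
      by (rule E.indep_vars_subset[OF E.indep_vars_compose2[OF indep_vars_PiM_borel[OF D]]]) auto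
    have "block K j \<noteq> {}" using card_block[of K j] width_pos[of K] by auto
    from E.prob_sum_large_le[OF finite_block this ind _ \<eta> intE, of m] expE
    show ?thesis unfolding T_def not_le card_block \<alpha>(3) by simp
  qed
  interpret env: block_environment ?E "\<lambda>i g. g i" T "\<lambda>_ _. True" r \<alpha> "2 * m"
  proof unfold_locales
    show "E.indep_vars (\<lambda>_. borel) (\<lambda>i g. g i) UNIV" by (rule indep_vars_PiM_borel[OF D])
    show "T K j g \<longleftrightarrow> T K j g'" if "\<And>i. i \<in> block K j \<Longrightarrow> g i = g' i" for K j g g'
      unfolding T_def using that by simp
    show "Measurable.pred (PiM F (\<lambda>_. borel)) (T K j)" if "block K j \<subseteq> F" for K j F
    proof -
      have "(\<lambda>g. g i) \<in> borel_measurable (PiM F (\<lambda>_. borel :: real measure))" if "i \<in> block K j" for i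
        using that \<open>block K j \<subseteq> F\<close> by (intro measurable_component_singleton) auto
      then have "(\<lambda>g. \<Sum>i\<in>block K j. \<bar>g i\<bar>) \<in> borel_measurable (PiM F (\<lambda>_. borel :: real measure))"
        by (intro borel_measurable_sum borel_measurable_abs)
      then show ?thesis unfolding T_def[abs_def] by measurable
    qed
    show "E.prob {g \<in> space ?E. \<not> T K j g} \<le> 2 * m * real (width K) powr (- (2 * \<alpha>))" for K j
      by (rule T_prob)
    show "E.prob {g \<in> space ?E. \<not> (True \<and> T r j g)} \<le> real (width r) powr (- \<alpha>)" for j
    proof -
      have 1: "1 \<le> real (ratio r) ^ 3" using ratio_pos[of r] by (intro one_le_power) (simp add: Suc_leI)
      \<comment> \<open>The large-deviation bound at scale \<open>r\<close> already is small enough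
        for the base, because \<open>scales\<close> makes \<open>2 * m\<close> at most
        \<open>width r powr \<alpha>\<close>.\<close>
      have "2 * m \<le> (2 * m + 1) * 1" by simp
      also have "\<dots> \<le> (2 * m + 1) * real (ratio r) ^ 3" using 1 m by (intro mult_left_mono) auto
      also have "\<dots> \<le> real (width r) powr \<alpha>" by (rule scales) simp
      finally have "2 * m * real (width r) powr (- (2 * \<alpha>)) \<le> real (width r) powr \<alpha> * real (width r) powr (- (2 * \<alpha>))"
        by (intro mult_right_mono) auto
      also have "\<dots> = real (width r) powr (- \<alpha>)" by (simp add: powr_add[symmetric])
      finally show ?thesis using T_prob[of r j] by simp
    qed
  qed (use \<alpha> m scales in auto)
  define \<kappa> :: real where "\<kappa> = 1 / 256"
  define \<beta> where "\<beta> = exit_bound r / (4 * exp (4 * (\<kappa> * width r)))"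
  have \<beta>: "0 < \<beta>" "4 * exp (4 * (\<kappa> * width r)) * \<beta> \<le> exit_bound r" by (auto simp: \<beta>_def exit_bound_def)
  \<comment> \<open>With \<open>p = exp (- \<epsilon>)\<close> the dual sums are \<epsilon> times
    sums of gaps, at most \<kappa> per column on blocks where \<open>T\<close> holds, and the dual
    horizontal probability \<open>1 - p\<close> is at most \<epsilon>, hence at most
    \<beta>.\<close>
  define \<epsilon> where "\<epsilon> = min (\<kappa> / (m + 2)) \<beta>"
  define p where "p = exp (- \<epsilon>)"
  have \<epsilon>: "0 < \<epsilon>" "\<epsilon> * (m + 2) \<le> \<kappa>" "\<epsilon> \<le> \<beta>" using \<beta> m by (auto simp: \<epsilon>_def \<kappa>_def min_def field_simps)
  have p: "0 < p" "p < 1" "- ln p = \<epsilon>" "1 - p \<le> \<beta>"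
    using \<epsilon> exp_ge_add_one_self[of "- \<epsilon>"] by (auto simp: p_def)
  have "AE g in ?E. 0 < perc_prob p g"
    using env.AE_eventually_good PiM_pos[OF D(1) pos]
  proof eventually_elim
    case (elim g)
    then obtain K0 where K0: "r \<le> K0" "\<And>K j. K0 \<le> K \<Longrightarrow> j < 4 * ratio K \<Longrightarrow> env.gd (K - r) j g \<and> T K j g" by blast
    have g: "0 < g i" for i using elim by simp
    interpret column_percolation uniforms "\<lambda>e U. dual (config p g U) e" "\<lambda>i. - ln p * g i" "\<lambda>_. 1 - p"
      by (rule column_percolation_dual) (use p g in auto)
    have R: "regular \<kappa> K" if K: "K0 \<le> K" for K
    proof (rule regular_of_good[where T = "\<lambda>K j. T K j g" and base = "\<lambda>_. True" and r = r and \<beta> = \<beta>])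
      show "(\<Sum>i\<in>block K j. - ln p * g i) \<le> \<kappa> * width K" if "T K j g" for K j
      proof -
        have "(\<Sum>i\<in>block K j. - ln p * g i) = \<epsilon> * (\<Sum>i\<in>block K j. \<bar>g i\<bar>)"
          unfolding p(3) using g by (simp add: sum_distrib_left abs_of_pos)
        also have "\<dots> \<le> \<epsilon> * ((m + 2) * width K)" using that \<epsilon> unfolding T_def by (intro mult_left_mono) auto
        also have "\<dots> \<le> \<kappa> * width K" using mult_right_mono[OF \<epsilon>(2), of "width K"] by (simp add: mult.assoc)
        finally show ?thesis .
      qed
      show "\<exists>i\<in>block r j. 1 - p \<le> \<beta>" for j
        using p(4) card_block[of r j] width_pos[of r] by (intro bexI[of _ "j * width r"]) (auto simp: block_def)
    qed (use r K K0 \<beta> in \<open>auto simp: env.gd_def \<kappa>_def\<close>)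
    let ?reach = "\<lambda>U n. \<exists>v. ((0, n), (v, 0)) \<in> (open_adj (\<lambda>e. dual (config p g U) e))\<^sup>*"
    have "summable (\<lambda>n. Prob (\<lambda>\<omega>. \<exists>v. ((0, n), (v, 0)) \<in> (open_adj \<omega>)\<^sup>*))"
      by (rule Prob_reach_row_summable[OF _ _ R]) (auto simp: \<kappa>_def)
    then have sum: "summable (\<lambda>n. uniforms.prob {U. ?reach U n})" by simp
    \<comment> \<open>From \<open>n0\<close> on, dual paths from the left side to the bottom row
      have total probability below 1/2.\<close>
    from suminf_exist_split[OF _ this, of "1 / 2"] obtain n0
      where n0: "\<bar>\<Sum>i. uniforms.prob {U. ?reach U (i + n0)}\<bar> < 1 / 2" by auto
    have reach_ev: "{U. ?reach U n} \<in> uniforms.events" for n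
    proof -
      have "Measurable.pred uniforms (\<lambda>U. ?reach U n)"
        by (intro pred_intros_countable pred_open_rtrancl rv_X)
      then show ?thesis by (simp add: pred_def)
    qed
    \<comment> \<open>The dual is unfolded to display that only edges in
      \<open>range crossed_edge\<close> are read. This set contains no \<open>Ver 0 k\<close>, so
      \<open>?B\<close> is independent of opening the first \<open>n0\<close> edges of column
      0.\<close>
    let ?B = "\<lambda>U. \<exists>i v. ((0, i + n0), (v, 0)) \<in> (open_adj (\<lambda>e. \<not> U (crossed_edge e) < p powr edge_length g (crossed_edge e)))\<^sup>*"
    let ?A = "\<lambda>U. \<forall>k<n0. U (Ver 0 k) < p powr 1"
    have B_eq: "?B U \<longleftrightarrow> (\<exists>i. ?reach U (i + n0))" for U
      unfolding dual_eq config_def ..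
    have B_le: "uniforms.prob {U. ?B U} \<le> 1 / 2"
    proof -
      have "uniforms.prob {U. ?B U} = uniforms.prob (\<Union>i. {U. ?reach U (i + n0)})"
        unfolding B_eq by (rule arg_cong[where f = uniforms.prob]) auto
      also have "\<dots> \<le> (\<Sum>i. uniforms.prob {U. ?reach U (i + n0)})"
        using reach_ev summable_ignore_initial_segment[OF sum, of n0]
        by (intro uniforms.finite_measure_subadditive_countably) auto
      finally show ?thesis using n0 by linarith
    qed
    have B_meas: "Measurable.pred N ?B" if "\<And>e. e \<in> range crossed_edge \<Longrightarrow> (\<lambda>U. U e) \<in> borel_measurable N" for N
    proof (intro pred_intros_countable pred_open_rtrancl)
      fix e
      have [measurable]: "(\<lambda>U. U (crossed_edge e)) \<in> borel_measurable N" using that by auto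
      show "Measurable.pred N (\<lambda>U. \<not> U (crossed_edge e) < p powr edge_length g (crossed_edge e))" by measurable
    qed
    have B_ev: "{U \<in> space uniforms. ?B U} \<in> uniforms.events"
      by (rule predE[OF B_meas]) (rule measurable_uniforms)
    have A_prob: "uniforms.prob {U. ?A U} = p ^ n0"
    proof -
      interpret c: indep_bools uniforms "\<lambda>e U. config p g U e" by (rule indep_config)
      have "c.Prob (\<lambda>\<omega>. \<forall>k<n. \<omega> (Ver 0 k)) = p ^ n" for n
      proof (induction n)
        case (Suc n)
        have "c.Prob (\<lambda>\<omega>. \<forall>k<Suc n. \<omega> (Ver 0 k)) = c.Prob (\<lambda>\<omega>. (\<forall>k<n. \<omega> (Ver 0 k)) \<and> \<omega> (Ver 0 n))"
          by (rule arg_cong[where f = uniforms.prob]) (auto simp: less_Suc_eq)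
        also have "\<dots> = c.Prob (\<lambda>\<omega>. \<forall>k<n. \<omega> (Ver 0 k)) * c.Prob (\<lambda>\<omega>. \<omega> (Ver 0 n))"
          by (rule c.Prob_conj_dep_on[of "Ver 0 ` {..<n}" "{Ver 0 n}"]) (auto simp: dep_on_def)
        also have "c.Prob (\<lambda>\<omega>. \<omega> (Ver 0 n)) = p" using prob_config[of p g "Ver 0 n"] p g by simp
        finally show ?case using Suc by simp
      qed (simp add: uniforms.prob_space[simplified])
      then show ?thesis by (simp add: config_def)
    qed
    have "uniforms.prob {U \<in> space uniforms. ?A (\<lambda>e\<in>Ver 0 ` {..<n0}. U e) \<and> \<not> ?B (\<lambda>e\<in>range crossed_edge. U e)} =
      uniforms.prob {U \<in> space uniforms. ?A (\<lambda>e\<in>Ver 0 ` {..<n0}. U e)} *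
      uniforms.prob {U \<in> space uniforms. \<not> ?B (\<lambda>e\<in>range crossed_edge. U e)}"
    proof (rule uniforms.prob_indep_measurable[OF indep_uniforms[of "\<lambda>e. e"]])
      show "Ver 0 ` {..<n0} \<inter> range crossed_edge = {}" by (auto simp: crossed_edge_def split: edge.splits)
      have "Measurable.pred (PiM (Ver 0 ` {..<n0}) (\<lambda>_. borel :: real measure)) (\<lambda>U. \<forall>k\<in>{..<n0}. U (Ver 0 k) < p powr 1)"
        by (intro pred_intros_finite borel_measurable_pred_less measurable_component_singleton) auto
      from predE[OF this] show "{U \<in> space (PiM (Ver 0 ` {..<n0}) (\<lambda>_. borel)). ?A U} \<in> sets (PiM (Ver 0 ` {..<n0}) (\<lambda>_. borel :: real measure))"
        by (simp add: Ball_def)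
      have "Measurable.pred (PiM (range crossed_edge) (\<lambda>_. borel :: real measure)) ?B"
        by (rule B_meas) (rule measurable_component_singleton)
      then show "{U \<in> space (PiM (range crossed_edge) (\<lambda>_. borel)). \<not> ?B U} \<in> sets (PiM (range crossed_edge) (\<lambda>_. borel :: real measure))"
        by (intro predE pred_intros_logic)
    qed auto
    then have e1: "uniforms.prob {U. ?A U \<and> \<not> ?B U} = uniforms.prob {U. ?A U} * uniforms.prob {U. \<not> ?B U}"
      by simp
    have e2: "uniforms.prob {U. \<not> ?B U} = 1 - uniforms.prob {U. ?B U}"
      using uniforms.prob_neg[OF B_ev] by simp
    have eq: "uniforms.prob {U. ?A U \<and> \<not> ?B U} = p ^ n0 * (1 - uniforms.prob {U. ?B U})"
      by (simp only: e1 e2 A_prob)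
    have "p ^ n0 * (1 / 2) \<le> uniforms.prob {U. ?A U \<and> \<not> ?B U}"
      unfolding eq by (rule mult_left_mono) (use B_le p in auto)
    also have "\<dots> \<le> perc_prob p g"
      unfolding perc_prob_def
    proof (rule uniforms.finite_measure_mono[OF _ events_percolation], rule subsetI)
      fix U assume U: "U \<in> {U. ?A U \<and> \<not> ?B U}"
      show "U \<in> {U. infinite (open_cluster (config p g U) (0, 0))}"
      proof (rule ccontr)
        assume "U \<notin> {U. infinite (open_cluster (config p g U) (0, 0))}"
        then have "finite (open_cluster (config p g U) (0, 0))" by simp
        from dual_path_of_finite_cluster[OF this, of n0] U
        obtain n v where "n0 \<le> n" "((0, n), (v, 0)) \<in> (open_adj (dual (config p g U)))\<^sup>*"
          by (auto simp: config_def)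
        then have "?reach U (n - n0 + n0)" by auto
        then show False using U B_eq[of U] by blast
      qed
    qed
    finally have "p ^ n0 * (1 / 2) \<le> perc_prob p g" .
    moreover have "0 < p ^ n0 * (1 / 2)" using p by simp
    ultimately show ?case by (rule less_le_trans[rotated])
  qed
  then show ?thesis using p by blast
qed

theorem theorem1p1:
  fixes M :: "'a measure" and \<xi> :: "'a \<Rightarrow> real" and \<eta> :: real
  assumes "prob_space M"
    and "\<xi> \<in> borel_measurable M"
    and "AE \<omega> in M. 0 < \<xi> \<omega>"
    and "1 < \<eta>"
    and "(\<integral>\<^sup>+ \<omega>. ennreal (\<xi> \<omega> powr \<eta>) \<partial>M) < \<infinity>"
  shows "\<exists>p\<^sub>c. 0 < p\<^sub>c \<and> p\<^sub>c < 1 \<and>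
     (\<forall>p. 0 \<le> p \<and> p < p\<^sub>c \<longrightarrow>
        (AE g in env_law M \<xi>. measure (perc_measure p g) origin_percolates = 0)) \<and>
     (\<forall>p. p\<^sub>c < p \<and> p \<le> 1 \<longrightarrow>
        (AE g in env_law M \<xi>. measure (perc_measure p g) origin_percolates > 0))"
proof -
  interpret M: prob_space M by fact
  define D where "D = distr M borel \<xi>"
  have [measurable]: "\<xi> \<in> borel_measurable M" by fact
  have D: "prob_space D" "sets D = sets borel" unfolding D_def by (auto intro: M.prob_space_distr)
  have posD: "AE x in D. 0 < x" unfolding D_def using assms(3) by (subst AE_distr_iff) auto
  \<comment> \<open>The truncated second moment argument wants an exponent of at most 2; lowering
    the exponent is harmless as
    \<open>\<xi> x powr \<theta> \<le> 1 + \<xi> x powr \<eta>\<close>.\<close>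
  define \<theta> where "\<theta> = min \<eta> 2"
  have \<theta>: "1 < \<theta>" "\<theta> \<le> 2" "\<theta> \<le> \<eta>" using assms(4) by (auto simp: \<theta>_def)
  have intD: "integrable D (\<lambda>x. \<bar>x\<bar> powr \<theta>)"
  proof -
    have "integrable M (\<lambda>x. \<xi> x powr \<eta>)"
      using assms(5) by (intro integrableI_nonneg) auto
    then have "integrable M (\<lambda>x. 1 + \<xi> x powr \<eta>)" by simp
    then have "integrable M (\<lambda>x. \<bar>\<xi> x\<bar> powr \<theta>)"
    proof (rule Bochner_Integration.integrable_bound)
      show "AE x in M. norm (\<bar>\<xi> x\<bar> powr \<theta>) \<le> norm (1 + \<xi> x powr \<eta>)"
        using assms(3)
      proof eventually_elim
        case (elim x)
        have "\<xi> x powr \<theta> \<le> 1 + \<xi> x powr \<eta>"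
        proof (cases "\<xi> x \<le> 1")
          case True
          then have "\<xi> x powr \<theta> \<le> 1" using elim \<theta> by (intro powr_le1) auto
          then show ?thesis by (simp add: add_increasing2)
        next
          case False
          then have "\<xi> x powr \<theta> \<le> \<xi> x powr \<eta>" using \<theta> by (intro powr_mono) auto
          then show ?thesis by simp
        qed
        then show ?case using elim by simp
      qed
    qed measurable
    then show ?thesis unfolding D_def by (subst integrable_distr_eq) auto
  qed
  let ?E = "PiM UNIV (\<lambda>_ :: nat. D)"
  interpret E: prob_space ?E by (rule prob_space_PiM[OF D(1)])
  have env: "env_law M \<xi> = ?E" by (simp add: env_law_def D_def)
  note pos = PiM_pos[OF D(1) posD]
  have setsE: "sets ?E = sets (PiM UNIV (\<lambda>_ :: nat. borel))" using D(2) by (intro sets_PiM_cong) auto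
  have eq: "AE g in ?E. measure (perc_measure p g) origin_percolates = perc_prob p g" if "0 \<le> p" "p \<le> 1" for p
    using pos by eventually_elim (use that in \<open>auto intro: perc_measure_eq_perc_prob\<close>)
  obtain a where a: "0 < a" "a < 1" "AE g in ?E. perc_prob a g = 0"
    using AE_no_percolation_small_p[OF D posD] by blast
  obtain b where b: "0 < b" "b < 1" "AE g in ?E. 0 < perc_prob b g"
    using AE_percolation_large_p[OF D posD \<theta>(1,2) intD] by blast
  \<comment> \<open>The coupling makes \<open>Z\<close> an initial segment of the unit interval; it
    contains \<open>a > 0\<close> and is bounded by \<open>b < 1\<close>, so its supremum is a
    threshold strictly inside.\<close>
  define Z where "Z = {p. 0 \<le> p \<and> p \<le> 1 \<and> (AE g in ?E. perc_prob p g = 0)}"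
  have mono: "AE g in ?E. perc_prob p g \<le> perc_prob p' g" if "0 \<le> p" "p \<le> p'" for p p'
    using pos by eventually_elim (use that in \<open>auto intro: perc_prob_mono\<close>)
  have Z_down: "AE g in ?E. perc_prob p g = 0" if "0 \<le> p" "p \<le> p'" "p' \<in> Z" for p p'
  proof -
    have "AE g in ?E. perc_prob p' g = 0" using that by (simp add: Z_def)
    with mono[OF that(1,2)] show ?thesis
    proof eventually_elim
      case (elim g)
      then show ?case using measure_nonneg[of uniforms] by (simp add: perc_prob_def antisym)
    qed
  qed
  have Z_le: "p \<le> b" if "p \<in> Z" for p
  proof (rule ccontr)
    assume "\<not> p \<le> b"
    then have "AE g in ?E. perc_prob b g = 0" using Z_down[of b p] b that by auto
    with b(3) have "AE g in ?E. False" by eventually_elim simp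
    then show False by simp
  qed
  have bdd: "bdd_above Z" by (rule bdd_aboveI[of _ b]) (rule Z_le)
  have aZ: "a \<in> Z" using a by (simp add: Z_def)
  define pc where "pc = Sup Z"
  have "0 < pc" using cSup_upper[OF aZ bdd] a by (simp add: pc_def)
  moreover have "pc < 1" using cSup_least[of Z b] aZ Z_le b by (force simp: pc_def)
  moreover have "AE g in ?E. measure (perc_measure p g) origin_percolates = 0" if p: "0 \<le> p" "p < pc" for p
  proof -
    obtain p' where p': "p' \<in> Z" "p < p'"
      using less_cSup_iff[of Z p] aZ bdd p by (auto simp: pc_def)
    then have "p \<le> 1" by (simp add: Z_def)
    from eq[OF p(1) this] Z_down[of p p'] p p' show ?thesis by (auto elim: eventually_elim2)
  qed
  moreover have "AE g in ?E. 0 < measure (perc_measure p g) origin_percolates" if p: "pc < p" "p \<le> 1" for p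
  proof -
    have p0: "0 < p" using p \<open>0 < pc\<close> by simp
    \<comment> \<open>Not being in \<open>Z\<close> only says that percolation has positive
      probability on a set of environments of positive measure; the zero-one law upgrades this to
      almost every environment.\<close>
    have nZ: "p \<notin> Z" using cSup_upper[OF _ bdd, of p] p by (auto simp: pc_def)
    have "(AE g in ?E. 0 < perc_prob p g) \<or> (AE g in ?E. \<not> 0 < perc_prob p g)"
    proof (rule PiM_shift_zero_one[OF D])
      show "Measurable.pred ?E (\<lambda>g. 0 < perc_prob p g)" by (rule perc_prob_measurable[OF setsE])
      show "0 < perc_prob p g" if "\<forall>i. 0 < g i" "0 < perc_prob p (\<lambda>i. g (Suc i))" for g
        using perc_prob_shift_pos[OF p0 p(2), of g] that by simp
    qed (use pos in auto)
    moreover have "\<not> (AE g in ?E. \<not> 0 < perc_prob p g)"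
    proof
      assume "AE g in ?E. \<not> 0 < perc_prob p g"
      then have "AE g in ?E. perc_prob p g = 0"
        by eventually_elim (simp add: perc_prob_def measure_le_0_iff not_less)
      then show False using nZ p p0 by (simp add: Z_def)
    qed
    ultimately have "AE g in ?E. 0 < perc_prob p g" by blast
    with eq[OF less_imp_le[OF p0] p(2)] show ?thesis by eventually_elim simp
  qed
  ultimately show ?thesis unfolding env by blast
qed

end
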